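(* Let $k\ge0$ and let $\mathcal G$ be the set of $V\in C^k_{sym}(M\times M)$ such that every fixed point of $\Pi_V$ is nondegenerate. Then $\mathcal G$ is open and dense in $C^k_{sym}(M\times M)$.
   Context: $M$ is a $C^\infty$, $d$-dimensional, compact connected Riemannian manifold without boundary, $\lambda$ is the Riemannian probability measure on $M$. $C^k_{sym}(M\times M)$ is the Banach space of $C^k$ symmetric functions $V:M\times M\to\mathbb R$ ($V(x,y)=V(y,x)$), endowed with the topology of $C^k$ convergence. For a bounded Borel measure $\mu$, $V\mu(x)=\int_MV(x,y)\mu(dy)$; for $g\in L^2(\lambda)$, $Vg=V(g\lambda)$. For $f\in C^0(M)$, $\xi(f)(x)=e^{-f(x)}/\int_Me^{-f(y)}\lambda(dy)$. $\Pi_V:\mathcal P(M)\to\mathcal P(M)$ is the map $\Pi_V(\mu)=\xi(V\mu)\lambda$ on Borel probability measures. Write $\langle u,v\rangle_\lambda=\int_M uv\,d\lambda$ and $\mathcal B_0=\{f\in C^0(M):\langle f,\mathbf 1\rangle_\lambda=0\}$. For a positive $f\in C^0(M)$ with $\int f\,d\lambda=1$, let $\mathsf T(f)h=fh-\langle f,h\rangle_\lambda f$ for $h\in C^0(M)$. A fixed point $\mu$ of $\Pi_V$ has a continuous positive density $f$ with respect to $\lambda$, and $\mu$ is called nondegenerate if the only $u\in\mathcal B_0$ with $u+\mathsf T(f)(Vu)=0$ is $u=0$. *)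

theory Defs
  imports "HOL-Probability.Probability"
begin

section \<open>Functions of class \<open>C\<^sup>k\<close> on open subsets of Euclidean spaces\<close>

text \<open>Only meaningful for open \<open>S\<close>: derivatives are taken in the full space.\<close>

primrec Ck_on :: "nat \<Rightarrow> ('e::euclidean_space \<Rightarrow> 'b::real_normed_vector) \<Rightarrow> 'e set \<Rightarrow> bool" where
  "Ck_on 0 f S \<longleftrightarrow> continuous_on S f"
| "Ck_on (Suc k) f S \<longleftrightarrow> (\<forall>x\<in>S. f differentiable (at x)) \<and>
     (\<forall>b\<in>Basis. Ck_on k (\<lambda>x. frechet_derivative f (at x) b) S)"

definition smooth_on :: "('e::euclidean_space \<Rightarrow> 'b::real_normed_vector) \<Rightarrow> 'e set \<Rightarrow> bool" where
  "smooth_on f S \<longleftrightarrow> (\<forall>k. Ck_on k f S)"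

primrec iter_pderiv :: "'e list \<Rightarrow> ('e::euclidean_space \<Rightarrow> 'b::real_normed_vector) \<Rightarrow> 'e \<Rightarrow> 'b" where
  "iter_pderiv [] f = f"
| "iter_pderiv (b # bs) f = iter_pderiv bs (\<lambda>x. frechet_derivative f (at x) b)"

section \<open>Smooth manifolds\<close>

text \<open>A manifold is the whole of a topological type together with a smooth atlas, which need
  not be maximal. The second component of a chart is only relevant on the first one.\<close>

type_synonym ('m, 'e) chart = "'m set \<times> ('m \<Rightarrow> 'e)"

definition chart_inv :: "('m, 'e) chart \<Rightarrow> 'e \<Rightarrow> 'm" where
  "chart_inv c = inv_into (fst c) (snd c)"

definition is_chart :: "('m::topological_space, 'e::euclidean_space) chart \<Rightarrow> bool" where
  "is_chart c \<longleftrightarrow> open (fst c) \<and> open (snd c ` fst c) \<and>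
     homeomorphism (fst c) (snd c ` fst c) (snd c) (chart_inv c)"

definition transition :: "('m, 'e) chart \<Rightarrow> ('m, 'e) chart \<Rightarrow> 'e \<Rightarrow> 'e" where
  "transition c c' = snd c' \<circ> chart_inv c"

definition smooth_atlas :: "('m::topological_space, 'e::euclidean_space) chart set \<Rightarrow> bool" where
  "smooth_atlas A \<longleftrightarrow> (\<forall>c\<in>A. is_chart c) \<and> (\<Union>c\<in>A. fst c) = UNIV \<and>
     (\<forall>c\<in>A. \<forall>c'\<in>A. smooth_on (transition c c') (snd c ` (fst c \<inter> fst c')))"

definition prod_atlas :: "('m, 'e) chart set \<Rightarrow> ('n, 'f) chart set \<Rightarrow> ('m \<times> 'n, 'e \<times> 'f) chart set" where
  "prod_atlas A B = {(U \<times> U', map_prod \<phi> \<psi>) | U \<phi> U' \<psi>. (U, \<phi>) \<in> A \<and> (U', \<psi>) \<in> B}"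

definition Ck_functions :: "nat \<Rightarrow> ('m::topological_space, 'e::euclidean_space) chart set \<Rightarrow> ('m \<Rightarrow> real) set" where
  "Ck_functions k A = {f. \<forall>c\<in>A. Ck_on k (f \<circ> chart_inv c) (snd c ` fst c)}"

text \<open>Uniform convergence, on compact subsets of chart images, of all partial derivatives of
  order at most \<open>k\<close>.\<close>

definition Ck_nbhd :: "nat \<Rightarrow> ('m::topological_space, 'e::euclidean_space) chart set \<Rightarrow>
    ('m \<Rightarrow> real) \<Rightarrow> ('m, 'e) chart \<Rightarrow> 'e set \<Rightarrow> 'e list \<Rightarrow> real \<Rightarrow> ('m \<Rightarrow> real) set" where
  "Ck_nbhd k A f c K bs \<epsilon> = {h \<in> Ck_functions k A.
     \<forall>x\<in>K. \<bar>iter_pderiv bs (h \<circ> chart_inv c) x - iter_pderiv bs (f \<circ> chart_inv c) x\<bar> < \<epsilon>}"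

definition Ck_topology :: "nat \<Rightarrow> ('m::topological_space, 'e::euclidean_space) chart set \<Rightarrow> ('m \<Rightarrow> real) topology" where
  "Ck_topology k A = topology_generated_by
     {Ck_nbhd k A f c K bs \<epsilon> | f c K bs \<epsilon>. f \<in> Ck_functions k A \<and> c \<in> A \<and>
        compact K \<and> K \<subseteq> snd c ` fst c \<and> set bs \<subseteq> Basis \<and> length bs \<le> k \<and> \<epsilon> > 0}"

definition Ck_sym :: "nat \<Rightarrow> ('m::topological_space, 'e::euclidean_space) chart set \<Rightarrow> ('m \<times> 'm \<Rightarrow> real) set" where
  "Ck_sym k A = {V \<in> Ck_functions k (prod_atlas A A). \<forall>x y. V (x, y) = V (y, x)}"

definition Ck_sym_topology :: "nat \<Rightarrow> ('m::topological_space, 'e::euclidean_space) chart set \<Rightarrow> ('m \<times> 'm \<Rightarrow> real) topology" where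
  "Ck_sym_topology k A = subtopology (Ck_topology k (prod_atlas A A)) (Ck_sym k A)"

lemma topspace_Ck_topology:
  assumes "A \<noteq> {}"
  shows "topspace (Ck_topology k A) = Ck_functions k A"
proof -
  obtain c where c: "c \<in> A" using assms by blast
  define S where "S = {Ck_nbhd k A f c K bs \<epsilon> | f c K bs \<epsilon>. f \<in> Ck_functions k A \<and> c \<in> A \<and>
        compact K \<and> K \<subseteq> snd c ` fst c \<and> set bs \<subseteq> Basis \<and> length bs \<le> k \<and> \<epsilon> > 0}"
  have nb: "Ck_nbhd k A f c K bs \<epsilon> \<subseteq> Ck_functions k A" for f c K bs \<epsilon>
    unfolding Ck_nbhd_def by (rule Collect_subset)
  have "X \<subseteq> Ck_functions k A" if "X \<in> S" for X
    using that nb unfolding S_def by (elim CollectE exE conjE) metis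
  moreover have "f \<in> \<Union>S" if f: "f \<in> Ck_functions k A" for f
  proof (rule UnionI)
    show "Ck_nbhd k A f c {} [] 1 \<in> S"
      unfolding S_def
      by (rule CollectI, rule exI[of _ f], rule exI[of _ c], rule exI[of _ "{}"],
          rule exI[of _ "[]"], rule exI[of _ 1]) (simp add: f c)
    show "f \<in> Ck_nbhd k A f c {} [] 1" using f by (simp add: Ck_nbhd_def)
  qed
  ultimately have "\<Union>S = Ck_functions k A" by (intro equalityI subsetI) (meson UnionE subsetD)+
  then show ?thesis unfolding Ck_topology_def S_def topology_generated_by_topspace .
qed

lemma topspace_Ck_sym_topology:
  assumes "A \<noteq> {}"
  shows "topspace (Ck_sym_topology k A) = Ck_sym k A"
proof -
  obtain U \<phi> where "(U, \<phi>) \<in> A" using assms by (metis ex_in_conv surj_pair)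
  then have "(U \<times> U, map_prod \<phi> \<phi>) \<in> prod_atlas A A"
    unfolding prod_atlas_def by (intro CollectI exI conjI) (rule refl)
  then have "prod_atlas A A \<noteq> {}" by (metis empty_iff)
  then have "topspace (Ck_topology k (prod_atlas A A)) = Ck_functions k (prod_atlas A A)"
    by (rule topspace_Ck_topology)
  moreover have "Ck_sym k A \<subseteq> Ck_functions k (prod_atlas A A)"
    unfolding Ck_sym_def by (rule Collect_restrict)
  ultimately show ?thesis
    unfolding Ck_sym_topology_def topspace_subtopology by (metis inf.absorb2)
qed

section \<open>Riemannian metrics and the Riemannian probability\<close>

text \<open>\<open>G c x\<close> is the Gram matrix of the metric in the chart \<open>c\<close> at the coordinate point \<open>x\<close>.\<close>

definition riemannian_metric ::
  "('m::topological_space, real^'n) chart set \<Rightarrow> (('m, real^'n) chart \<Rightarrow> real^'n \<Rightarrow> real^'n^'n) \<Rightarrow> bool" where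
  "riemannian_metric A G \<longleftrightarrow>
     (\<forall>c\<in>A. smooth_on (G c) (snd c ` fst c) \<and>
        (\<forall>x \<in> snd c ` fst c. transpose (G c x) = G c x \<and> (\<forall>v. v \<noteq> 0 \<longrightarrow> v \<bullet> (G c x *v v) > 0))) \<and>
     (\<forall>c\<in>A. \<forall>c'\<in>A. \<forall>x \<in> snd c ` (fst c \<inter> fst c').
        let J = matrix (frechet_derivative (transition c c') (at x))
        in G c x = transpose J ** G c' (transition c c' x) ** J)"

definition riemannian_volume ::
  "('m::topological_space, real^'n) chart set \<Rightarrow> (('m, real^'n) chart \<Rightarrow> real^'n \<Rightarrow> real^'n^'n) \<Rightarrow>
     'm measure \<Rightarrow> bool" where
  "riemannian_volume A G vol \<longleftrightarrow> sets vol = sets borel \<and>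
     (\<forall>c\<in>A. \<forall>B\<in>sets borel. B \<subseteq> fst c \<longrightarrow>
        emeasure vol B = (\<integral>\<^sup>+x\<in>snd c ` B. ennreal (sqrt (det (G c x))) \<partial>lborel))"

definition riemannian_probability ::
  "('m::topological_space, real^'n) chart set \<Rightarrow> (('m, real^'n) chart \<Rightarrow> real^'n \<Rightarrow> real^'n^'n) \<Rightarrow>
     'm measure \<Rightarrow> bool" where
  "riemannian_probability A G lam \<longleftrightarrow>
     (\<exists>vol. riemannian_volume A G vol \<and> lam = scale_measure (inverse (emeasure vol UNIV)) vol)"

definition compact_riemannian_manifold ::
  "('m::{t2_space,second_countable_topology}, real^'n) chart set \<Rightarrow>
     (('m, real^'n) chart \<Rightarrow> real^'n \<Rightarrow> real^'n^'n) \<Rightarrow> bool" where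
  "compact_riemannian_manifold A G \<longleftrightarrow>
     compact (UNIV :: 'm set) \<and> connected (UNIV :: 'm set) \<and> smooth_atlas A \<and> riemannian_metric A G"

section \<open>The map \<open>\<Pi>\<^sub>V\<close> and nondegenerate fixed points\<close>

definition V_meas :: "('m \<times> 'm \<Rightarrow> real) \<Rightarrow> 'm measure \<Rightarrow> 'm \<Rightarrow> real" where
  "V_meas V \<mu> x = (\<integral>y. V (x, y) \<partial>\<mu>)"

text \<open>\<open>V g = V (g \<lambda>)\<close>, where \<open>g \<lambda>\<close> is in general a signed measure.\<close>

definition V_fun :: "'m measure \<Rightarrow> ('m \<times> 'm \<Rightarrow> real) \<Rightarrow> ('m \<Rightarrow> real) \<Rightarrow> 'm \<Rightarrow> real" where
  "V_fun lam V g x = (\<integral>y. V (x, y) * g y \<partial>lam)"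

definition xi :: "'m measure \<Rightarrow> ('m \<Rightarrow> real) \<Rightarrow> 'm \<Rightarrow> real" where
  "xi lam f x = exp (- f x) / (\<integral>y. exp (- f y) \<partial>lam)"

definition Pi_map :: "'m measure \<Rightarrow> ('m \<times> 'm \<Rightarrow> real) \<Rightarrow> 'm measure \<Rightarrow> 'm measure" where
  "Pi_map lam V \<mu> = density lam (\<lambda>x. ennreal (xi lam (V_meas V \<mu>) x))"

definition Borel_probs :: "'m::topological_space measure set" where
  "Borel_probs = {\<mu>. sets \<mu> = sets borel \<and> prob_space \<mu>}"

definition inner_lam :: "'m measure \<Rightarrow> ('m \<Rightarrow> real) \<Rightarrow> ('m \<Rightarrow> real) \<Rightarrow> real" where
  "inner_lam lam u v = (\<integral>x. u x * v x \<partial>lam)"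

definition B0 :: "'m::topological_space measure \<Rightarrow> ('m \<Rightarrow> real) set" where
  "B0 lam = {f. continuous_on UNIV f \<and> inner_lam lam f (\<lambda>_. 1) = 0}"

definition T_op :: "'m measure \<Rightarrow> ('m \<Rightarrow> real) \<Rightarrow> ('m \<Rightarrow> real) \<Rightarrow> 'm \<Rightarrow> real" where
  "T_op lam f h x = f x * h x - inner_lam lam f h * f x"

text \<open>The continuous positive density of a fixed point exists and is unique, since \<open>\<lambda>\<close> has full
  support.\<close>

definition nondegenerate :: "'m::topological_space measure \<Rightarrow> ('m \<times> 'm \<Rightarrow> real) \<Rightarrow> 'm measure \<Rightarrow> bool" where
  "nondegenerate lam V \<mu> \<longleftrightarrow>
     (\<exists>f. continuous_on UNIV f \<and> (\<forall>x. f x > 0) \<and> \<mu> = density lam (\<lambda>x. ennreal (f x)) \<and>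
        (\<forall>u\<in>B0 lam. (\<forall>x. u x + T_op lam f (V_fun lam V u) x = 0) \<longrightarrow> (\<forall>x. u x = 0)))"

definition nondegenerate_potentials ::
  "nat \<Rightarrow> ('m::topological_space, 'e::euclidean_space) chart set \<Rightarrow> 'm measure \<Rightarrow> ('m \<times> 'm \<Rightarrow> real) set" where
  "nondegenerate_potentials k A lam =
     {V \<in> Ck_sym k A. \<forall>\<mu>\<in>Borel_probs. Pi_map lam V \<mu> = \<mu> \<longrightarrow> nondegenerate lam V \<mu>}"

end

theory Submission
  imports Defs
begin

text \<open>Both properties reduce to statements about continuous kernels \<open>V\<close>. Since \<open>h \<mapsto> Vh\<close> is compact, limits of
  fixed points (and of normalised kernel vectors) of uniformly converging kernels exist, which gives openness
  already for uniform convergence.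

  For density, \<open>V\<close> is perturbed by kernels \<open>g(x) + g(y)\<close>, which turn the fixed point equation into
  \<open>ln f + Vf + g = const\<close>, so that a generic \<open>g\<close> has to be a regular value of \<open>f \<mapsto> - ln f - Vf\<close> modulo
  constants. It suffices to take \<open>g\<close> in the span of finitely many slices \<open>V(z, \<cdot>)\<close>: they are automatically
  of class \<open>C\<^sup>k\<close>, and a finite net of points \<open>z\<close> separates the kernel of the linearisation. Instead of
  invoking the Sard--Smale theorem, parameters with a degenerate fixed point are counted on a fine grid. The
  linearisation is self-adjoint, so its kernel vector pairs the increment of \<open>g\<close> with a quadratically small
  quantity.\<close>

section \<open>Counting critical parameters\<close>

text \<open>On mean-zero functions, adding g(x) + g(y) to V changes V h by a constant only, so
  modulo constants the linearised equation at f depends on V and f alone. Hence the radius and the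
  finite set of slices found at a fixed point f0 of the original V serve for every g at once. This
  uniformity is what allows finitely many balls covering the fixed points to be treated one after
  another, openness protecting the balls already treated. Inside one ball, a bad parameter t merely
  provides some degenerate fixed point, chosen without any continuity in t. What survives is an
  inverse bound: t is a Lipschitz function of the values of V f at the chosen points, and there are
  as many values as parameters. This is the equal-dimensional case of Sard's theorem, where a
  first-order expansion with quadratic remainder is enough. The grid mesh is matched to the
  thickness of the slabs, so that counting plays the part of volume.\<close>

lemma card_le_fibres:
  assumes "finite S" "\<And>x. x \<in> A \<Longrightarrow> f x \<in> S" "finite A"
    and "\<And>s. s \<in> S \<Longrightarrow> card {x \<in> A. f x = s} \<le> b"
  shows "card A \<le> card S * b"
proof -
  have "card A \<le> card (\<Union>s\<in>S. {x \<in> A. f x = s})" using assms by (intro card_mono) auto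
  also have "\<dots> \<le> (\<Sum>s\<in>S. card {x \<in> A. f x = s})" by (rule card_UN_le[OF assms(1)])
  also have "\<dots> \<le> card S * b" using sum_bounded_above[of S "\<lambda>s. card {x \<in> A. f x = s}" b] assms(4) by simp
  finally show ?thesis .
qed

text \<open>Points of the grid of mesh \<open>\<delta> / N\<^sup>2\<close> whose \<open>q\<close>-values share a cube of side \<open>1 / N\<close> lie in a box of
  side \<open>O(1 / N)\<close> and in a slab of thickness \<open>O(1 / N\<^sup>2)\<close>. So \<open>O(N^m)\<close> cubes account for only
  \<open>O(N^m * N^(m - 1))\<close> of the \<open>N^(2 * m)\<close> grid points, where \<open>m = card I\<close>.\<close>

lemma critical_parameters_counting:
  fixes q a :: "('i \<Rightarrow> real) \<Rightarrow> 'i \<Rightarrow> real"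
  defines "s \<equiv> \<lambda>I t t'. \<Sum>j\<in>I. \<bar>q t j - q t' j\<bar>"
  assumes fin: "finite I" and \<delta>: "\<delta> > 0" and c: "c > 0"
    and T: "T = {t. \<forall>i\<in>I. 0 \<le> t i \<and> t i < \<delta>}"
    and qb: "\<And>t i. t \<in> T \<Longrightarrow> i \<in> I \<Longrightarrow> \<bar>q t i\<bar> \<le> Q"
    and big: "\<And>t. t \<in> T \<Longrightarrow> \<exists>i\<in>I. c \<le> \<bar>a t i\<bar>"
    and lip: "\<And>t t' i. t \<in> T \<Longrightarrow> t' \<in> T \<Longrightarrow> i \<in> I \<Longrightarrow> \<bar>t i - t' i\<bar> \<le> C * s I t t'"
    and slab: "\<And>t t'. t \<in> T \<Longrightarrow> t' \<in> T \<Longrightarrow> \<bar>\<Sum>i\<in>I. a t' i * (t i - t' i)\<bar> \<le> C * (s I t t')\<^sup>2"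
  shows False
proof -
  define m where "m = card I"
  \<comment> \<open>The cube contains the origin, so \<open>big\<close> excludes an empty index set
    and the exponents \<open>m - 1\<close> and \<open>2 * m - 1\<close> involve no truncated
    subtraction.\<close>
  have "(\<lambda>_. 0) \<in> T" using \<delta> by (simp add: T)
  then have "I \<noteq> {}" using big by blast
  then have m: "m \<ge> 1" using fin by (simp add: m_def Suc_le_eq card_gt_0_iff)
  define C' where "C' = max C 0"
  have C': "C' \<ge> 0" "C \<le> C'" by (auto simp: C'_def)
  obtain Q1 :: nat where Q1: "Q \<le> real Q1" using real_arch_simple by blast
  \<comment> \<open>In units of the mesh, the points of a cell lie within \<open>D * N\<close> of a
    reference point in every coordinate. \<open>P\<close> strictly bounds the difference, in one
    steep coordinate, of two points of the cell that agree in all others.\<close>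
  obtain D :: nat where D: "C' * m / \<delta> \<le> real D" using real_arch_simple by blast
  obtain P :: nat where P: "2 * (C' * m\<^sup>2 / \<delta>) / c < real P" using reals_Archimedean2 by blast
  have "0 \<le> 2 * (C' * m\<^sup>2 / \<delta>) / c" using C' \<delta> c by simp
  then have P0: "P > 0" using P by linarith
  \<comment> \<open>\<open>M\<close> collects the constants so that the upper count becomes
    \<open>M * N ^ (2 * m - 1)\<close>; with \<open>N = M + 1\<close> this falls below the number of
    grid points.\<close>
  define M where "M = (2 * Q1 + 1) ^ m * (P * (2 * D + 1) ^ (m - 1))"
  define N where "N = M + 1"
  have N: "N \<ge> 1" by (simp add: N_def)
  define \<Gamma> where "\<Gamma> = (\<Pi>\<^sub>E i\<in>I. {..<N\<^sup>2})"
  define \<tau> where "\<tau> k = (\<lambda>i. \<delta> * real (k i) / N\<^sup>2)" for k :: "'i \<Rightarrow> nat"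
  define cell where "cell k = (\<lambda>i\<in>I. \<lfloor>q (\<tau> k) i * N\<rfloor>)" for k
  define S where "S = (\<Pi>\<^sub>E i\<in>I. {- int (Q1 * N)..int (Q1 * N)})"
  have \<tau>T: "\<tau> k \<in> T" if "k \<in> \<Gamma>" for k
  proof -
    have "\<delta> * real (k i) / N\<^sup>2 < \<delta>" if "i \<in> I" for i
    proof -
      have "k i < N\<^sup>2" using \<open>k \<in> \<Gamma>\<close> that by (auto simp: \<Gamma>_def)
      then have "real (k i) < real (N\<^sup>2)" by (simp only: of_nat_less_iff)
      then have "\<delta> * real (k i) < \<delta> * real (N\<^sup>2)" using \<delta> by simp
      then show ?thesis using N by (simp add: divide_less_eq)
    qed
    then show ?thesis using \<delta> unfolding T \<tau>_def by simp
  qed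
  have finG: "finite \<Gamma>" "finite S" unfolding \<Gamma>_def S_def using fin by (auto intro!: finite_PiE)
  have cellS: "cell k \<in> S" if k: "k \<in> \<Gamma>" for k
    unfolding cell_def S_def restrict_PiE_iff
  proof
    fix i assume i: "i \<in> I"
    have "\<bar>q (\<tau> k) i * N\<bar> \<le> real Q1 * N"
      unfolding abs_mult using qb[OF \<tau>T[OF k] i] Q1 by (intro mult_mono) auto
    then have "- real (Q1 * N) \<le> q (\<tau> k) i * N" "q (\<tau> k) i * N \<le> real (Q1 * N)" by (auto simp: abs_le_iff)
    then show "\<lfloor>q (\<tau> k) i * N\<rfloor> \<in> {- int (Q1 * N)..int (Q1 * N)}"
      by (simp add: le_floor_iff floor_le_iff)
  qed
  have fibre: "card {k \<in> \<Gamma>. cell k = \<sigma>} \<le> P * (2 * D * N + 1) ^ (m - 1)" for \<sigma>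
  proof (cases "{k \<in> \<Gamma>. cell k = \<sigma>} = {}")
    case False
    then obtain k0 where k0: "k0 \<in> \<Gamma>" "cell k0 = \<sigma>" by blast
    obtain i0 where i0: "i0 \<in> I" "c \<le> \<bar>a (\<tau> k0) i0\<bar>" using big[OF \<tau>T[OF k0(1)]] by blast
    have ss: "s I (\<tau> k) (\<tau> k0) \<le> m / N" if "k \<in> \<Gamma>" "cell k = \<sigma>" for k
    proof -
      have "\<bar>q (\<tau> k) i - q (\<tau> k0) i\<bar> \<le> 1 / N" if "i \<in> I" for i
      proof -
        have "\<lfloor>q (\<tau> k) i * N\<rfloor> = \<lfloor>q (\<tau> k0) i * N\<rfloor>"
          using fun_cong[OF trans[OF \<open>cell k = \<sigma>\<close> k0(2)[symmetric]], of i] that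
          by (simp add: cell_def)
        then have "\<bar>q (\<tau> k) i * N - q (\<tau> k0) i * N\<bar> \<le> 1" by linarith
        then have "\<bar>q (\<tau> k) i - q (\<tau> k0) i\<bar> * N \<le> 1" by (simp add: abs_mult flip: left_diff_distrib)
        then show ?thesis using N by (simp add: le_divide_eq)
      qed
      then have "s I (\<tau> k) (\<tau> k0) \<le> real (card I) * (1 / N)"
        unfolding s_def by (intro sum_bounded_above) auto
      then show ?thesis by (simp add: m_def)
    qed
    have s0: "s I t t' \<ge> 0" for t t' unfolding s_def by (simp add: sum_nonneg)
    have Nr: "real N > 0" using N by simp
    have near: "\<bar>real (k i) - real (k0 i)\<bar> \<le> D * N" if k: "k \<in> \<Gamma>" "cell k = \<sigma>" and i: "i \<in> I" for k i
    proof -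
      have "\<delta> / N\<^sup>2 * \<bar>real (k i) - real (k0 i)\<bar> = \<bar>\<tau> k i - \<tau> k0 i\<bar>"
        unfolding \<tau>_def using \<delta> by (simp add: abs_mult flip: diff_divide_distrib right_diff_distrib)
      also have "\<dots> \<le> C * s I (\<tau> k) (\<tau> k0)" by (rule lip[OF \<tau>T[OF k(1)] \<tau>T[OF k0(1)] i])
      also have "\<dots> \<le> C' * (m / N)" using C' ss[OF k] s0 by (intro mult_mono) auto
      finally have "\<bar>real (k i) - real (k0 i)\<bar> \<le> (C' * (m / N)) / (\<delta> / N\<^sup>2)"
        using \<delta> Nr by (subst pos_le_divide_eq) (auto simp: mult.commute)
      also have "\<dots> = (C' * m / \<delta>) * N" using \<delta> Nr by (simp add: field_simps power2_eq_square)
      also have "\<dots> \<le> D * N" unfolding of_nat_mult using D by (intro mult_right_mono) auto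
      finally show ?thesis by simp
    qed
    have thin: "\<bar>\<Sum>i\<in>I. a (\<tau> k0) i * (real (k i) - real (k0 i))\<bar> \<le> C' * m\<^sup>2 / \<delta>"
      if k: "k \<in> \<Gamma>" "cell k = \<sigma>" for k
    proof -
      have "\<tau> k i - \<tau> k0 i = \<delta> / N\<^sup>2 * (real (k i) - real (k0 i))" for i
        by (simp add: \<tau>_def flip: diff_divide_distrib right_diff_distrib)
      then have "(\<Sum>i\<in>I. a (\<tau> k0) i * (\<tau> k i - \<tau> k0 i)) =
          \<delta> / N\<^sup>2 * (\<Sum>i\<in>I. a (\<tau> k0) i * (real (k i) - real (k0 i)))"
        unfolding sum_distrib_left by (simp only: mult_ac)
      then have "\<delta> / N\<^sup>2 * \<bar>\<Sum>i\<in>I. a (\<tau> k0) i * (real (k i) - real (k0 i))\<bar> =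
          \<bar>\<Sum>i\<in>I. a (\<tau> k0) i * (\<tau> k i - \<tau> k0 i)\<bar>" using \<delta> by (simp add: abs_mult)
      also have "\<dots> \<le> C * (s I (\<tau> k) (\<tau> k0))\<^sup>2" by (rule slab[OF \<tau>T[OF k(1)] \<tau>T[OF k0(1)]])
      also have "\<dots> \<le> C' * (m / N)\<^sup>2" using C' ss[OF k] s0 by (intro mult_mono power_mono) auto
      finally have "\<bar>\<Sum>i\<in>I. a (\<tau> k0) i * (real (k i) - real (k0 i))\<bar> \<le> (C' * (m / N)\<^sup>2) / (\<delta> / N\<^sup>2)"
        using \<delta> Nr by (subst pos_le_divide_eq) (auto simp: mult.commute)
      also have "\<dots> = C' * m\<^sup>2 / \<delta>" using \<delta> Nr by (simp add: field_simps power2_eq_square)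
      finally show ?thesis .
    qed
    \<comment> \<open>Off \<open>i0\<close> the code records offsets from \<open>k0\<close>, shifted
      by \<open>D * N\<close> to stay in the naturals; in the steep direction \<open>i0\<close> a
      residue modulo \<open>P\<close> suffices.\<close>
    define code where "code k = (\<lambda>i\<in>I. if i = i0 then k i mod P else k i + D * N - k0 i)" for k
    define R where "R = (\<Pi>\<^sub>E i\<in>I. if i = i0 then {..<P} else {..2 * D * N})"
    have ge: "k i + D * N \<ge> k0 i" "k i + D * N - k0 i \<le> 2 * D * N"
      if "k \<in> \<Gamma>" "cell k = \<sigma>" "i \<in> I" for k i
      using near[OF that] by (simp_all add: abs_le_iff flip: of_nat_add of_nat_mult) linarith+
    have "code k \<in> R" if "k \<in> {k \<in> \<Gamma>. cell k = \<sigma>}" for k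
      using that ge P0 unfolding code_def R_def restrict_PiE_iff by auto
    moreover have "inj_on code {k \<in> \<Gamma>. cell k = \<sigma>}"
    proof (rule inj_onI)
      fix k k' assume k: "k \<in> {k \<in> \<Gamma>. cell k = \<sigma>}" and k': "k' \<in> {k \<in> \<Gamma>. cell k = \<sigma>}"
        and eq: "code k = code k'"
      have off: "k i = k' i" if "i \<in> I" "i \<noteq> i0" for i
        using fun_cong[OF eq, of i] that ge(1)[of k i] ge(1)[of k' i] k k' by (simp add: code_def)
      \<comment> \<open>Both points satisfy the slab bound with the same conormal
        \<open>a (\<tau> k0)\<close>. As they agree off \<open>i0\<close>, subtraction leaves one
        term, and its coefficient is at least \<open>c\<close> in absolute value.\<close>
      have "(\<Sum>i\<in>I. a (\<tau> k0) i * (real (k i) - real (k0 i))) - (\<Sum>i\<in>I. a (\<tau> k0) i * (real (k' i) - real (k0 i)))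
          = (\<Sum>i\<in>I. a (\<tau> k0) i * (real (k i) - real (k' i)))"
        unfolding sum_subtractf[symmetric] by (intro sum.cong refl) (simp add: algebra_simps)
      also have "\<dots> = (\<Sum>i\<in>{i0}. a (\<tau> k0) i * (real (k i) - real (k' i)))"
        using fin i0(1) off by (intro sum.mono_neutral_right) auto
      finally have "\<bar>a (\<tau> k0) i0 * (real (k i0) - real (k' i0))\<bar> \<le> 2 * (C' * m\<^sup>2 / \<delta>)"
        using thin[of k] thin[of k'] k k' by simp
      then have "c * \<bar>real (k i0) - real (k' i0)\<bar> \<le> 2 * (C' * m\<^sup>2 / \<delta>)"
        using mult_right_mono[OF i0(2), of "\<bar>real (k i0) - real (k' i0)\<bar>"] by (simp add: abs_mult)
      then have "\<bar>real (k i0) - real (k' i0)\<bar> \<le> 2 * (C' * m\<^sup>2 / \<delta>) / c"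
        using c by (subst pos_le_divide_eq) (auto simp: mult.commute)
      then have lt: "\<bar>real (k i0) - real (k' i0)\<bar> < P" using P by linarith
      have "k i0 mod P = k' i0 mod P"
        using fun_cong[OF eq, of i0] i0(1) by (simp add: code_def)
      then have "int P dvd int (k i0) - int (k' i0)"
        by (metis mod_eq_dvd_iff zmod_int)
      moreover have "\<bar>int (k i0) - int (k' i0)\<bar> < int P" using lt by linarith
      ultimately have "k i0 = k' i0"
        using zdvd_imp_le[of "int P" "int (k i0) - int (k' i0)"]
          zdvd_imp_le[of "int P" "int (k' i0) - int (k i0)"]
        by (metis abs_less_iff dvd_diff_commute eq_iff_diff_eq_0 linorder_not_less minus_diff_eq
            nat_int_comparison(1) not_less_iff_gr_or_eq zero_less_diff diff_gt_0_iff_gt)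
      then show "k = k'"
        using off k k' unfolding \<Gamma>_def by (intro PiE_ext[of k I _ k']) (auto, metis)
    qed
    moreover have "finite R" unfolding R_def using fin by (intro finite_PiE) auto
    ultimately have "card {k \<in> \<Gamma>. cell k = \<sigma>} \<le> card R"
      by (metis (no_types, lifting) card_inj_on_le image_subsetI)
    also have "card R = (\<Prod>i\<in>I. card (if i = i0 then {..<P} else {..2 * D * N}))"
      unfolding R_def by (rule card_PiE[OF fin])
    also have "\<dots> = P * (\<Prod>i\<in>I - {i0}. 2 * D * N + 1)"
      by (subst prod.remove[OF fin i0(1)]) (auto intro!: prod.cong)
    also have "\<dots> = P * (2 * D * N + 1) ^ (m - 1)" using fin i0(1) by (simp add: m_def)
    finally show ?thesis .
  qed (simp only: card.empty)
  have "card \<Gamma> \<le> card S * (P * (2 * D * N + 1) ^ (m - 1))"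
    by (rule card_le_fibres[of S \<Gamma> cell]) (use finG cellS fibre in auto)
  moreover have "card \<Gamma> = N ^ (2 * m)"
    unfolding \<Gamma>_def using fin by (simp add: card_PiE m_def power_mult)
  moreover have "card S = (2 * Q1 * N + 1) ^ m"
  proof -
    have "card {- int (Q1 * N)..int (Q1 * N)} = 2 * Q1 * N + 1"
      unfolding card_atLeastAtMost_int by linarith
    then show ?thesis unfolding S_def using fin by (simp only: card_PiE m_def prod_constant)
  qed
  ultimately have "N ^ (2 * m) \<le> (2 * Q1 * N + 1) ^ m * (P * (2 * D * N + 1) ^ (m - 1))" by simp
  also have "\<dots> \<le> ((2 * Q1 + 1) * N) ^ m * (P * ((2 * D + 1) * N) ^ (m - 1))"
    using N by (intro mult_mono power_mono) auto
  also have "\<dots> = M * (N ^ m * N ^ (m - 1))" by (simp only: M_def power_mult_distrib mult_ac)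
  also have "\<dots> = M * N ^ (2 * m - 1)" using m by (simp flip: power_add add: mult_2)
  also have "\<dots> < N * N ^ (2 * m - 1)" using N by (simp add: N_def)
  also have "\<dots> = N ^ (2 * m)" using m by (simp flip: power_Suc)
  finally show False by simp
qed

text \<open>\<open>c\<close> is the point where the logarithm is linearised: the mean value theorem
  gives a slope 1/z with z between \<open>a\<close> and \<open>b\<close>, and |1/z - 1/c| is at most
  d/m^2. With a fixed centre \<open>c\<close> the error has a small Lipschitz constant; with
  \<open>c\<close> one of the two points and \<open>d\<close> their distance it is quadratic. Both
  readings are used.\<close>

lemma ln_diff_estimate:
  fixes a b c :: real
  assumes m: "0 < m" "m \<le> a" "m \<le> b" "m \<le> c" and d: "\<bar>a - c\<bar> \<le> d" "\<bar>b - c\<bar> \<le> d"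
  shows "\<bar>ln a - ln b - (a - b) / c\<bar> \<le> \<bar>a - b\<bar> * (d / m\<^sup>2)"
proof -
  have *: "\<bar>ln a - ln b - (a - b) / c\<bar> \<le> \<bar>a - b\<bar> * (d / m\<^sup>2)"
    if ab: "b < a" "m \<le> b" "\<bar>a - c\<bar> \<le> d" "\<bar>b - c\<bar> \<le> d" for a b
  proof -
    have "\<exists>z>b. z < a \<and> ln a - ln b = (a - b) * (1 / z)"
      using m(1) ab(2) by (intro MVT2[OF ab(1)] DERIV_ln_divide) auto
    then obtain z where z: "b < z" "z < a" "ln a - ln b = (a - b) * (1 / z)" by blast
    have zm: "m \<le> z" "0 < z" "0 < c" using z ab m by auto
    have "ln a - ln b - (a - b) / c = (a - b) * ((c - z) / (z * c))"
      unfolding z(3) using zm by (simp add: field_simps)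
    moreover have "\<bar>(c - z) / (z * c)\<bar> \<le> d / m\<^sup>2"
    proof -
      have "\<bar>c - z\<bar> \<le> d" using ab z by linarith
      moreover have "m\<^sup>2 \<le> z * c" unfolding power2_eq_square using zm m by (intro mult_mono) auto
      ultimately show ?thesis using zm m(1) by (simp add: abs_mult frac_le)
    qed
    ultimately show ?thesis by (simp only: abs_mult[of "a - b"] mult_left_mono abs_ge_zero)
  qed
  consider "a = b" | "b < a" | "a < b" by linarith
  then show ?thesis
  proof cases
    case 2 then show ?thesis using *[of b a] m d by simp
  next
    case 3
    have "\<bar>ln a - ln b - (a - b) / c\<bar> = \<bar>ln b - ln a - (b - a) / c\<bar>"
      by (simp add: diff_divide_distrib)
    then show ?thesis using 3 *[of a b] m d by (simp add: abs_minus_commute)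
  qed simp
qed

section \<open>Kernel operators on continuous functions\<close>

lemma complete_UNIV_bcontfun:
  "Topological_Spaces.complete (UNIV :: ('a::topological_space \<Rightarrow>\<^sub>C 'b::complete_space) set)"
proof (rule completeI)
  fix f :: "nat \<Rightarrow> ('a, 'b) bcontfun"
  assume "Cauchy f"
  then obtain g where "uniform_limit UNIV f g sequentially"
    using uniformly_convergent_eq_cauchy[of "\<lambda>_. True" f]
    unfolding Cauchy_def uniform_limit_sequentially_iff
    by (metis dist_fun_lt_imp_dist_val_lt)
  from uniform_limit_bcontfunE[OF this sequentially_bot]
  show "\<exists>l\<in>UNIV. f \<longlonglongrightarrow> l" by (metis UNIV_I)
qed

lemma compact_UNIV_Times:
  assumes "compact (UNIV :: 'a::topological_space set)"
  shows "compact (UNIV :: ('a \<times> 'a) set)"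
  using compact_Times[OF assms assms] by simp

lemma bcontfun_compact:
  fixes f :: "'a::topological_space \<Rightarrow> real"
  assumes "compact (UNIV :: 'a set)" "continuous_on UNIV f"
  shows "f \<in> bcontfun"
  using assms compact_continuous_image[of UNIV f]
  by (auto simp: bcontfun_def compact_imp_bounded)

lemma apply_Bcontfun_compact:
  fixes f :: "'a::topological_space \<Rightarrow> real"
  assumes "compact (UNIV :: 'a set)" "continuous_on UNIV f"
  shows "apply_bcontfun (Bcontfun f) = f"
  by (rule Bcontfun_inverse) (rule bcontfun_compact[OF assms])

lemma abs_apply_le_norm: "\<bar>apply_bcontfun f x\<bar> \<le> norm f" for f :: "'a::topological_space \<Rightarrow>\<^sub>C real"
  using norm_bounded[of f x] by simp

lemma norm_bcontfun_le_iff: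
  "norm f \<le> b \<longleftrightarrow> (\<forall>x. \<bar>apply_bcontfun f x\<bar> \<le> b)" for f :: "'a::topological_space \<Rightarrow>\<^sub>C real"
  using abs_apply_le_norm[of f] norm_bound[of f b] by (auto intro: order_trans)

lemma apply_bcontfun_sum:
  "apply_bcontfun (\<Sum>i\<in>I. f i) x = (\<Sum>i\<in>I. apply_bcontfun (f i) x)"
  for f :: "'i \<Rightarrow> 'a::topological_space \<Rightarrow>\<^sub>C real"
  by (induction I rule: infinite_finite_induct) auto

lemma tendsto_apply_bcontfun:
  fixes f :: "'i \<Rightarrow> 'a::topological_space \<Rightarrow>\<^sub>C real"
  assumes "(f \<longlongrightarrow> g) F"
  shows "((\<lambda>n. apply_bcontfun (f n) x) \<longlongrightarrow> apply_bcontfun g x) F"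
  using tendsto_bcontfun_uniform_limit[OF assms] by (rule tendsto_uniform_limitI) simp

text \<open>Compactness in the second variable makes the oscillation near each x uniform in y, and
  compactness in the first leaves finitely many centres. Since the spaces carry no metric,
  equicontinuity is phrased through comparison points. It serves both for total boundedness and for
  finding separating points.\<close>

lemma finite_equicontinuity_net:
  fixes V :: "'a::topological_space \<times> 'b::topological_space \<Rightarrow> real"
  assumes a: "compact (UNIV :: 'a set)" and b: "compact (UNIV :: 'b set)"
    and V: "continuous_on UNIV V" and e: "e > 0"
  obtains Z where "finite Z" "\<And>x. \<exists>z\<in>Z. \<forall>y. \<bar>V (x, y) - V (z, y)\<bar> \<le> e"
proof -
  have "\<exists>X. x \<in> X \<and> open X \<and> (\<forall>x'\<in>X. \<forall>y. \<bar>V (x', y) - V (x, y)\<bar> \<le> e)" for x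
  proof -
    have "continuous_on (UNIV \<times> UNIV) V" using V by simp
    from continuous_on_prod_compactE[OF this b UNIV_I e, of x]
    show ?thesis by (metis IntI UNIV_I dist_real_def)
  qed
  then obtain X where X: "\<And>x. x \<in> X x" "\<And>x. open (X x)"
    "\<And>x x' y. x' \<in> X x \<Longrightarrow> \<bar>V (x', y) - V (x, y)\<bar> \<le> e" by metis
  obtain Z where "finite Z" "UNIV \<subseteq> (\<Union>z\<in>Z. X z)"
    by (rule compactE_image[OF a, of UNIV X]) (use X in auto)
  then show ?thesis using that[of Z] X(3) by (metis UN_E UNIV_I subsetD)
qed

text \<open>The fixed point theory takes place in the sup norm over a compact space with a Borel
  probability. The locale is instantiated with \<open>lam\<close> and, inside
  \<open>fixed_point_density\<close>, with a fixed point measure as well.\<close>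

locale compact_prob =
  fixes lam :: "'m::{t2_space,second_countable_topology} measure"
  assumes sets_lam: "sets lam = sets borel"
    and prob_lam: "prob_space lam"
    and compact_M: "compact (UNIV :: 'm set)"
begin

lemma space_lam: "space lam = UNIV"
  using sets_eq_imp_space_eq[OF sets_lam] by simp

lemma integrable_continuous:
  fixes f :: "'m \<Rightarrow> real"
  assumes f: "continuous_on UNIV f"
  shows "integrable lam f"
proof -
  interpret prob_space lam by (rule prob_lam)
  obtain B where "\<And>x. norm (f x) \<le> B"
    using bcontfun_compact[OF compact_M f] by (auto simp: bcontfun_def bounded_iff)
  moreover have "f \<in> borel_measurable lam"
    unfolding measurable_cong_sets[OF sets_lam refl]
    using f by (rule borel_measurable_continuous_onI)
  ultimately show ?thesis by (intro integrable_const_bound[where B = B]) auto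
qed

lemma integral_abs_le:
  fixes f :: "'m \<Rightarrow> real"
  assumes "continuous_on UNIV f" "\<And>x. \<bar>f x\<bar> \<le> b"
  shows "\<bar>\<integral>x. f x \<partial>lam\<bar> \<le> b"
proof -
  interpret prob_space lam by (rule prob_lam)
  have "\<bar>\<integral>x. f x \<partial>lam\<bar> \<le> (\<integral>x. \<bar>f x\<bar> \<partial>lam)" using integral_norm_bound[of lam f] by simp
  also have "\<dots> \<le> (\<integral>x. b \<partial>lam)"
    using assms by (intro integral_mono integrable_continuous continuous_intros)
  finally show ?thesis by (simp add: prob_space)
qed

lemma integral_const_lam [simp]: "(\<integral>x. c \<partial>lam) = (c::real)"
proof -
  interpret prob_space lam by (rule prob_lam)
  show ?thesis by (simp add: prob_space)
qed

lemma integral_pos: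
  assumes f: "continuous_on UNIV f" "\<And>x. f x > (0::real)"
  shows "(\<integral>x. f x \<partial>lam) > 0"
proof -
  interpret prob_space lam by (rule prob_lam)
  have "compact (f ` UNIV)" using compact_continuous_image[OF f(1) compact_M] .
  then obtain m where "\<And>x. f m \<le> f x"
    by (metis UNIV_I UNIV_not_empty compact_M continuous_attains_inf f(1))
  then have "(\<integral>x. f m \<partial>lam) \<le> (\<integral>x. f x \<partial>lam)"
    by (intro integral_mono integrable_continuous continuous_intros f)
  then show ?thesis using f(2)[of m] by (simp add: prob_space)
qed

section \<open>Inner product, multiplication and kernel operator as bounded bilinear maps\<close>

definition ip :: "('m \<Rightarrow>\<^sub>C real) \<Rightarrow> ('m \<Rightarrow>\<^sub>C real) \<Rightarrow> real" where
  "ip u v = inner_lam lam u v"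

definition mult :: "('m \<Rightarrow>\<^sub>C real) \<Rightarrow> ('m \<Rightarrow>\<^sub>C real) \<Rightarrow> ('m \<Rightarrow>\<^sub>C real)" where
  "mult u v = Bcontfun (\<lambda>x. u x * v x)"

definition Kop :: "(('m \<times> 'm) \<Rightarrow>\<^sub>C real) \<Rightarrow> ('m \<Rightarrow>\<^sub>C real) \<Rightarrow> ('m \<Rightarrow>\<^sub>C real)" where
  "Kop V h = Bcontfun (V_fun lam (apply_bcontfun V) (apply_bcontfun h))"

lemma mult_apply [simp]: "mult u v x = u x * v x"
  unfolding mult_def by (subst apply_Bcontfun_compact[OF compact_M]) (auto intro!: continuous_intros)

lemma continuous_slice: "continuous_on UNIV (\<lambda>y. apply_bcontfun V (x, y))"
  for V :: "('m \<times> 'm) \<Rightarrow>\<^sub>C real"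
  by (rule continuous_on_compose2[of UNIV "apply_bcontfun V"]) (auto intro!: continuous_intros)

lemma continuous_V_fun: "continuous_on UNIV (V_fun lam (apply_bcontfun V) (apply_bcontfun h))"
proof -
  have "\<exists>X. open X \<and> x \<in> X \<and> (\<forall>x'\<in>X. \<bar>V_fun lam (apply_bcontfun V) (apply_bcontfun h) x' - V_fun lam (apply_bcontfun V) (apply_bcontfun h) x\<bar> < e)"
    if e: "e > 0" for e x
  proof -
    define d where "d = e / (2 * (norm h + 1))"
    have d: "d > 0" unfolding d_def using e by (simp add: add_nonneg_pos)
    have "continuous_on (UNIV \<times> UNIV) (apply_bcontfun V)" by simp
    from continuous_on_prod_compactE[OF this compact_M UNIV_I d, of x]
    obtain X where X: "x \<in> X" "open X" "\<And>x' y. x' \<in> X \<Longrightarrow> \<bar>V (x', y) - V (x, y)\<bar> \<le> d"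
      by (metis IntI UNIV_I dist_real_def)
    have "\<bar>V_fun lam (apply_bcontfun V) (apply_bcontfun h) x' - V_fun lam (apply_bcontfun V) (apply_bcontfun h) x\<bar> < e" if "x' \<in> X" for x'
    proof -
      have "V_fun lam (apply_bcontfun V) (apply_bcontfun h) x' - V_fun lam (apply_bcontfun V) (apply_bcontfun h) x = (\<integral>y. (V (x', y) - V (x, y)) * h y \<partial>lam)"
        unfolding V_fun_def
        by (subst Bochner_Integration.integral_diff[symmetric])
          (auto intro!: integrable_continuous continuous_intros continuous_slice simp: algebra_simps)
      moreover have "\<bar>\<dots>\<bar> \<le> d * norm h"
        using X(3)[OF that] d
        by (intro integral_abs_le continuous_intros continuous_slice)
          (auto simp: abs_mult intro!: mult_mono abs_apply_le_norm)
      moreover have "d * norm h < e"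
      proof -
        have "d * norm h \<le> d * (norm h + 1)" using d by (intro mult_left_mono) auto
        also have "\<dots> = e / 2" unfolding d_def by (simp add: field_simps add_nonneg_eq_0_iff)
        finally show ?thesis using e by simp
      qed
      ultimately show ?thesis by simp
    qed
    then show ?thesis using X by blast
  qed
  then have "isCont (V_fun lam (apply_bcontfun V) (apply_bcontfun h)) x" for x
    unfolding isCont_def tendsto_iff eventually_at_topological dist_real_def by meson
  then show ?thesis by (simp add: continuous_at_imp_continuous_on)
qed

lemma Kop_apply: "Kop V h x = (\<integral>y. V (x, y) * h y \<partial>lam)"
  unfolding Kop_def by (subst apply_Bcontfun_compact[OF compact_M continuous_V_fun]) (simp add: V_fun_def)

lemma Kop_V_fun: "apply_bcontfun (Kop V h) = V_fun lam (apply_bcontfun V) (apply_bcontfun h)"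
  unfolding Kop_def by (rule apply_Bcontfun_compact[OF compact_M continuous_V_fun])

lemma abs_ip_le: "\<bar>ip u v\<bar> \<le> norm u * norm v"
  unfolding ip_def inner_lam_def
  by (intro integral_abs_le continuous_intros)
    (auto simp: abs_mult intro!: mult_mono abs_apply_le_norm)

lemma norm_mult_le: "norm (mult u v) \<le> norm u * norm v"
  by (auto simp: norm_bcontfun_le_iff abs_mult intro!: mult_mono abs_apply_le_norm)

lemma norm_Kop: "norm (Kop V h) \<le> norm V * norm h"
  unfolding norm_bcontfun_le_iff Kop_apply
  by (intro allI integral_abs_le continuous_intros continuous_slice)
    (auto simp: abs_mult intro!: mult_mono abs_apply_le_norm)

lemma bounded_bilinear_ip: "bounded_bilinear ip"
proof
  show "\<exists>K. \<forall>a b. norm (ip a b) \<le> norm a * norm b * K"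
    by (intro exI[of _ 1]) (simp add: abs_ip_le)
  have i: "integrable lam (\<lambda>x. apply_bcontfun u x * apply_bcontfun v x)" for u v :: "'m \<Rightarrow>\<^sub>C real"
    by (intro integrable_continuous continuous_intros) auto
  show "ip (a + a') b = ip a b + ip a' b" for a a' b
    unfolding ip_def inner_lam_def plus_bcontfun.rep_eq distrib_right
    by (rule Bochner_Integration.integral_add[OF i i])
  show "ip a (b + b') = ip a b + ip a b'" for a b b'
    unfolding ip_def inner_lam_def plus_bcontfun.rep_eq distrib_left
    by (rule Bochner_Integration.integral_add[OF i i])
  show "ip (r *\<^sub>R a) b = r *\<^sub>R ip a b" "ip a (r *\<^sub>R b) = r *\<^sub>R ip a b" for r a b
    by (simp_all add: ip_def inner_lam_def mult.assoc mult.left_commute[of _ r])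
qed

lemma bounded_bilinear_mult: "bounded_bilinear mult"
proof
  show "\<exists>K. \<forall>a b. norm (mult a b) \<le> norm a * norm b * K"
    by (intro exI[of _ 1]) (simp add: norm_mult_le)
qed (auto intro!: bcontfun_eqI simp: algebra_simps)

lemma bounded_bilinear_Kop: "bounded_bilinear Kop"
proof
  show "\<exists>K. \<forall>a b. norm (Kop a b) \<le> norm a * norm b * K"
    by (intro exI[of _ 1]) (auto simp: norm_Kop)
  have i: "integrable lam (\<lambda>y. apply_bcontfun V (x, y) * apply_bcontfun v y)"
    for V :: "('m \<times> 'm) \<Rightarrow>\<^sub>C real" and v x
    by (intro integrable_continuous continuous_intros continuous_slice) auto
  show "Kop (a + a') b = Kop a b + Kop a' b" for a a' b
    by (rule bcontfun_eqI)
      (simp only: Kop_apply plus_bcontfun.rep_eq distrib_right Bochner_Integration.integral_add[OF i i])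
  show "Kop a (b + b') = Kop a b + Kop a b'" for a b b'
    by (rule bcontfun_eqI)
      (simp only: Kop_apply plus_bcontfun.rep_eq distrib_left Bochner_Integration.integral_add[OF i i])
  show "Kop (r *\<^sub>R a) b = r *\<^sub>R Kop a b" "Kop a (r *\<^sub>R b) = r *\<^sub>R Kop a b" for r a b
    by (rule bcontfun_eqI, simp add: Kop_apply mult.assoc mult.left_commute[of _ r])+
qed

sublocale ip: bounded_bilinear ip by (rule bounded_bilinear_ip)
sublocale mult: bounded_bilinear mult by (rule bounded_bilinear_mult)
sublocale Kop: bounded_bilinear Kop by (rule bounded_bilinear_Kop)

lemma ip_commute: "ip u v = ip v u"
  unfolding ip_def inner_lam_def by (simp add: mult.commute)

text \<open>Fubini, followed by symmetry of V. This self-adjointness turns a kernel vector of the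
  linearisation into a conormal for the parameters.\<close>

lemma ip_Kop_sym:
  fixes V :: "('m \<times> 'm) \<Rightarrow>\<^sub>C real"
  assumes sym: "\<And>x y. V (x, y) = V (y, x)"
  shows "ip u (Kop V h) = ip (Kop V u) h"
proof -
  interpret prob_space lam by (rule prob_lam)
  interpret P: pair_prob_space lam lam ..
  \<comment> \<open>Second countability identifies the product sigma-algebra with the Borel sets of
    the product, so that continuity yields measurability there.\<close>
  have [simp]: "sets (lam \<Otimes>\<^sub>M lam) = sets borel"
    using sets_pair_measure_cong[OF sets_lam sets_lam] unfolding borel_prod .
  have c: "continuous_on UNIV (\<lambda>z. u (fst z) * (V z * h (snd z)))"
    using continuous_on_compose2[OF continuous_on_apply_bcontfun[of UNIV u] continuous_on_fst[OF continuous_on_id]]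
      continuous_on_compose2[OF continuous_on_apply_bcontfun[of UNIV h] continuous_on_snd[OF continuous_on_id]]
    by (intro continuous_on_mult) auto
  have m: "(\<lambda>z. u (fst z) * (V z * h (snd z))) \<in> borel_measurable (lam \<Otimes>\<^sub>M lam)"
    unfolding measurable_cong_sets[OF \<open>sets (lam \<Otimes>\<^sub>M lam) = _\<close> refl]
    using c by (rule borel_measurable_continuous_onI)
  have "integrable (lam \<Otimes>\<^sub>M lam) (\<lambda>z. u (fst z) * (V z * h (snd z)))"
  proof (rule P.integrable_const_bound[OF AE_I2 m])
    fix z
    show "norm (u (fst z) * (V z * h (snd z))) \<le> norm u * (norm V * norm h)"
      unfolding real_norm_def abs_mult by (intro mult_mono abs_apply_le_norm) auto
  qed
  then have I: "integrable (lam \<Otimes>\<^sub>M lam) (\<lambda>(x, y). u x * (V (x, y) * h y))"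
    by (simp add: case_prod_unfold)
  have "ip u (Kop V h) = (\<integral>x. (\<integral>y. u x * (V (x, y) * h y) \<partial>lam) \<partial>lam)"
    unfolding ip_def inner_lam_def Kop_apply by simp
  also have "\<dots> = (\<integral>y. (\<integral>x. u x * (V (x, y) * h y) \<partial>lam) \<partial>lam)"
    by (rule P.Fubini_integral[OF I, symmetric])
  also have "\<dots> = ip (Kop V u) h"
    unfolding ip_def inner_lam_def Kop_apply
  proof (rule Bochner_Integration.integral_cong[OF refl])
    fix y
    have "(\<integral>x. u x * (V (x, y) * h y) \<partial>lam) = (\<integral>x. (V (y, x) * u x) * h y \<partial>lam)"
      by (intro Bochner_Integration.integral_cong refl) (simp add: sym[of _ y])
    then show "(\<integral>x. u x * (V (x, y) * h y) \<partial>lam) = (\<integral>x. V (y, x) * u x \<partial>lam) * h y" by simp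
  qed
  finally show ?thesis .
qed


section \<open>Compactness of the kernel operators\<close>

lemma Kop_diff_le:
  assumes "\<And>y. \<bar>apply_bcontfun V (x, y) - apply_bcontfun V (z, y)\<bar> \<le> d"
  shows "\<bar>Kop V h x - Kop V h z\<bar> \<le> d * norm h"
proof -
  have i: "integrable lam (\<lambda>y. apply_bcontfun V (x, y) * apply_bcontfun h y)" for x
    by (intro integrable_continuous continuous_intros continuous_slice) auto
  \<comment> \<open>Any single point of the type shows that \<open>d\<close> is nonnegative.\<close>
  have "d \<ge> 0" using assms[of undefined] by linarith
  have "Kop V h x - Kop V h z = (\<integral>y. (V (x, y) - V (z, y)) * h y \<partial>lam)"
    unfolding Kop_apply left_diff_distrib by (rule Bochner_Integration.integral_diff[OF i i, symmetric])
  also have "\<bar>\<dots>\<bar> \<le> d * norm h"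
    using assms \<open>d \<ge> 0\<close>
    by (intro integral_abs_le continuous_intros continuous_slice)
      (auto simp: abs_mult intro!: mult_mono abs_apply_le_norm)
  finally show ?thesis .
qed

text \<open>Arzela-Ascoli without a metric on the domain: a function in the image is determined up
  to 3e/4 by its values on a finite net, rounded down to multiples of e/4, and the sup bound leaves
  finitely many such codes.\<close>

lemma compact_closure_Kop: "compact (closure (Kop V ` {h. norm h \<le> B}))"
proof -
  define S where "S = Kop V ` {h. norm h \<le> B}"
  have "\<exists>k. finite k \<and> closure S \<subseteq> (\<Union>x\<in>k. ball x e)" if e: "e > 0" for e
  proof -
    define d where "d = e / (4 * (\<bar>B\<bar> + 1))"
    have d: "d > 0" unfolding d_def using e by (simp add: add_nonneg_pos)
    have dB: "d * norm h \<le> e / 4" if "norm h \<le> B" for h :: "'m \<Rightarrow>\<^sub>C real"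
    proof -
      have "d * norm h \<le> d * (\<bar>B\<bar> + 1)" using that d by (intro mult_left_mono) auto
      also have "\<dots> = e / 4" unfolding d_def by (simp add: field_simps add_nonneg_eq_0_iff)
      finally show ?thesis .
    qed
    have "continuous_on UNIV (apply_bcontfun V)" by simp
    from finite_equicontinuity_net[OF compact_M compact_M this d]
    obtain Z where Z: "finite Z" "\<And>x. \<exists>z\<in>Z. \<forall>y. \<bar>V (x, y) - V (z, y)\<bar> \<le> d" by blast
    define code where "code \<phi> = (\<lambda>z\<in>Z. \<lfloor>apply_bcontfun \<phi> z / (e / 4)\<rfloor>)" for \<phi> :: "'m \<Rightarrow>\<^sub>C real"
    define C where "C = norm V * B"
    have "code ` S \<subseteq> (\<Pi>\<^sub>E z\<in>Z. {\<lfloor>- C / (e / 4)\<rfloor>..\<lfloor>C / (e / 4)\<rfloor>})"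
    proof (rule image_subsetI)
      fix \<phi> assume "\<phi> \<in> S"
      then obtain h where h: "\<phi> = Kop V h" "norm h \<le> B" by (auto simp: S_def)
      have "norm \<phi> \<le> C" unfolding h C_def
        using norm_Kop[of V h] mult_left_mono[OF h(2) norm_ge_zero[of V]] by linarith
      then have "\<bar>\<phi> z\<bar> \<le> C" for z using abs_apply_le_norm[of \<phi> z] by linarith
      then have "- C \<le> \<phi> z" "\<phi> z \<le> C" for z by (simp_all add: abs_le_iff minus_le_iff)
      then have "\<lfloor>\<phi> z / (e / 4)\<rfloor> \<in> {\<lfloor>- C / (e / 4)\<rfloor>..\<lfloor>C / (e / 4)\<rfloor>}" for z
        unfolding atLeastAtMost_iff using e by (intro conjI floor_mono divide_right_mono) auto
      then show "code \<phi> \<in> (\<Pi>\<^sub>E z\<in>Z. {\<lfloor>- C / (e / 4)\<rfloor>..\<lfloor>C / (e / 4)\<rfloor>})"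
        unfolding code_def restrict_PiE_iff by blast
    qed
    then have fin: "finite (code ` S)"
      by (rule finite_subset) (intro finite_PiE Z(1) finite_atLeastAtMost_int)
    define k where "k = inv_into S code ` code ` S"
    \<comment> \<open>Three errors of e/4: moving from x to the net point for each of the two
      functions, and the rounding at the net point.\<close>
    have close: "dist \<phi> \<psi> \<le> 3 * e / 4" if "\<phi> \<in> S" "\<psi> \<in> S" "code \<phi> = code \<psi>" for \<phi> \<psi>
    proof (rule dist_bound)
      fix x
      obtain z where z: "z \<in> Z" "\<And>y. \<bar>V (x, y) - V (z, y)\<bar> \<le> d" using Z(2)[of x] by auto
      have *: "\<bar>\<eta> x - \<eta> z\<bar> \<le> e / 4" if "\<eta> \<in> S" for \<eta>
      proof -
        obtain h where h: "\<eta> = Kop V h" "norm h \<le> B" using \<open>\<eta> \<in> S\<close> by (auto simp: S_def)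
        show ?thesis unfolding h(1) using Kop_diff_le[of V x z d h, OF z(2)] dB[OF h(2)] by linarith
      qed
      have "\<lfloor>\<phi> z / (e / 4)\<rfloor> = \<lfloor>\<psi> z / (e / 4)\<rfloor>"
        using fun_cong[OF that(3), of z] z(1) by (simp add: code_def)
      then have "\<bar>\<phi> z / (e / 4) - \<psi> z / (e / 4)\<bar> \<le> 1" by linarith
      then have "e / 4 * \<bar>(\<phi> z - \<psi> z) / (e / 4)\<bar> \<le> e / 4 * 1"
        using e by (intro mult_left_mono) (auto simp: diff_divide_distrib)
      moreover have "e / 4 * \<bar>(\<phi> z - \<psi> z) / (e / 4)\<bar> = \<bar>\<phi> z - \<psi> z\<bar>"
        using e by (subst abs_divide) simp
      ultimately have "\<bar>\<phi> z - \<psi> z\<bar> \<le> e / 4" by (simp only: mult_1_right)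
      then show "dist (\<phi> x) (\<psi> x) \<le> 3 * e / 4"
        using *[OF that(1)] *[OF that(2)] unfolding dist_real_def by linarith
    qed
    \<comment> \<open>A finite union of closed balls is closed and so contains the closure; the gap
      between 3e/4 and e then allows open balls.\<close>
    have "S \<subseteq> (\<Union>x\<in>k. cball x (3 * e / 4))"
    proof
      fix \<phi> assume "\<phi> \<in> S"
      then have "inv_into S code (code \<phi>) \<in> S" "code (inv_into S code (code \<phi>)) = code \<phi>"
        by (auto intro: inv_into_into f_inv_into_f)
      then show "\<phi> \<in> (\<Union>x\<in>k. cball x (3 * e / 4))"
        using close[of "inv_into S code (code \<phi>)" \<phi>] \<open>\<phi> \<in> S\<close> unfolding k_def by auto
    qed
    moreover have "closed (\<Union>x\<in>k. cball x (3 * e / 4))"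
      using fin unfolding k_def by (intro closed_UN) auto
    ultimately have "closure S \<subseteq> (\<Union>x\<in>k. cball x (3 * e / 4))" by (rule closure_minimal)
    also have "\<dots> \<subseteq> (\<Union>x\<in>k. ball x e)" using e by (intro UN_mono) auto
    finally show ?thesis using fin unfolding k_def by blast
  qed
  moreover have "Topological_Spaces.complete (closure S)"
    using complete_closed_subset[OF closed_closure subset_UNIV complete_UNIV_bcontfun] .
  ultimately show ?thesis unfolding S_def[symmetric] compact_eq_totally_bounded by blast
qed

lemma Kop_subsequence:
  fixes h :: "nat \<Rightarrow> 'm \<Rightarrow>\<^sub>C real"
  assumes "\<And>n. norm (h n) \<le> B"
  obtains r \<phi> where "strict_mono r" "(\<lambda>n. Kop V (h (r n))) \<longlonglongrightarrow> \<phi>"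
proof -
  have mem: "\<forall>n. Kop V (h n) \<in> closure (Kop V ` {h. norm h \<le> B})"
    using assms closure_subset by fastforce
  have "seq_compact (closure (Kop V ` {h. norm h \<le> B}))"
    using compact_closure_Kop by (simp add: compact_eq_seq_compact_metric)
  from seq_compactE[OF this mem] show ?thesis using that unfolding comp_def by blast
qed

text \<open>On bounded sets \<open>Kop (V n - V')\<close> tends to 0 uniformly, so compactness of
  the limit operator suffices. The limit \<phi> is common to both sequences, which later identifies
  it with \<open>Kop V'\<close> of the limit function.\<close>

lemma Kop_subsequence_varying:
  assumes V: "V \<longlonglongrightarrow> V'" and h: "\<And>n. norm (h n) \<le> B"
  obtains r \<phi> where "strict_mono (r :: nat \<Rightarrow> nat)" "(\<lambda>n. Kop (V (r n)) (h (r n))) \<longlonglongrightarrow> \<phi>"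
    "(\<lambda>n. Kop V' (h (r n))) \<longlonglongrightarrow> \<phi>"
proof -
  obtain r \<phi> where r: "strict_mono r" "(\<lambda>n. Kop V' (h (r n))) \<longlonglongrightarrow> \<phi>"
    using Kop_subsequence[OF h] .
  have "(\<lambda>n. Kop (V (r n) - V') (h (r n))) \<longlonglongrightarrow> 0"
  proof (rule Lim_null_comparison)
    show "\<forall>\<^sub>F n in sequentially. norm (Kop (V (r n) - V') (h (r n))) \<le> norm (V (r n) - V') * B"
      using norm_Kop h by (intro always_eventually allI) (meson mult_left_mono norm_ge_zero order_trans)
    have "(\<lambda>n. V (r n)) \<longlonglongrightarrow> V'" using LIMSEQ_subseq_LIMSEQ[OF V r(1)] by (simp add: comp_def)
    then show "(\<lambda>n. norm (V (r n) - V') * B) \<longlonglongrightarrow> 0"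
      by (intro tendsto_mult_left_zero tendsto_norm_zero LIM_zero)
  qed
  from tendsto_add[OF this r(2)] have "(\<lambda>n. Kop (V (r n)) (h (r n))) \<longlonglongrightarrow> \<phi>"
    by (simp add: Kop.diff_left)
  then show ?thesis using that r by blast
qed

section \<open>Gibbs densities and limits of fixed points\<close>

definition one :: "'m \<Rightarrow>\<^sub>C real" where "one = const_bcontfun 1"

lemma one_apply [simp]: "one x = 1" by (simp add: one_def)

lemma ip_one: "ip h one = (\<integral>x. h x \<partial>lam)" by (simp add: ip_def inner_lam_def)

definition exp_neg :: "('m \<Rightarrow>\<^sub>C real) \<Rightarrow> ('m \<Rightarrow>\<^sub>C real)" where
  "exp_neg \<phi> = Bcontfun (\<lambda>x. exp (- \<phi> x))"

lemma exp_neg_apply [simp]: "exp_neg \<phi> x = exp (- \<phi> x)"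
  unfolding exp_neg_def by (subst apply_Bcontfun_compact[OF compact_M]) (auto intro!: continuous_intros)

lemma norm_exp_neg_diff: "norm (exp_neg a - exp_neg b) \<le> exp (norm b) * (exp (norm (a - b)) - 1)"
proof -
  \<comment> \<open>For negative s this is exp s + exp (-s) >= 2, obtained by adding the tangent
    inequalities at 0 of the two exponentials.\<close>
  have *: "\<bar>exp s - 1\<bar> \<le> exp \<bar>s\<bar> - 1" for s :: real
  proof (cases "s \<ge> 0")
    case False
    then have *: "\<bar>exp s - 1\<bar> = 1 - exp s" "\<bar>s\<bar> = - s" by auto
    show ?thesis
      unfolding * using exp_ge_add_one_self[of s] exp_ge_add_one_self[of "- s"] by linarith
  qed simp
  have "\<bar>exp (- a x) - exp (- b x)\<bar> \<le> exp (norm b) * (exp (norm (a - b)) - 1)" for x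
  proof -
    have "exp (- a x) - exp (- b x) = exp (- b x) * (exp (b x - a x) - 1)"
      by (simp add: algebra_simps flip: exp_add)
    then have "\<bar>exp (- a x) - exp (- b x)\<bar> = exp (- b x) * \<bar>exp (b x - a x) - 1\<bar>" by (simp add: abs_mult)
    also have "\<dots> \<le> exp (norm b) * (exp (norm (a - b)) - 1)"
    proof (intro mult_mono)
      show "exp (- b x) \<le> exp (norm b)" using abs_apply_le_norm[of b x] by auto
      have "\<bar>b x - a x\<bar> \<le> norm (a - b)" using abs_apply_le_norm[of "a - b" x] by simp
      then show "\<bar>exp (b x - a x) - 1\<bar> \<le> exp (norm (a - b)) - 1"
        using *[of "b x - a x"] exp_le_cancel_iff[of "\<bar>b x - a x\<bar>" "norm (a - b)"] by linarith
    qed auto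
    finally show ?thesis .
  qed
  then show ?thesis by (simp add: norm_bcontfun_le_iff)
qed

lemma tendsto_exp_neg:
  assumes "(f \<longlongrightarrow> g) F"
  shows "((\<lambda>n. exp_neg (f n)) \<longlongrightarrow> exp_neg g) F"
proof (rule LIM_zero_cancel, rule Lim_null_comparison)
  show "\<forall>\<^sub>F n in F. norm (exp_neg (f n) - exp_neg g) \<le> exp (norm g) * (exp (norm (f n - g)) - 1)"
    by (simp add: norm_exp_neg_diff)
  have "((\<lambda>n. exp (norm g) * (exp (norm (f n - g)) - 1)) \<longlongrightarrow> exp (norm g) * (exp (norm (g - g)) - 1)) F"
    by (intro tendsto_intros assms)
  then show "((\<lambda>n. exp (norm g) * (exp (norm (f n - g)) - 1)) \<longlongrightarrow> 0) F" by simp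
qed

definition gibbs :: "('m \<Rightarrow>\<^sub>C real) \<Rightarrow> ('m \<Rightarrow>\<^sub>C real)" where
  "gibbs \<phi> = exp_neg \<phi> /\<^sub>R ip (exp_neg \<phi>) one"

lemma ip_exp_neg_pos: "ip (exp_neg \<phi>) one > 0"
  unfolding ip_one exp_neg_apply
  by (rule integral_pos) (intro continuous_intros continuous_on_apply_bcontfun, simp)

lemma gibbs_apply: "apply_bcontfun (gibbs \<phi>) = xi lam \<phi>"
  by (rule ext) (simp add: gibbs_def xi_def ip_one field_simps)

lemma tendsto_gibbs:
  assumes "(f \<longlongrightarrow> g) F"
  shows "((\<lambda>n. gibbs (f n)) \<longlongrightarrow> gibbs g) F"
  unfolding gibbs_def using ip_exp_neg_pos[of g]
  by (intro tendsto_intros tendsto_exp_neg ip.tendsto assms) auto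

text \<open>The fixed point equation is put on densities, which are elements of a Banach space;
  \<open>fixed_point_density\<close> and \<open>fixed_density_is_fixed_point\<close> lead to
  measures and back. Positivity and unit mass follow from the form of \<open>gibbs\<close>.\<close>

definition fixed_density :: "(('m \<times> 'm) \<Rightarrow>\<^sub>C real) \<Rightarrow> ('m \<Rightarrow>\<^sub>C real) \<Rightarrow> bool" where
  "fixed_density V f \<longleftrightarrow> f = gibbs (Kop V f)"

definition kernel_vector :: "(('m \<times> 'm) \<Rightarrow>\<^sub>C real) \<Rightarrow> ('m \<Rightarrow>\<^sub>C real) \<Rightarrow> ('m \<Rightarrow>\<^sub>C real) \<Rightarrow> bool" where
  "kernel_vector V f u \<longleftrightarrow> ip u one = 0 \<and> u + mult f (Kop V u) - ip f (Kop V u) *\<^sub>R f = 0"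

lemma fixed_density_pos: "fixed_density V f \<Longrightarrow> f x > 0"
  unfolding fixed_density_def using ip_exp_neg_pos
  by (metis exp_neg_apply exp_gt_zero mult_pos_pos positive_imp_inverse_positive real_scaleR_def
      scaleR_bcontfun.rep_eq gibbs_def)

lemma fixed_density_ip_one:
  assumes "fixed_density V f" shows "ip f one = 1"
proof -
  have "ip (gibbs \<phi>) one = 1" for \<phi>
    using ip_exp_neg_pos[of \<phi>] by (simp add: gibbs_def ip.scaleR_left)
  then show ?thesis using assms unfolding fixed_density_def by metis
qed

lemma fixed_density_log:
  assumes "fixed_density V f"
  obtains c where "\<And>x. ln (f x) + Kop V f x = c"
proof
  fix x
  have "f x = exp (- Kop V f x) / ip (exp_neg (Kop V f)) one"
    using assms unfolding fixed_density_def
    by (metis divide_inverse_commute exp_neg_apply real_scaleR_def scaleR_bcontfun.rep_eq gibbs_def)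
  then show "ln (f x) + Kop V f x = - ln (ip (exp_neg (Kop V f)) one)"
    using ip_exp_neg_pos[of "Kop V f"] by (simp add: ln_div)
qed

text \<open>Since f is positive with unit mass, |V f| is at most the norm of V. The numerator of the
  Gibbs formula is then at most exp (norm V) and the normalising integral at least exp (- norm V).
  As the bound involves the kernel only, it is uniform along convergent sequences of
  kernels.\<close>

lemma fixed_density_norm_le:
  assumes "fixed_density V f" shows "norm f \<le> exp (2 * norm V)"
proof -
  have fp: "f x > 0" for x using assms by (rule fixed_density_pos)
  have c: "continuous_on UNIV (\<lambda>y. V (x, y) * f y)" for x
    by (intro continuous_intros continuous_slice) auto
  have K: "\<bar>Kop V f x\<bar> \<le> norm V" for x
  proof -
    have "\<bar>Kop V f x\<bar> \<le> (\<integral>y. \<bar>V (x, y) * f y\<bar> \<partial>lam)"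
      unfolding Kop_apply using integral_norm_bound[of lam "\<lambda>y. V (x, y) * f y"] by simp
    also have "\<dots> \<le> (\<integral>y. norm V * f y \<partial>lam)"
      using abs_apply_le_norm[of V] fp
      by (intro integral_mono integrable_continuous continuous_intros c)
        (auto simp: abs_mult less_imp_le intro!: mult_right_mono)
    also have "\<dots> = norm V" using fixed_density_ip_one[OF assms] by (simp add: ip_one)
    finally show ?thesis .
  qed
  let ?c = "ip (exp_neg (Kop V f)) one"
  have "(\<integral>x. exp (- norm V) \<partial>lam) \<le> ?c"
    unfolding ip_one exp_neg_apply
  proof (intro integral_mono integrable_continuous)
    show "continuous_on UNIV (\<lambda>x. exp (- Kop V f x))"
      by (intro continuous_intros continuous_on_apply_bcontfun)
    show "exp (- norm V) \<le> exp (- Kop V f x)" for x using K[of x] by auto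
  qed auto
  then have c: "exp (- norm V) \<le> ?c" unfolding integral_const_lam .
  have "f x \<le> exp (2 * norm V)" for x
  proof -
    have "f x = exp (- Kop V f x) / ?c"
      using assms unfolding fixed_density_def
      by (metis divide_inverse_commute exp_neg_apply real_scaleR_def scaleR_bcontfun.rep_eq gibbs_def)
    also have "\<dots> \<le> exp (norm V) / exp (- norm V)"
      using c K[of x] by (intro frac_le) (auto simp: abs_le_iff)
    finally show ?thesis by (simp add: exp_minus divide_inverse mult_exp_exp)
  qed
  then show ?thesis using fp by (auto simp: norm_bcontfun_le_iff less_imp_le)
qed

text \<open>The images \<open>Kop (V n) (f n)\<close> of the bounded densities subconverge, and each
  density is \<open>gibbs\<close> of its image, so convergence passes from the images to the
  densities themselves.\<close>

lemma fixed_density_subsequence: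
  assumes V: "V \<longlonglongrightarrow> V'" and f: "\<And>n. fixed_density (V n) (f n)"
  obtains r g where "strict_mono (r :: nat \<Rightarrow> nat)" "(\<lambda>n. f (r n)) \<longlonglongrightarrow> g" "fixed_density V' g"
proof -
  obtain B where B: "\<And>n. norm (V n) \<le> B"
    using convergent_imp_Bseq[OF convergentI[OF V]] by (auto simp: Bseq_def)
  have "norm (f n) \<le> exp (2 * B)" for n
    using fixed_density_norm_le[OF f[of n]] B[of n] exp_le_cancel_iff[of "2 * norm (V n)" "2 * B"] by linarith
  then obtain r \<phi> where r: "strict_mono r" "(\<lambda>n. Kop (V (r n)) (f (r n))) \<longlonglongrightarrow> \<phi>"
    "(\<lambda>n. Kop V' (f (r n))) \<longlonglongrightarrow> \<phi>" by (rule Kop_subsequence_varying[OF V])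
  have "gibbs (Kop (V (r n)) (f (r n))) = f (r n)" for n using f[of "r n"] by (simp add: fixed_density_def)
  then have lim: "(\<lambda>n. f (r n)) \<longlonglongrightarrow> gibbs \<phi>" using tendsto_gibbs[OF r(2)] by simp
  have "(\<lambda>n. Kop V' (f (r n))) \<longlonglongrightarrow> Kop V' (gibbs \<phi>)" by (intro Kop.tendsto tendsto_const lim)
  then have "Kop V' (gibbs \<phi>) = \<phi>" using r(3) LIMSEQ_unique by blast
  then have "fixed_density V' (gibbs \<phi>)" by (simp add: fixed_density_def)
  then show ?thesis using that r(1) lim by blast
qed

text \<open>As for densities, the equation expresses u n through its image under a compact operator,
  so a subsequence converges in norm. Norm convergence is what keeps the limit from
  vanishing.\<close>

lemma kernel_vector_subsequence:
  assumes V: "V \<longlonglongrightarrow> V'" and f: "f \<longlonglongrightarrow> g"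
    and u: "\<And>n. kernel_vector (V n) (f n) (u n)" "\<And>n. norm (u n) = 1"
  obtains v where "kernel_vector V' g v" "norm v = 1"
proof -
  have "norm (u n) \<le> 1" for n using u(2)[of n] by simp
  then obtain r \<phi> where r: "strict_mono r" "(\<lambda>n. Kop (V (r n)) (u (r n))) \<longlonglongrightarrow> \<phi>"
    "(\<lambda>n. Kop V' (u (r n))) \<longlonglongrightarrow> \<phi>" by (rule Kop_subsequence_varying[OF V])
  have fr: "(\<lambda>n. f (r n)) \<longlonglongrightarrow> g" using LIMSEQ_subseq_LIMSEQ[OF f r(1)] by (simp add: comp_def)
  define v where "v = ip g \<phi> *\<^sub>R g - mult g \<phi>"
  have "(\<lambda>n. ip (f (r n)) (Kop (V (r n)) (u (r n))) *\<^sub>R f (r n) -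
      mult (f (r n)) (Kop (V (r n)) (u (r n)))) \<longlonglongrightarrow> v"
    unfolding v_def by (intro tendsto_intros ip.tendsto mult.tendsto fr r(2))
  moreover have "u (r n) = ip (f (r n)) (Kop (V (r n)) (u (r n))) *\<^sub>R f (r n) -
      mult (f (r n)) (Kop (V (r n)) (u (r n)))" for n
    using u(1)[of "r n"] unfolding kernel_vector_def by (simp add: algebra_simps eq_neg_iff_add_eq_0)
  ultimately have ur: "(\<lambda>n. u (r n)) \<longlonglongrightarrow> v" by simp
  have "(\<lambda>n. Kop V' (u (r n))) \<longlonglongrightarrow> Kop V' v" by (intro Kop.tendsto tendsto_const ur)
  then have K: "Kop V' v = \<phi>" using r(3) LIMSEQ_unique by blast
  have "(\<lambda>n. ip (u (r n)) one) \<longlonglongrightarrow> ip v one" by (intro ip.tendsto tendsto_const ur)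
  then have "ip v one = 0" using u(1) by (simp add: kernel_vector_def LIMSEQ_const_iff)
  then have "kernel_vector V' g v" unfolding kernel_vector_def K by (simp add: v_def)
  moreover have "norm v = 1" using tendsto_norm[OF ur] u(2) by (simp add: LIMSEQ_const_iff)
  ultimately show ?thesis by (rule that)
qed

section \<open>The linearised fixed point equation\<close>

definition sum_kernel :: "('m \<Rightarrow>\<^sub>C real) \<Rightarrow> (('m \<times> 'm) \<Rightarrow>\<^sub>C real)" where
  "sum_kernel g = Bcontfun (\<lambda>z. g (fst z) + g (snd z))"

definition slice :: "(('m \<times> 'm) \<Rightarrow>\<^sub>C real) \<Rightarrow> 'm \<Rightarrow> ('m \<Rightarrow>\<^sub>C real)" where
  "slice V z = Bcontfun (\<lambda>y. V (z, y))"

definition recip :: "('m \<Rightarrow>\<^sub>C real) \<Rightarrow> ('m \<Rightarrow>\<^sub>C real)" where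
  "recip f = Bcontfun (\<lambda>x. 1 / f x)"

lemma sum_kernel_apply: "sum_kernel g z = g (fst z) + g (snd z)"
proof -
  have "continuous_on UNIV (\<lambda>z. g (fst z) + g (snd z))"
    using continuous_on_compose2[OF continuous_on_apply_bcontfun[of UNIV g] continuous_on_fst[OF continuous_on_id]]
      continuous_on_compose2[OF continuous_on_apply_bcontfun[of UNIV g] continuous_on_snd[OF continuous_on_id]]
    by (intro continuous_on_add) auto
  then show ?thesis
    unfolding sum_kernel_def by (subst apply_Bcontfun_compact[OF compact_UNIV_Times[OF compact_M]]) auto
qed

lemma sum_kernel_add: "sum_kernel (a + b) = sum_kernel a + sum_kernel b"
  by (rule bcontfun_eqI) (simp add: sum_kernel_apply)

lemma slice_apply: "slice V z y = V (z, y)"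
  unfolding slice_def by (subst apply_Bcontfun_compact[OF compact_M continuous_slice]) simp

lemma norm_slice_le: "norm (slice V z) \<le> norm V"
  by (auto simp: norm_bcontfun_le_iff slice_apply abs_apply_le_norm)

lemma recip_apply:
  fixes f :: "'m \<Rightarrow>\<^sub>C real"
  assumes "\<And>x. f x > 0" shows "recip f x = 1 / f x"
proof -
  have "continuous_on UNIV (\<lambda>x. 1 / f x)"
    using assms by (intro continuous_intros) (auto simp: less_le)
  then show ?thesis unfolding recip_def by (subst apply_Bcontfun_compact[OF compact_M]) auto
qed

lemma ip_slice: "ip u (slice V z) = Kop V u z"
  by (simp add: ip_def inner_lam_def slice_apply Kop_apply mult.commute)

lemma ip_mult: "ip (mult v u) h = ip u (mult v h)"
  by (simp add: ip_def inner_lam_def mult_ac)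

text \<open>The two cases of interest are densities, \<open>ip h one = 1\<close>, for which the
  perturbation adds g and a constant, and kernel vectors, \<open>ip h one = 0\<close>, for which it
  adds a constant.\<close>

lemma Kop_sum_kernel: "Kop (V + sum_kernel g) h x = Kop V h x + g x * ip h one + ip g h"
proof -
  have i: "integrable lam (\<lambda>y. V (x, y) * h y)" "integrable lam (\<lambda>y. g x * h y)" "integrable lam (\<lambda>y. g y * h y)"
    by (intro integrable_continuous continuous_intros continuous_slice continuous_on_apply_bcontfun)+
  have "Kop (V + sum_kernel g) h x = (\<integral>y. V (x, y) * h y + (g x * h y + g y * h y) \<partial>lam)"
    by (simp add: Kop_apply sum_kernel_apply algebra_simps)
  also have "\<dots> = (\<integral>y. V (x, y) * h y \<partial>lam) + ((\<integral>y. g x * h y \<partial>lam) + (\<integral>y. g y * h y \<partial>lam))"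
    by (simp only: Bochner_Integration.integral_add[OF i(1) Bochner_Integration.integrable_add[OF i(2,3)]]
        Bochner_Integration.integral_add[OF i(2,3)])
  finally show ?thesis by (simp add: Kop_apply ip_def inner_lam_def)
qed

text \<open>Kernel of the derivative of ln f + V f modulo constants, at an arbitrary f rather than
  at fixed points only. \<kappa> is the Lagrange multiplier of the mass constraint.\<close>

definition linear_kernel :: "(('m \<times> 'm) \<Rightarrow>\<^sub>C real) \<Rightarrow> ('m \<Rightarrow>\<^sub>C real) \<Rightarrow> ('m \<Rightarrow>\<^sub>C real) \<Rightarrow> bool" where
  "linear_kernel V f u \<longleftrightarrow> ip u one = 0 \<and> (\<exists>\<kappa>. \<forall>x. u x / f x + Kop V u x = \<kappa>)"

text \<open>Division by f turns the projection term into a constant, and on the mean-zero u the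
  perturbation contributes the constant \<open>ip g u\<close>; both are absorbed in
  \<kappa>.\<close>

lemma kernel_vector_sum_kernel_linear_kernel:
  assumes "kernel_vector (V + sum_kernel g) f u" and f: "\<And>x. f x > 0"
  shows "linear_kernel V f u"
proof -
  have u: "ip u one = 0" "u + mult f (Kop (V + sum_kernel g) u) - ip f (Kop (V + sum_kernel g) u) *\<^sub>R f = 0"
    using assms(1) by (auto simp: kernel_vector_def)
  have "u x / f x + Kop V u x = ip f (Kop (V + sum_kernel g) u) - ip g u" for x
  proof -
    have "apply_bcontfun (u + mult f (Kop (V + sum_kernel g) u) - ip f (Kop (V + sum_kernel g) u) *\<^sub>R f) x = 0"
      unfolding u(2) by simp
    then have "u x + f x * Kop (V + sum_kernel g) u x = ip f (Kop (V + sum_kernel g) u) * f x" by simp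
    then have "u x / f x + Kop (V + sum_kernel g) u x = ip f (Kop (V + sum_kernel g) u)"
      using f[of x] by (simp add: field_simps)
    moreover have "Kop (V + sum_kernel g) u x = Kop V u x + ip g u" by (simp add: Kop_sum_kernel u(1))
    ultimately show ?thesis by linarith
  qed
  then show ?thesis unfolding linear_kernel_def using u(1) by blast
qed

lemma linear_kernel_scaleR:
  assumes "linear_kernel V f u" shows "linear_kernel V f (c *\<^sub>R u)"
proof -
  obtain \<kappa> where "\<And>x. u x / f x + Kop V u x = \<kappa>" using assms by (auto simp: linear_kernel_def)
  then have "(c *\<^sub>R u) x / f x + Kop V (c *\<^sub>R u) x = c * \<kappa>" for x
    by (metis Kop.scaleR_right distrib_left real_scaleR_def scaleR_bcontfun.rep_eq times_divide_eq_right)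
  then show ?thesis using assms unfolding linear_kernel_def by (auto simp: ip.scaleR_left)
qed

text \<open>Multiplying by f and pairing with 1 determines \<kappa> through the mass conditions.
  Thus h is recovered from its compact image and the error, the form in which compactness and
  smallness arguments apply.\<close>

lemma linearized_solution:
  fixes f h :: "'m \<Rightarrow>\<^sub>C real"
  assumes f: "\<And>x. f x > 0" "ip f one = 1" and h: "ip h one = 0"
    and eq: "\<And>x. h x / f x + Kop V h x = \<kappa> + apply_bcontfun e x"
  shows "h = ip f (Kop V h - e) *\<^sub>R f - mult f (Kop V h - e)"
proof -
  have "h = \<kappa> *\<^sub>R f - mult f (Kop V h - e)"
  proof (rule bcontfun_eqI)
    fix x
    have "h x = f x * (\<kappa> + e x - Kop V h x)" using eq[of x] f(1)[of x] by (simp add: field_simps)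
    then show "h x = (\<kappa> *\<^sub>R f - mult f (Kop V h - e)) x" by (simp add: algebra_simps)
  qed
  moreover from this have "ip h one = ip (\<kappa> *\<^sub>R f - mult f (Kop V h - e)) one" by simp
  then have "\<kappa> = ip f (Kop V h - e)"
    using h f(2) unfolding ip.diff_left ip.scaleR_left by (simp add: ip_def inner_lam_def)
  ultimately show ?thesis by simp
qed

section \<open>Separating points and quantitative injectivity\<close>

definition separating :: "(('m \<times> 'm) \<Rightarrow>\<^sub>C real) \<Rightarrow> ('m \<Rightarrow>\<^sub>C real) \<Rightarrow> 'm set \<Rightarrow> bool" where
  "separating V f Z \<longleftrightarrow> finite Z \<and> (\<forall>u. linear_kernel V f u \<and> (\<forall>z\<in>Z. Kop V u z = 0) \<longrightarrow> u = 0)"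

text \<open>If V u vanishes on a fine net, equicontinuity gives ||V u|| <= d ||u||, whereas
  \<open>linearized_solution\<close> gives ||u|| <= b ||V u||; the choice d = 1/(2b) forces u = 0.
  By \<open>ip_slice\<close> the values V u(z) are pairings of u with slices of V, so separating
  points also provide enough perturbation directions.\<close>

lemma ex_separating:
  fixes f :: "'m \<Rightarrow>\<^sub>C real"
  assumes f: "\<And>x. f x > 0" "ip f one = 1"
  shows "\<exists>Z. separating V f Z"
proof -
  define b where "b = norm f * norm f + norm f + 1"
  have b: "b > 0" unfolding b_def by (simp add: add_nonneg_pos)
  define d where "d = 1 / (2 * b)"
  have "d > 0" unfolding d_def using b by simp
  moreover have "continuous_on UNIV (apply_bcontfun V)" by simp
  ultimately obtain Z where Z: "finite Z" "\<And>x. \<exists>z\<in>Z. \<forall>y. \<bar>V (x, y) - V (z, y)\<bar> \<le> d"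
    using finite_equicontinuity_net[OF compact_M compact_M] by metis
  have "u = 0" if u: "linear_kernel V f u" "\<And>z. z \<in> Z \<Longrightarrow> Kop V u z = 0" for u
  proof -
    obtain \<kappa> where \<kappa>: "\<And>x. u x / f x + Kop V u x = \<kappa>" and u1: "ip u one = 0"
      using u(1) by (auto simp: linear_kernel_def)
    have eq: "u = ip f (Kop V u) *\<^sub>R f - mult f (Kop V u)"
      using linearized_solution[OF f u1, of V \<kappa> 0] \<kappa> by simp
    have K: "norm (Kop V u) \<le> d * norm u"
      unfolding norm_bcontfun_le_iff
    proof
      fix x
      obtain z where "z \<in> Z" "\<And>y. \<bar>V (x, y) - V (z, y)\<bar> \<le> d" using Z(2)[of x] by blast
      then show "\<bar>Kop V u x\<bar> \<le> d * norm u" using Kop_diff_le[of V x z d u] u(2)[of z] by simp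
    qed
    have "norm u \<le> norm (ip f (Kop V u) *\<^sub>R f) + norm (mult f (Kop V u))"
      by (subst eq) (rule norm_triangle_ineq4)
    also have "\<dots> \<le> norm f * norm (Kop V u) * norm f + norm f * norm (Kop V u)"
      using abs_ip_le[of f "Kop V u"] norm_mult_le[of f "Kop V u"] by (auto intro!: add_mono mult_right_mono)
    also have "\<dots> \<le> b * norm (Kop V u)" by (simp add: b_def algebra_simps)
    also have "\<dots> \<le> b * (d * norm u)" using K b by simp
    also have "\<dots> = norm u / 2" unfolding d_def using b by (simp add: field_simps)
    finally show ?thesis by simp
  qed
  then show ?thesis using Z(1) unfolding separating_def by blast
qed

text \<open>The dual vectors serve to read off single parameters: pairing \<open>v z\<close> with a
  combination of the slices returns the coefficient at z. Their existence makes the number of points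
  equal to the dimension of the kernel at f.\<close>

lemma ex_separating_dual:
  fixes f :: "'m \<Rightarrow>\<^sub>C real"
  assumes "\<And>x. f x > 0" "ip f one = 1"
  obtains Z v where "separating V f Z" "\<And>z. z \<in> Z \<Longrightarrow> linear_kernel V f (v z)"
    "\<And>z. z \<in> Z \<Longrightarrow> Kop V (v z) z = 1" "\<And>z z'. z \<in> Z \<Longrightarrow> z' \<in> Z \<Longrightarrow> z' \<noteq> z \<Longrightarrow> Kop V (v z) z' = 0"
proof -
  \<comment> \<open>in a separating set of least size no point can be omitted, which yields the dual vectors\<close>
  obtain Z where Z: "separating V f Z" "\<And>Z'. separating V f Z' \<Longrightarrow> card Z \<le> card Z'"
    using ex_has_least_nat[of "separating V f" _ card] ex_separating[OF assms] by metis
  have "\<exists>v. linear_kernel V f v \<and> Kop V v z = 1 \<and> (\<forall>z'\<in>Z. z' \<noteq> z \<longrightarrow> Kop V v z' = 0)" if z: "z \<in> Z" for z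
  proof -
    have fin: "finite Z" using Z(1) by (simp add: separating_def)
    have "\<not> separating V f (Z - {z})"
      using Z(2)[of "Z - {z}"] card_Diff1_less[OF fin z] by auto
    then obtain u where u: "linear_kernel V f u" "\<And>z'. z' \<in> Z - {z} \<Longrightarrow> Kop V u z' = 0" "u \<noteq> 0"
      using fin by (auto simp: separating_def)
    have "Kop V u z \<noteq> 0"
    proof
      assume "Kop V u z = 0"
      then have "\<forall>z'\<in>Z. Kop V u z' = 0" using u(2) by blast
      then show False using Z(1) u(1,3) by (auto simp: separating_def)
    qed
    then show ?thesis using u(2) linear_kernel_scaleR[OF u(1), of "1 / Kop V u z"]
      by (intro exI[of _ "(1 / Kop V u z) *\<^sub>R u"]) (auto simp: Kop.scaleR_right)
  qed
  then show ?thesis using that[OF Z(1)] by metis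
qed

text \<open>Otherwise there are functions h of norm 1 whose errors and values V h on Z tend to 0;
  compactness yields a limit of norm 1 in the kernel at f with V h = 0 on Z, against separation. The
  error \<open>e\<close> is kept general so that nonlinear remainders can be inserted.\<close>

lemma linearized_estimate:
  fixes f :: "'m \<Rightarrow>\<^sub>C real"
  assumes f: "\<And>x. f x > 0" "ip f one = 1" and Z: "separating V f Z"
  obtains C where "C > 0"
    "\<And>h \<kappa> e. ip h one = 0 \<Longrightarrow> (\<And>x. h x / f x + Kop V h x = \<kappa> + apply_bcontfun e x) \<Longrightarrow>
      norm h \<le> C * (norm e + (\<Sum>z\<in>Z. \<bar>Kop V h z\<bar>))"
proof (rule ccontr)
  assume neg: "\<not> thesis"
  have "\<exists>h e \<kappa>. norm h = 1 \<and> ip h one = 0 \<and> (\<forall>x. h x / f x + Kop V h x = \<kappa> + apply_bcontfun e x) \<and>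
      norm e + (\<Sum>z\<in>Z. \<bar>Kop V h z\<bar>) < inverse (real (Suc n))" for n
  proof -
    have "\<exists>h \<kappa> e. ip h one = 0 \<and> (\<forall>x. h x / f x + Kop V h x = \<kappa> + apply_bcontfun e x) \<and>
      real (Suc n) * (norm e + (\<Sum>z\<in>Z. \<bar>Kop V h z\<bar>)) < norm h"
    proof (rule ccontr)
      assume "\<not> ?thesis"
      then have "norm h \<le> real (Suc n) * (norm e + (\<Sum>z\<in>Z. \<bar>Kop V h z\<bar>))"
        if "ip h one = 0" "\<And>x. h x / f x + Kop V h x = \<kappa> + apply_bcontfun e x" for h \<kappa> e
        using that by (meson linorder_not_less)
      then have thesis by (intro that[where C = "real (Suc n)"]) auto
      then show False using neg by blast
    qed
    then obtain h \<kappa> e where h: "ip h one = 0" "\<And>x. h x / f x + Kop V h x = \<kappa> + apply_bcontfun e x"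
      "real (Suc n) * (norm e + (\<Sum>z\<in>Z. \<bar>Kop V h z\<bar>)) < norm h" by blast
    have "0 \<le> real (Suc n) * (norm e + (\<Sum>z\<in>Z. \<bar>Kop V h z\<bar>))"
      by (intro mult_nonneg_nonneg add_nonneg_nonneg sum_nonneg) auto
    then have n: "norm h > 0" using h(3) by linarith
    let ?c = "inverse (norm h)"
    have "(?c *\<^sub>R h) x / f x + Kop V (?c *\<^sub>R h) x = ?c * \<kappa> + (?c *\<^sub>R e) x" for x
      using arg_cong[OF h(2)[of x], of "\<lambda>y. ?c * y"] by (simp add: Kop.scaleR_right distrib_left)
    moreover have "norm (?c *\<^sub>R e) + (\<Sum>z\<in>Z. \<bar>Kop V (?c *\<^sub>R h) z\<bar>) = ?c * (norm e + (\<Sum>z\<in>Z. \<bar>Kop V h z\<bar>))"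
      by (simp add: Kop.scaleR_right abs_mult distrib_left sum_distrib_left)
    moreover have "?c * (norm e + (\<Sum>z\<in>Z. \<bar>Kop V h z\<bar>)) < inverse (real (Suc n))"
      using h(3) n by (simp add: field_simps)
    moreover have "norm (?c *\<^sub>R h) = 1" using n by simp
    moreover have "ip (?c *\<^sub>R h) one = 0" by (simp add: ip.scaleR_left h(1))
    ultimately show ?thesis by metis
  qed
  then obtain h e \<kappa> where h: "\<And>n. norm (h n) = 1" "\<And>n. ip (h n) one = 0"
    "\<And>n x. h n x / f x + Kop V (h n) x = \<kappa> n + apply_bcontfun (e n) x"
    "\<And>n. norm (e n) + (\<Sum>z\<in>Z. \<bar>Kop V (h n) z\<bar>) < inverse (real (Suc n))"
    by metis
  have "norm (h n) \<le> 1" for n using h(1)[of n] by simp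
  then obtain r \<phi> where r: "strict_mono r" "(\<lambda>n. Kop V (h (r n))) \<longlonglongrightarrow> \<phi>" by (rule Kop_subsequence)
  have small: "norm (e n) < inverse (real (Suc n))" "\<And>z. z \<in> Z \<Longrightarrow> \<bar>Kop V (h n) z\<bar> < inverse (real (Suc n))" for n
  proof -
    have fin: "finite Z" using Z by (simp add: separating_def)
    have s: "0 \<le> (\<Sum>z\<in>Z. \<bar>Kop V (h n) z\<bar>)" by (simp add: sum_nonneg)
    then show "norm (e n) < inverse (real (Suc n))" using h(4)[of n] by linarith
    fix z assume "z \<in> Z"
    then have "\<bar>Kop V (h n) z\<bar> \<le> (\<Sum>z\<in>Z. \<bar>Kop V (h n) z\<bar>)" using fin by (intro member_le_sum) auto
    then show "\<bar>Kop V (h n) z\<bar> < inverse (real (Suc n))" using h(4)[of n] norm_ge_zero[of "e n"] by linarith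
  qed
  have "e \<longlonglongrightarrow> 0"
    by (rule Lim_null_comparison[OF _ LIMSEQ_inverse_real_of_nat]) (use small(1) in \<open>auto intro: always_eventually less_imp_le\<close>)
  then have er: "(\<lambda>n. e (r n)) \<longlonglongrightarrow> 0" using LIMSEQ_subseq_LIMSEQ[OF _ r(1)] by (fastforce simp: comp_def)
  \<comment> \<open>The zeros stand for the limit of \<open>e\<close>, so that the limit matches the
    expression term by term.\<close>
  define g where "g = ip f (\<phi> - 0) *\<^sub>R f - mult f (\<phi> - 0)"
  have "(\<lambda>n. ip f (Kop V (h (r n)) - e (r n)) *\<^sub>R f - mult f (Kop V (h (r n)) - e (r n))) \<longlonglongrightarrow> g"
    unfolding g_def by (intro tendsto_intros ip.tendsto mult.tendsto er r(2))
  moreover have "h n = ip f (Kop V (h n) - e n) *\<^sub>R f - mult f (Kop V (h n) - e n)" for n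
    by (rule linearized_solution[OF f h(2) h(3)])
  then have "(\<lambda>n. ip f (Kop V (h (r n)) - e (r n)) *\<^sub>R f - mult f (Kop V (h (r n)) - e (r n))) = (\<lambda>n. h (r n))"
    by (intro ext) simp
  ultimately have hr: "(\<lambda>n. h (r n)) \<longlonglongrightarrow> g" by simp
  have "(\<lambda>n. Kop V (h (r n))) \<longlonglongrightarrow> Kop V g" by (intro Kop.tendsto tendsto_const hr)
  then have K: "Kop V g = \<phi>" using r(2) LIMSEQ_unique by blast
  have "(\<lambda>n. ip (h (r n)) one) \<longlonglongrightarrow> ip g one" by (intro ip.tendsto tendsto_const hr)
  then have g1: "ip g one = 0" by (simp add: h(2) LIMSEQ_const_iff)
  have "g x / f x + Kop V g x = ip f \<phi>" for x
    unfolding K using f(1)[of x] by (simp add: g_def field_simps)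
  then have "linear_kernel V f g" using g1 unfolding linear_kernel_def by blast
  moreover have "Kop V g z = 0" if "z \<in> Z" for z
  proof -
    have "(\<lambda>n. Kop V (h (r n)) z) \<longlonglongrightarrow> Kop V g z"
      unfolding K by (rule tendsto_apply_bcontfun[OF r(2)])
    moreover have "(\<lambda>n. Kop V (h n) z) \<longlonglongrightarrow> 0"
      by (rule Lim_null_comparison[OF _ LIMSEQ_inverse_real_of_nat])
        (use small(2)[OF that] in \<open>auto intro: always_eventually less_imp_le\<close>)
    then have "(\<lambda>n. Kop V (h (r n)) z) \<longlonglongrightarrow> 0" using LIMSEQ_subseq_LIMSEQ[OF _ r(1)] by (fastforce simp: comp_def)
    ultimately show ?thesis using LIMSEQ_unique by blast
  qed
  ultimately have "g = 0" using Z unfolding separating_def by blast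
  moreover have "norm g = 1" using tendsto_norm[OF hr] h(1) by (simp add: LIMSEQ_const_iff)
  ultimately show False by simp
qed

text \<open>By self-adjointness \<open>ip u (Kop V h)\<close> is \<open>ip (Kop V u) h\<close>,
  which the kernel equation at c rewrites as minus \<open>ip u (mult (recip c) h)\<close>. So the
  terms linear in h cancel, the constants vanish by the two mean-zero conditions, and the pairing
  sees the increment g alone.\<close>

lemma linearized_duality:
  fixes V :: "('m \<times> 'm) \<Rightarrow>\<^sub>C real" and c u h :: "'m \<Rightarrow>\<^sub>C real"
  assumes sym: "\<And>x y. V (x, y) = V (y, x)" and c: "\<And>x. c x > 0"
    and u: "linear_kernel V c u" and h: "ip h one = 0"
  shows "ip u (\<kappa> *\<^sub>R one - Kop V h - g - mult (recip c) h) = - ip u g"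
proof -
  obtain \<kappa>' where \<kappa>': "\<And>x. u x / c x + Kop V u x = \<kappa>'" and u1: "ip u one = 0"
    using u by (auto simp: linear_kernel_def)
  have "Kop V u = \<kappa>' *\<^sub>R one - mult (recip c) u"
    using \<kappa>' by (intro bcontfun_eqI) (simp add: recip_apply[OF c] algebra_simps)
  then have "ip (Kop V u) h = - ip u (mult (recip c) h)"
    by (simp add: ip.diff_left ip.scaleR_left ip_mult h ip_commute[of one])
  then show ?thesis using ip_Kop_sym[of V u h, OF sym] u1
    by (simp add: ip.diff_right ip.scaleR_right)
qed

section \<open>Stability and perturbation of fixed points\<close>

text \<open>Localised to \<open>N\<close> so that balls around fixed points can be treated
  separately. The normalisation of \<open>u\<close> survives limits, which u \<noteq> 0 would
  not.\<close>

definition degenerate_on :: "(('m \<times> 'm) \<Rightarrow>\<^sub>C real) \<Rightarrow> ('m \<Rightarrow>\<^sub>C real) set \<Rightarrow> bool" where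
  "degenerate_on V N \<longleftrightarrow> (\<exists>f\<in>N. \<exists>u. fixed_density V f \<and> kernel_vector V f u \<and> norm u = 1)"

text \<open>Logarithms make the normalisations additive constants, and by unit mass each
  perturbation contributes itself plus a constant; all constants are collected in \<kappa>.\<close>

lemma fixed_density_sum_kernel_difference:
  assumes f: "fixed_density (V + sum_kernel a) f" and f': "fixed_density (V + sum_kernel a') f'"
  obtains \<kappa> where "\<And>x. ln (f x) - ln (f' x) = \<kappa> - Kop V (f - f') x - (a - a') x"
proof -
  obtain c c' where "\<And>x. ln (f x) + Kop (V + sum_kernel a) f x = c" "\<And>x. ln (f' x) + Kop (V + sum_kernel a') f' x = c'"
    using fixed_density_log[OF f] fixed_density_log[OF f'] by metis
  then have "ln (f x) - ln (f' x) = (c - c' - ip a f + ip a' f') - Kop V (f - f') x - (a - a') x" for x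
    by (simp add: Kop_sum_kernel fixed_density_ip_one[OF f] fixed_density_ip_one[OF f'] Kop.diff_right algebra_simps)
  then show ?thesis by (rule that)
qed

text \<open>Near \<open>f0\<close> the fixed points of the potentials perturbed
  by \<open>\<Sum>z\<in>Z. t z *\<^sub>R slice V z\<close> are parametrised, in a Lipschitz way, by their coordinates
  \<open>Kop V f z\<close>, and a degenerate one confines \<open>t\<close> to a slab of quadratic thickness whose
  conormal is the kernel vector, because the linearisation is self-adjoint.\<close>

lemma local_perturbation:
  fixes V :: "('m \<times> 'm) \<Rightarrow>\<^sub>C real" and f0 :: "'m \<Rightarrow>\<^sub>C real"
  assumes sym: "\<And>x y. V (x, y) = V (y, x)"
    and f0: "\<And>x. f0 x > 0" "ip f0 one = 1"
  obtains r Z where "r > 0" "finite Z"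
    "\<And>g \<delta>. \<delta> > 0 \<Longrightarrow> \<exists>t. (\<forall>z\<in>Z. 0 \<le> t z \<and> t z < \<delta>) \<and>
       \<not> degenerate_on (V + sum_kernel (g + (\<Sum>z\<in>Z. t z *\<^sub>R slice V z))) (cball f0 r)"
proof -
  obtain Z v where Z: "separating V f0 Z" and v: "\<And>z. z \<in> Z \<Longrightarrow> linear_kernel V f0 (v z)"
    "\<And>z. z \<in> Z \<Longrightarrow> Kop V (v z) z = 1" "\<And>z z'. z \<in> Z \<Longrightarrow> z' \<in> Z \<Longrightarrow> z' \<noteq> z \<Longrightarrow> Kop V (v z) z' = 0"
    using ex_separating_dual[OF f0] by metis
  have fin: "finite Z" using Z by (simp add: separating_def)
  obtain C where C: "C > 0" "\<And>h \<kappa> e. ip h one = 0 \<Longrightarrow>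
      (\<And>x. h x / f0 x + Kop V h x = \<kappa> + apply_bcontfun e x) \<Longrightarrow>
      norm h \<le> C * (norm e + (\<Sum>z\<in>Z. \<bar>Kop V h z\<bar>))"
    using linearized_estimate[OF f0 Z] by metis
  obtain x0 where x0: "\<And>x. f0 x0 \<le> f0 x"
    using continuous_attains_inf[OF compact_M UNIV_not_empty continuous_on_apply_bcontfun, of f0] by auto
  \<comment> \<open>Half of the minimum of \<open>f0\<close>: densities within distance
    \<open>r \<le> m\<close> of \<open>f0\<close> keep the lower bound \<open>m\<close>.\<close>
  define m where "m = f0 x0 / 2"
  have m: "m > 0" "\<And>x. 2 * m \<le> f0 x" using f0(1) x0 by (auto simp: m_def)
  define A where "A = (\<Sum>z\<in>Z. norm (v z))"
  have A: "A \<ge> 0" "\<And>z. z \<in> Z \<Longrightarrow> norm (v z) \<le> A"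
    unfolding A_def using fin by (auto intro!: sum_nonneg member_le_sum)
  \<comment> \<open>The 1 accounts for the error of linearising the logarithm, the other summand for
    \<open>G t - G t'\<close>, whose coefficients are estimated by means of the dual vectors. The
    radius \<open>r\<close> then makes \<open>C * (L * r)\<close> at most 1/2, so that the total
    error can be absorbed.\<close>
  define L where "L = (1 + card Z * (A * norm V)) / m\<^sup>2"
  have L0: "0 \<le> card Z * (A * norm V)" using A by simp
  have L: "L > 0" "1 / m\<^sup>2 \<le> L" unfolding L_def using m(1) L0 by (auto intro!: divide_right_mono)
  define r where "r = min m (1 / (2 * C * L))"
  have r: "r > 0" "r \<le> m" "C * (L * r) \<le> 1 / 2"
  proof -
    show "r > 0" "r \<le> m" unfolding r_def using m(1) C(1) L(1) by auto
    have "C * (L * r) \<le> C * (L * (1 / (2 * C * L)))"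
      unfolding r_def using C(1) L(1) by (intro mult_left_mono) auto
    also have "\<dots> = 1 / 2" using C(1) L(1) by simp
    finally show "C * (L * r) \<le> 1 / 2" .
  qed
  have near: "m \<le> f x" "\<bar>f x - f0 x\<bar> \<le> r" if "dist f f0 \<le> r" for f :: "'m \<Rightarrow>\<^sub>C real" and x
  proof -
    show "\<bar>f x - f0 x\<bar> \<le> r" using dist_bounded[of f x f0] that by (simp add: dist_real_def)
    then show "m \<le> f x" using m(2)[of x] r(2) by (simp add: abs_le_iff)
  qed
  have "\<exists>t. (\<forall>z\<in>Z. 0 \<le> t z \<and> t z < \<delta>) \<and>
       \<not> degenerate_on (V + sum_kernel (g + (\<Sum>z\<in>Z. t z *\<^sub>R slice V z))) (cball f0 r)" if \<delta>: "\<delta> > 0" for g and \<delta> :: real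
  proof (rule ccontr)
    assume no: "\<not> ?thesis"
    define G where "G t = (\<Sum>z\<in>Z. t z *\<^sub>R slice V z)" for t
    define T where "T = {t. \<forall>z\<in>Z. 0 \<le> t z \<and> t z < \<delta>}"
    have "\<exists>f u. dist f f0 \<le> r \<and> fixed_density (V + sum_kernel (g + G t)) f \<and> kernel_vector (V + sum_kernel (g + G t)) f u \<and> norm u = 1"
      if "t \<in> T" for t
    proof -
      have "degenerate_on (V + sum_kernel (g + G t)) (cball f0 r)" using no that unfolding T_def G_def by blast
      then show ?thesis unfolding degenerate_on_def by (auto simp: dist_commute) blast
    qed
    \<comment> \<open>A bare choice of degenerate fixed points; all regularity in \<open>t\<close>
      comes from the estimates that follow.\<close>
    then obtain F U where F: "\<And>t. t \<in> T \<Longrightarrow> dist (F t) f0 \<le> r" "\<And>t. t \<in> T \<Longrightarrow> fixed_density (V + sum_kernel (g + G t)) (F t)"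
      and U: "\<And>t. t \<in> T \<Longrightarrow> kernel_vector (V + sum_kernel (g + G t)) (F t) (U t)" "\<And>t. t \<in> T \<Longrightarrow> norm (U t) = 1"
      by metis
    have Fpos: "F t x > 0" if "t \<in> T" for t x using fixed_density_pos[OF F(2)[OF that]] .
    have U': "linear_kernel V (F t) (U t)" if "t \<in> T" for t
      using kernel_vector_sum_kernel_linear_kernel[OF U(1)[OF that] Fpos[OF that]] .
    \<comment> \<open>\<open>q\<close> holds the coordinates of the fixed point, \<open>a\<close>
      the conormal of the slab: \<open>a t z\<close> is the pairing of \<open>U t\<close> with the
      slice at z, the direction in which the parameter at z acts.\<close>
    define q where "q t z = Kop V (F t) z" for t z
    define a where "a t z = Kop V (U t) z" for t z
    define S where "S t t' = (\<Sum>z\<in>Z. \<bar>q t z - q t' z\<bar>)" for t t'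
    have ipG: "ip u (G t - G t') = (\<Sum>z\<in>Z. Kop V u z * (t z - t' z))" for u t t'
      unfolding G_def sum_subtractf[symmetric] ip.sum_right
      by (intro sum.cong refl) (simp add: ip_slice ip.scaleR_right flip: scaleR_diff_left)
    \<comment> \<open>One expansion at a base function \<open>c\<close> with accuracy
      \<open>d\<close> serves twice: with \<open>c = f0\<close> and \<open>d = r\<close> for the
      Lipschitz bounds, with \<open>c = F t'\<close> and \<open>d\<close> the distance of the two
      densities for the slab.\<close>
    have pair: "\<bar>ip u (G t - G t')\<bar> \<le> norm u * (norm (F t - F t') * (d / m\<^sup>2))"
      "\<exists>\<kappa> e. (\<forall>x. (F t - F t') x / c x + Kop V (F t - F t') x = \<kappa> + apply_bcontfun e x) \<and>
        norm e \<le> norm (F t - F t') * (d / m\<^sup>2) + norm (G t - G t')"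
      if t: "t \<in> T" "t' \<in> T" and c: "\<And>x. m \<le> c x"
        and d: "\<And>x. \<bar>F t x - c x\<bar> \<le> d" "\<And>x. \<bar>F t' x - c x\<bar> \<le> d" and u: "linear_kernel V c u"
      for t t' d and c u :: "'m \<Rightarrow>\<^sub>C real"
    proof -
      define h where "h = F t - F t'"
      have c0: "c x > 0" for x using c[of x] m(1) by linarith
      have h1: "ip h one = 0"
        unfolding h_def ip.diff_left
        using fixed_density_ip_one[OF F(2)[OF t(1)]] fixed_density_ip_one[OF F(2)[OF t(2)]] by simp
      obtain \<kappa> where \<kappa>: "\<And>x. ln (F t x) - ln (F t' x) = \<kappa> - Kop V h x - (G t - G t') x"
        using fixed_density_sum_kernel_difference[OF F(2)[OF t(1)] F(2)[OF t(2)]] unfolding h_def by auto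
      \<comment> \<open>One function in two forms: here it is built from linear operators and the
        increment of G, while by the fixed point equations it is pointwise the remainder of the
        logarithm linearised at \<open>c\<close>.\<close>
      define E where "E = \<kappa> *\<^sub>R one - Kop V h - (G t - G t') - mult (recip c) h"
      have E: "E x = ln (F t x) - ln (F t' x) - h x / c x" for x
        unfolding E_def by (simp add: \<kappa> recip_apply[OF c0])
      have "d \<ge> 0" using d(1)[of undefined] by linarith
      have nE: "norm E \<le> norm h * (d / m\<^sup>2)"
        unfolding norm_bcontfun_le_iff
      proof
        fix x
        have "\<bar>E x\<bar> \<le> \<bar>h x\<bar> * (d / m\<^sup>2)"
          unfolding E h_def minus_bcontfun.rep_eq
          by (rule ln_diff_estimate[OF m(1) near(1)[OF F(1)[OF t(1)]] near(1)[OF F(1)[OF t(2)]] c d])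
        also have "\<dots> \<le> norm h * (d / m\<^sup>2)"
          using \<open>d \<ge> 0\<close> by (intro mult_right_mono abs_apply_le_norm) auto
        finally show "\<bar>E x\<bar> \<le> norm h * (d / m\<^sup>2)" .
      qed
      have "ip u E = - ip u (G t - G t')"
        unfolding E_def by (rule linearized_duality[OF sym c0 u h1])
      then have "\<bar>ip u (G t - G t')\<bar> \<le> norm u * norm E" using abs_ip_le[of u E] by simp
      also have "\<dots> \<le> norm u * (norm h * (d / m\<^sup>2))" using nE by (intro mult_left_mono) auto
      finally show "\<bar>ip u (G t - G t')\<bar> \<le> norm u * (norm (F t - F t') * (d / m\<^sup>2))" by (simp add: h_def)
      have "h x / c x + Kop V h x = \<kappa> + (- E - (G t - G t')) x" for x
        unfolding E_def by (simp add: recip_apply[OF c0])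
      moreover have "norm (- E - (G t - G t')) \<le> norm h * (d / m\<^sup>2) + norm (G t - G t')"
        using norm_triangle_ineq4[of "- E" "G t - G t'"] nE by simp
      ultimately show "\<exists>\<kappa> e. (\<forall>x. (F t - F t') x / c x + Kop V (F t - F t') x = \<kappa> + apply_bcontfun e x) \<and>
          norm e \<le> norm (F t - F t') * (d / m\<^sup>2) + norm (G t - G t')" unfolding h_def by blast
    qed
    have m0: "m \<le> f0 x" for x using m(1) m(2)[of x] by linarith
    have s: "\<bar>t z - t' z\<bar> \<le> A * (r / m\<^sup>2) * norm (F t - F t')" if t: "t \<in> T" "t' \<in> T" and z: "z \<in> Z" for t t' z
    proof -
      have "ip (v z) (G t - G t') = (\<Sum>z'\<in>{z}. Kop V (v z) z' * (t z' - t' z'))"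
        unfolding ipG using fin z v(3)[OF z] by (intro sum.mono_neutral_right) auto
      then have "\<bar>t z - t' z\<bar> = \<bar>ip (v z) (G t - G t')\<bar>" by (simp add: v(2)[OF z])
      also have "\<dots> \<le> norm (v z) * (norm (F t - F t') * (r / m\<^sup>2))"
        by (rule pair(1)[OF t m0 near(2)[OF F(1)[OF t(1)]] near(2)[OF F(1)[OF t(2)]] v(1)[OF z]])
      also have "\<dots> \<le> A * (norm (F t - F t') * (r / m\<^sup>2))"
        using A(2)[OF z] r(1) by (intro mult_right_mono) auto
      finally show ?thesis by (simp add: mult_ac)
    qed
    \<comment> \<open>By the choice of \<open>r\<close>, the error in the linear estimate is at most
      half of the left-hand side and is absorbed there; hence the factor
      \<open>2 * C\<close>.\<close>
    have h: "norm (F t - F t') \<le> 2 * C * S t t'" if t: "t \<in> T" "t' \<in> T" for t t'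
    proof -
      let ?h = "F t - F t'"
      \<comment> \<open>The zero vector is a formal witness for \<open>u\<close>: the second
        conclusion of \<open>pair\<close> concerns the increment alone.\<close>
      have v0: "linear_kernel V f0 0" by (simp add: linear_kernel_def Kop.zero_right ip.zero_left)
      obtain \<kappa> e where e: "\<And>x. ?h x / f0 x + Kop V ?h x = \<kappa> + apply_bcontfun e x"
        "norm e \<le> norm ?h * (r / m\<^sup>2) + norm (G t - G t')"
        using pair(2)[OF t m0 near(2)[OF F(1)[OF t(1)]] near(2)[OF F(1)[OF t(2)]] v0] by blast
      have h1: "ip ?h one = 0" unfolding ip.diff_left
        using fixed_density_ip_one[OF F(2)[OF t(1)]] fixed_density_ip_one[OF F(2)[OF t(2)]] by simp
      have "norm (G t - G t') \<le> (\<Sum>z\<in>Z. norm ((t z - t' z) *\<^sub>R slice V z))"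
        unfolding G_def sum_subtractf[symmetric] scaleR_diff_left[symmetric] by (rule norm_sum)
      also have "\<dots> \<le> of_nat (card Z) * (A * (r / m\<^sup>2) * norm ?h * norm V)"
      proof (rule sum_bounded_above)
        fix z assume z: "z \<in> Z"
        show "norm ((t z - t' z) *\<^sub>R slice V z) \<le> A * (r / m\<^sup>2) * norm ?h * norm V"
          unfolding norm_scaleR using s[OF t z] norm_slice_le[of V z] A(1) r(1)
          by (intro mult_mono) auto
      qed
      finally have "norm e \<le> L * r * norm ?h"
        using e(2) m(1) unfolding L_def by (simp add: field_simps)
      then have "C * (norm e + (\<Sum>z\<in>Z. \<bar>Kop V ?h z\<bar>)) \<le> C * (L * r * norm ?h + S t t')"
        using C(1) by (intro mult_left_mono add_mono) (auto simp: S_def q_def Kop.diff_right)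
      also have "\<dots> = C * (L * r) * norm ?h + C * S t t'" by (simp add: algebra_simps)
      also have "\<dots> \<le> 1 / 2 * norm ?h + C * S t t'" using r(3) by (intro add_right_mono mult_right_mono) auto
      finally show ?thesis using C(2)[OF h1 e(1)] by simp
    qed
    have S0: "S t t' \<ge> 0" for t t' unfolding S_def by (simp add: sum_nonneg)
    \<comment> \<open>If all values |a t z| stayed below \<open>c\<close>, their contribution would
      be less than 1/2. Replacing \<open>F t\<close> by \<open>f0\<close> costs at most another 1/2,
      which contradicts \<open>norm (U t) = 1\<close>. The added 1 gives strictness and a meaningful
      quotient for empty \<open>Z\<close>.\<close>
    define c where "c = 1 / (2 * C * (card Z + 1))"
    have big: "\<exists>z\<in>Z. c \<le> \<bar>a t z\<bar>" if t: "t \<in> T" for t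
    proof (rule ccontr)
      assume no: "\<not> (\<exists>z\<in>Z. c \<le> \<bar>a t z\<bar>)"
      obtain \<kappa> where \<kappa>: "\<And>x. U t x / F t x + Kop V (U t) x = \<kappa>" and u1: "ip (U t) one = 0"
        using U'[OF t] by (auto simp: linear_kernel_def)
      \<comment> \<open>The cost of replacing \<open>F t\<close> by \<open>f0\<close> in the kernel
        equation, so that the estimate at the fixed centre applies.\<close>
      define e where "e = mult (recip f0 - recip (F t)) (U t)"
      have "U t x / f0 x + Kop V (U t) x = \<kappa> + e x" for x
        using \<kappa>[of x] by (simp add: e_def recip_apply[OF f0(1)] recip_apply[OF Fpos[OF t]] algebra_simps)
      then have "norm (U t) \<le> C * (norm e + (\<Sum>z\<in>Z. \<bar>Kop V (U t) z\<bar>))" by (rule C(2)[OF u1])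
      moreover have "norm e \<le> L * r"
      proof -
        have "\<bar>1 / f0 x - 1 / F t x\<bar> \<le> r / m\<^sup>2" for x
        proof -
          have "1 / f0 x - 1 / F t x = (F t x - f0 x) / (f0 x * F t x)"
            using f0(1)[of x] Fpos[OF t, of x] by (simp add: field_simps)
          moreover have "m\<^sup>2 \<le> f0 x * F t x"
            unfolding power2_eq_square using m0 near(1)[OF F(1)[OF t]] m(1) f0(1)[of x] by (intro mult_mono) (auto simp: less_imp_le)
          ultimately show ?thesis
            using near(2)[OF F(1)[OF t], of x] f0(1)[of x] Fpos[OF t, of x] m(1) r(1)
            by (simp add: abs_mult frac_le)
        qed
        then have "norm (recip f0 - recip (F t)) \<le> r / m\<^sup>2"
          by (simp add: norm_bcontfun_le_iff recip_apply[OF f0(1)] recip_apply[OF Fpos[OF t]])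
        then have "norm e \<le> r / m\<^sup>2"
          unfolding e_def using norm_mult_le[of "recip f0 - recip (F t)" "U t"] U(2)[OF t] by simp
        also have "\<dots> \<le> L * r" using mult_right_mono[OF L(2), of r] r(1) by simp
        finally show ?thesis .
      qed
      moreover have "(\<Sum>z\<in>Z. \<bar>Kop V (U t) z\<bar>) \<le> of_nat (card Z) * c"
        using no by (intro sum_bounded_above) (force simp: a_def)
      moreover have "C * (of_nat (card Z) * c) < 1 / 2"
      proof -
        have "C * (of_nat (card Z) * c) = 1 / 2 * (real (card Z) / (real (card Z) + 1))"
          unfolding c_def using C(1) by simp
        also have "\<dots> < 1 / 2 * 1" by (intro mult_strict_left_mono) (simp_all add: divide_less_eq)
        finally show ?thesis by simp
      qed
      ultimately have "1 \<le> C * (norm e + (\<Sum>z\<in>Z. \<bar>Kop V (U t) z\<bar>))"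
        "C * norm e \<le> C * (L * r)" "C * (\<Sum>z\<in>Z. \<bar>Kop V (U t) z\<bar>) \<le> C * (of_nat (card Z) * c)"
        "C * (of_nat (card Z) * c) < 1 / 2"
        using C(1) U(2)[OF t] by (simp_all add: mult_left_mono)
      then show False using r(3) by (simp add: distrib_left)
    qed
    define C2 where "C2 = max (A * (r / m\<^sup>2) * (2 * C)) ((2 * C)\<^sup>2 / m\<^sup>2)"
    show False
    proof (rule critical_parameters_counting[OF fin \<delta> _ T_def, of c q "norm V * (norm f0 + r)" a C2])
      show "c > 0" unfolding c_def using C(1) by simp
      show "\<exists>z\<in>Z. c \<le> \<bar>a t z\<bar>" if "t \<in> T" for t by (rule big[OF that])
      show "\<bar>q t z\<bar> \<le> norm V * (norm f0 + r)" if "t \<in> T" "z \<in> Z" for t z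
      proof -
        have "norm (F t) \<le> norm f0 + r"
          using F(1)[OF that(1)] norm_triangle_sub[of "F t" f0] by (simp add: dist_norm)
        then have "norm V * norm (F t) \<le> norm V * (norm f0 + r)" by (intro mult_left_mono) auto
        then show ?thesis
          unfolding q_def using abs_apply_le_norm[of "Kop V (F t)" z] norm_Kop[of V "F t"] by linarith
      qed
      show "\<bar>t z - t' z\<bar> \<le> C2 * (\<Sum>j\<in>Z. \<bar>q t j - q t' j\<bar>)" if t: "t \<in> T" "t' \<in> T" and z: "z \<in> Z" for t t' z
      proof -
        have "A * (r / m\<^sup>2) * norm (F t - F t') \<le> A * (r / m\<^sup>2) * (2 * C * S t t')"
          using h[OF t] A(1) r(1) by (intro mult_left_mono) auto
        also have "\<dots> = A * (r / m\<^sup>2) * (2 * C) * S t t'" by simp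
        also have "\<dots> \<le> C2 * S t t'" using S0 by (intro mult_right_mono) (auto simp: C2_def)
        finally show ?thesis using s[OF t z] by (simp add: S_def)
      qed
      show "\<bar>\<Sum>i\<in>Z. a t' i * (t i - t' i)\<bar> \<le> C2 * (\<Sum>j\<in>Z. \<bar>q t j - q t' j\<bar>)\<^sup>2" if t: "t \<in> T" "t' \<in> T" for t t'
      proof -
        have "\<bar>\<Sum>i\<in>Z. a t' i * (t i - t' i)\<bar> = \<bar>ip (U t') (G t - G t')\<bar>" unfolding ipG a_def ..
        \<comment> \<open>The kernel vector belongs to \<open>F t'\<close>, so the expansion is
          based there: one deviation is 0 and the other is the increment itself, which produces the
          square.\<close>
        also have "\<dots> \<le> norm (U t') * (norm (F t - F t') * (norm (F t - F t') / m\<^sup>2))"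
          using abs_apply_le_norm[of "F t - F t'"]
          by (intro pair(1)[OF t near(1)[OF F(1)[OF t(2)]] _ _ U'[OF t(2)]]) auto
        also have "\<dots> = (norm (F t - F t'))\<^sup>2 / m\<^sup>2" by (simp add: U(2)[OF t(2)] power2_eq_square)
        also have "\<dots> \<le> (2 * C * S t t')\<^sup>2 / m\<^sup>2"
          using h[OF t] by (intro divide_right_mono power_mono) auto
        also have "\<dots> = (2 * C)\<^sup>2 / m\<^sup>2 * (S t t')\<^sup>2" by (simp add: power_mult_distrib)
        also have "\<dots> \<le> C2 * (S t t')\<^sup>2" by (intro mult_right_mono) (auto simp: C2_def)
        finally show ?thesis by (simp add: S_def)
      qed
    qed
  qed
  then show ?thesis using that r(1) fin by blast
qed

section \<open>Stability under uniform convergence of kernels\<close>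

lemma kernel_vector_scaleR:
  assumes "kernel_vector V f u" shows "kernel_vector V f (c *\<^sub>R u)"
proof -
  have "c *\<^sub>R u + mult f (Kop V (c *\<^sub>R u)) - ip f (Kop V (c *\<^sub>R u)) *\<^sub>R f =
      c *\<^sub>R (u + mult f (Kop V u) - ip f (Kop V u) *\<^sub>R f)"
    by (simp add: Kop.scaleR_right mult.scaleR_right ip.scaleR_right scaleR_right_distrib scaleR_right_diff_distrib)
  then show ?thesis using assms by (simp add: kernel_vector_def ip.scaleR_left)
qed

lemma degenerate_on_iff: "degenerate_on V N \<longleftrightarrow> (\<exists>f\<in>N. \<exists>u. fixed_density V f \<and> kernel_vector V f u \<and> u \<noteq> 0)"
proof
  assume "\<exists>f\<in>N. \<exists>u. fixed_density V f \<and> kernel_vector V f u \<and> u \<noteq> 0"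
  then obtain f u where "f \<in> N" "fixed_density V f" "kernel_vector V f u" "u \<noteq> 0" by blast
  moreover from this have "kernel_vector V f (inverse (norm u) *\<^sub>R u)" "norm (inverse (norm u) *\<^sub>R u) = 1"
    by (auto intro: kernel_vector_scaleR)
  ultimately show "degenerate_on V N" unfolding degenerate_on_def by blast
next
  assume "degenerate_on V N"
  then obtain f u where "f \<in> N" "fixed_density V f" "kernel_vector V f u" "norm u = 1" unfolding degenerate_on_def by blast
  moreover from this have "u \<noteq> 0" by auto
  ultimately show "\<exists>f\<in>N. \<exists>u. fixed_density V f \<and> kernel_vector V f u \<and> u \<noteq> 0" by blast
qed

lemma tendsto_of_dist_inverse:
  fixes W :: "nat \<Rightarrow> 'a::metric_space"
  assumes "\<And>n. dist (W n) V < inverse (real (Suc n))"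
  shows "W \<longlonglongrightarrow> V"
proof (rule tendsto_dist_iff[THEN iffD2], rule Lim_null_comparison[OF _ LIMSEQ_inverse_real_of_nat])
  show "\<forall>\<^sub>F n in sequentially. norm (dist (W n) V) \<le> inverse (real (Suc n))"
    using assms by (intro always_eventually allI) (simp add: less_imp_le)
qed

text \<open>Degenerate fixed points in N of kernels tending to V would subconverge, together with
  their normalised kernel vectors, to a degenerate fixed point of V; closedness keeps the limit in
  N.\<close>

lemma open_nondegenerate:
  assumes "closed N" shows "open {V. \<not> degenerate_on V N}"
  unfolding open_dist
proof (rule ballI, rule ccontr)
  fix V assume V: "V \<in> {V. \<not> degenerate_on V N}"
    and no: "\<not> (\<exists>e>0. \<forall>W. dist W V < e \<longrightarrow> W \<in> {V. \<not> degenerate_on V N})"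
  then have "\<forall>e>0. \<exists>W. dist W V < e \<and> degenerate_on W N" by blast
  then have "\<exists>W. dist W V < inverse (real (Suc n)) \<and> degenerate_on W N" for n by simp
  then obtain W f u where W: "\<And>n. dist (W n) V < inverse (real (Suc n))"
    and f: "\<And>n. f n \<in> N" "\<And>n. fixed_density (W n) (f n)" and u: "\<And>n. kernel_vector (W n) (f n) (u n)" "\<And>n. norm (u n) = 1"
    unfolding degenerate_on_def by metis
  have lim: "W \<longlonglongrightarrow> V" by (rule tendsto_of_dist_inverse[OF W])
  obtain r g where r: "strict_mono r" "(\<lambda>n. f (r n)) \<longlonglongrightarrow> g" "fixed_density V g"
    using fixed_density_subsequence[OF lim f(2)] .
  have "(\<lambda>n. W (r n)) \<longlonglongrightarrow> V" using LIMSEQ_subseq_LIMSEQ[OF lim r(1)] by (simp add: comp_def)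
  from kernel_vector_subsequence[OF this r(2) u(1) u(2)]
  obtain w where w: "kernel_vector V g w" "norm w = 1" by blast
  have "g \<in> N" using closed_sequentially[OF assms _ r(2)] f(1) by blast
  then show False using V r(3) w unfolding degenerate_on_def by blast
qed

text \<open>Upper semicontinuity of the set of fixed points. It prevents small perturbations from
  creating fixed points outside the balls under control.\<close>

lemma open_fixed_points_subset:
  assumes "open O'" shows "open {V. \<forall>f. fixed_density V f \<longrightarrow> f \<in> O'}"
  unfolding open_dist
proof (rule ballI, rule ccontr)
  fix V assume V: "V \<in> {V. \<forall>f. fixed_density V f \<longrightarrow> f \<in> O'}"
    and no: "\<not> (\<exists>e>0. \<forall>W. dist W V < e \<longrightarrow> W \<in> {V. \<forall>f. fixed_density V f \<longrightarrow> f \<in> O'})"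
  then have "\<forall>e>0. \<exists>W f. dist W V < e \<and> fixed_density W f \<and> f \<in> - O'" by blast
  then have "\<exists>W f. dist W V < inverse (real (Suc n)) \<and> fixed_density W f \<and> f \<in> - O'" for n
    by (elim allE impE) auto
  then obtain W f where W: "\<And>n. dist (W n) V < inverse (real (Suc n))"
    and f: "\<And>n. f n \<in> - O'" "\<And>n. fixed_density (W n) (f n)" by metis
  obtain r g where r: "strict_mono r" "(\<lambda>n. f (r n)) \<longlonglongrightarrow> g" "fixed_density V g"
    using fixed_density_subsequence[OF tendsto_of_dist_inverse[OF W] f(2)] .
  have "g \<in> - O'" using closed_sequentially[OF _ _ r(2), of "- O'"] f(1) assms by auto
  then show False using V r(3) by blast
qed

lemma compact_fixed_points: "compact {f. fixed_density V f}"
  unfolding compact_eq_seq_compact_metric seq_compact_def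
proof (intro allI impI)
  fix f :: "nat \<Rightarrow> 'm \<Rightarrow>\<^sub>C real" assume "\<forall>n. f n \<in> {f. fixed_density V f}"
  then have "\<And>n. fixed_density V (f n)" by simp
  then obtain r g where "strict_mono (r :: nat \<Rightarrow> nat)" "(\<lambda>n. f (r n)) \<longlonglongrightarrow> g" "fixed_density V g"
    by (rule fixed_density_subsequence[OF tendsto_const])
  then show "\<exists>l\<in>{f. fixed_density V f}. \<exists>r. strict_mono r \<and> (f \<circ> r) \<longlonglongrightarrow> l"
    by (auto simp: comp_def)
qed

text \<open>\<open>Op\<close> abstracts the open sets of the C^k topology, pulled back to continuous
  kernels. \<open>Op_Int\<close> says that it refines the uniform topology, \<open>Op_add\<close>
  that small combinations of slices of the fixed V are admissible increments at any W.\<close>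

lemma nondegenerate_perturbation:
  fixes V :: "('m \<times> 'm) \<Rightarrow>\<^sub>C real" and Op :: "(('m \<times> 'm) \<Rightarrow>\<^sub>C real) set \<Rightarrow> bool"
  assumes sym: "\<And>x y. V (x, y) = V (y, x)"
    and Op_Int: "\<And>U S. Op U \<Longrightarrow> open S \<Longrightarrow> Op (U \<inter> S)"
    and Op_add: "\<And>U W Z. Op U \<Longrightarrow> W \<in> U \<Longrightarrow> finite Z \<Longrightarrow> \<exists>\<delta>>0. \<forall>t. (\<forall>z\<in>Z. 0 \<le> t z \<and> t z < \<delta>) \<longrightarrow>
        W + sum_kernel (\<Sum>z\<in>Z. t z *\<^sub>R slice V z) \<in> U"
    and U: "Op U" "V \<in> U"
  shows "\<exists>W\<in>U. \<not> degenerate_on W UNIV"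
proof -
  define F where "F = {f. fixed_density V f}"
  define Q where "Q f r Z \<longleftrightarrow> (\<forall>g \<delta>. \<delta> > 0 \<longrightarrow> (\<exists>t. (\<forall>z\<in>Z. 0 \<le> t z \<and> t z < \<delta>) \<and>
       \<not> degenerate_on (V + sum_kernel (g + (\<Sum>z\<in>Z. t z *\<^sub>R slice V z))) (cball f r)))"
    for f and r :: real and Z
  have "\<exists>r Z. r > 0 \<and> finite Z \<and> Q f r Z" if "f \<in> F" for f
  proof -
    have f: "fixed_density V f" using that by (simp add: F_def)
    show ?thesis
    proof (rule local_perturbation[OF sym fixed_density_pos[OF f] fixed_density_ip_one[OF f]])
      fix r :: real and Z
      assume "r > 0" "finite Z" "\<And>g \<delta>. \<delta> > 0 \<Longrightarrow> \<exists>t. (\<forall>z\<in>Z. 0 \<le> t z \<and> t z < \<delta>) \<and>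
         \<not> degenerate_on (V + sum_kernel (g + (\<Sum>z\<in>Z. t z *\<^sub>R slice V z))) (cball f r)"
      then show "\<exists>r Z. r > 0 \<and> finite Z \<and> Q f r Z" unfolding Q_def by blast
    qed
  qed
  then obtain r Z where rZ: "\<And>f. f \<in> F \<Longrightarrow> r f > (0::real)" "\<And>f. f \<in> F \<Longrightarrow> finite (Z f)"
    "\<And>f. f \<in> F \<Longrightarrow> Q f (r f) (Z f)"
    by metis
  obtain L where L: "L \<subseteq> F" "finite L" "F \<subseteq> (\<Union>f\<in>L. ball f (r f))"
    by (rule compactE_image[of F F "\<lambda>f. ball f (r f)"]) (use rZ(1) compact_fixed_points in \<open>auto simp: F_def\<close>)
  define O' where "O' = (\<Union>f\<in>L. ball f (r f))"
  \<comment> \<open>Confines all later fixed points to the union of the balls, so that nondegeneracy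
    on each ball becomes nondegeneracy everywhere.\<close>
  define U0 where "U0 = U \<inter> {W. \<forall>f. fixed_density W f \<longrightarrow> f \<in> O'}"
  have "Op U0" unfolding U0_def O'_def by (intro Op_Int U(1) open_fixed_points_subset open_UN) auto
  moreover have "V + sum_kernel 0 \<in> U0"
  proof -
    have "sum_kernel 0 = 0" by (rule bcontfun_eqI) (simp add: sum_kernel_apply)
    moreover have "f \<in> O'" if "fixed_density V f" for f using L(3) that unfolding F_def O'_def by blast
    ultimately show ?thesis using U(2) by (auto simp: U0_def)
  qed
  \<comment> \<open>Induction over the balls: the increments accumulate in \<open>g\<close>, which
    the local result permits because its radius and its points do not depend on
    \<open>g\<close>.\<close>
  moreover have "\<exists>g. V + sum_kernel g \<in> U' \<and> (\<forall>f\<in>L. \<not> degenerate_on (V + sum_kernel g) (cball f (r f)))"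
    if "Op U'" "V + sum_kernel g0 \<in> U'" for U' g0
    using L(2,1) that
  proof (induction L arbitrary: U' g0 rule: finite_induct)
    case (insert f L)
    then obtain g1 where g1: "V + sum_kernel g1 \<in> U'" "\<forall>f\<in>L. \<not> degenerate_on (V + sum_kernel g1) (cball f (r f))" by blast
    \<comment> \<open>Shrinks the open set so that the balls already treated stay nondegenerate
      under the next increment.\<close>
    define U'' where "U'' = U' \<inter> (\<Inter>f\<in>L. {W. \<not> degenerate_on W (cball f (r f))})"
    have "Op U''" unfolding U''_def
      using insert.hyps(1) by (intro Op_Int insert.prems open_INT ballI open_nondegenerate) auto
    moreover have "V + sum_kernel g1 \<in> U''" using g1 by (simp add: U''_def)
    moreover have f: "f \<in> F" using insert.prems by blast
    ultimately obtain \<delta> where \<delta>: "\<delta> > 0" "\<And>t. (\<forall>z\<in>Z f. 0 \<le> t z \<and> t z < \<delta>) \<Longrightarrow>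
        V + sum_kernel g1 + sum_kernel (\<Sum>z\<in>Z f. t z *\<^sub>R slice V z) \<in> U''" using Op_add rZ(2) by meson
    obtain t where "\<forall>z\<in>Z f. 0 \<le> t z \<and> t z < \<delta>"
      "\<not> degenerate_on (V + sum_kernel (g1 + (\<Sum>z\<in>Z f. t z *\<^sub>R slice V z))) (cball f (r f))"
      using rZ(3)[OF f] \<delta>(1) unfolding Q_def by blast
    then show ?case using \<delta>(2)[of t]
      by (intro exI[of _ "g1 + (\<Sum>z\<in>Z f. t z *\<^sub>R slice V z)"]) (simp add: U''_def sum_kernel_add add.assoc)
  qed blast
  ultimately obtain g where g: "V + sum_kernel g \<in> U0" "\<forall>f\<in>L. \<not> degenerate_on (V + sum_kernel g) (cball f (r f))" by blast
  have "\<not> degenerate_on (V + sum_kernel g) UNIV"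
  proof
    assume "degenerate_on (V + sum_kernel g) UNIV"
    then obtain f u where fu: "fixed_density (V + sum_kernel g) f" "kernel_vector (V + sum_kernel g) f u" "norm u = 1" unfolding degenerate_on_def by blast
    then obtain f' where "f' \<in> L" "f \<in> ball f' (r f')" using g(1) by (auto simp: U0_def O'_def)
    then show False using g(2) fu unfolding degenerate_on_def by fastforce
  qed
  then show ?thesis using g(1) by (auto simp: U0_def)
qed

section \<open>From densities to measures\<close>

lemma B0_iff: "apply_bcontfun u \<in> B0 lam \<longleftrightarrow> ip u one = 0"
  by (simp add: B0_def ip_def inner_lam_def)

lemma T_op_apply:
  fixes f u :: "'m \<Rightarrow>\<^sub>C real" and V :: "('m \<times> 'm) \<Rightarrow>\<^sub>C real"
  shows "T_op lam f (V_fun lam V u) x = (mult f (Kop V u) - ip f (Kop V u) *\<^sub>R f) x"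
  by (simp add: T_op_def Kop_V_fun[symmetric] ip_def)

lemma kernel_vector_iff:
  "kernel_vector V f u \<longleftrightarrow> apply_bcontfun u \<in> B0 lam \<and>
     (\<forall>x. u x + T_op lam f (V_fun lam V u) x = 0)"
proof -
  have "u + mult f (Kop V u) - ip f (Kop V u) *\<^sub>R f = 0 \<longleftrightarrow>
      (\<forall>x. (u + mult f (Kop V u) - ip f (Kop V u) *\<^sub>R f) x = 0)"
    by (metis bcontfun_eqI zero_bcontfun.rep_eq)
  then show ?thesis unfolding kernel_vector_def B0_iff T_op_apply by (simp add: add_diff_eq)
qed

text \<open>By the form of \<open>Pi_map\<close> a fixed point has the Gibbs density of V \<mu>;
  integrating against this density gives V \<mu> = V f, hence an equation for f alone.\<close>

lemma fixed_point_density: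
  fixes V :: "('m \<times> 'm) \<Rightarrow>\<^sub>C real"
  assumes \<mu>: "\<mu> \<in> Borel_probs" "Pi_map lam V \<mu> = \<mu>"
  obtains f where "fixed_density V f" "\<mu> = density lam (\<lambda>x. ennreal (apply_bcontfun f x))"
proof -
  have "compact_prob \<mu>"
    using \<mu>(1) compact_M unfolding compact_prob_def by (simp add: Borel_probs_def)
  then interpret \<mu>: compact_prob \<mu> .
  \<comment> \<open>V \<mu> is the kernel operator with reference measure \<mu> applied to 1, so its
    continuity comes from the locale for \<mu>.\<close>
  have "V_meas V \<mu> = V_fun \<mu> V \<mu>.one" by (rule ext) (simp add: V_meas_def V_fun_def)
  then have phi: "V_meas V \<mu> = \<mu>.Kop V \<mu>.one" by (simp add: \<mu>.Kop_V_fun)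
  define f where "f = gibbs (\<mu>.Kop V \<mu>.one)"
  have f: "apply_bcontfun f = xi lam (V_meas V \<mu>)" unfolding f_def phi by (rule gibbs_apply)
  have dens: "\<mu> = density lam (\<lambda>x. ennreal (f x))" using \<mu>(2) by (simp add: f Pi_map_def)
  have fpos: "f x > 0" for x
    using ip_exp_neg_pos by (simp add: f_def gibbs_def)
  have "\<mu>.Kop V \<mu>.one = Kop V f"
  proof (rule bcontfun_eqI)
    fix x
    have "\<mu>.Kop V \<mu>.one x = (\<integral>y. V (x, y) \<partial>\<mu>)"
      by (simp add: phi[symmetric] V_meas_def)
    also have "\<dots> = (\<integral>y. V (x, y) \<partial>density lam (\<lambda>x. ennreal (f x)))"
      by (simp only: dens[symmetric])
    also have "\<dots> = (\<integral>y. f y *\<^sub>R V (x, y) \<partial>lam)"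
    proof (rule integral_density)
      show "(\<lambda>y. V (x, y)) \<in> borel_measurable lam" "apply_bcontfun f \<in> borel_measurable lam"
        unfolding measurable_cong_sets[OF sets_lam refl]
        by (intro borel_measurable_continuous_onI continuous_slice continuous_on_apply_bcontfun)+
    qed (use fpos in \<open>auto simp: less_imp_le\<close>)
    finally show "\<mu>.Kop V \<mu>.one x = Kop V f x" by (simp add: Kop_apply mult.commute)
  qed
  then have "fixed_density V f" unfolding fixed_density_def using f_def by simp
  then show ?thesis using dens by (rule that)
qed

lemma fixed_density_is_fixed_point:
  assumes "fixed_density V f"
  shows "density lam (\<lambda>x. ennreal (apply_bcontfun f x)) \<in> Borel_probs"
    "Pi_map lam V (density lam (\<lambda>x. ennreal (apply_bcontfun f x))) = density lam (\<lambda>x. ennreal (apply_bcontfun f x))"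
proof -
  have m: "apply_bcontfun g \<in> borel_measurable lam" for g
    unfolding measurable_cong_sets[OF sets_lam refl]
    by (intro borel_measurable_continuous_onI continuous_on_apply_bcontfun)
  have fpos: "f x \<ge> 0" for x using fixed_density_pos[OF assms, of x] by simp
  have "emeasure (density lam (\<lambda>x. ennreal (f x))) UNIV = (\<integral>\<^sup>+x. ennreal (f x) \<partial>lam)"
    using m[of f] by (subst emeasure_density) (auto simp: space_lam[symmetric])
  also have "\<dots> = ennreal (\<integral>x. f x \<partial>lam)"
    by (rule nn_integral_eq_integral) (auto intro: integrable_continuous fpos)
  also have "\<dots> = 1" using fixed_density_ip_one[OF assms] by (simp add: ip_one)
  finally show "density lam (\<lambda>x. ennreal (f x)) \<in> Borel_probs"
    unfolding Borel_probs_def by (auto intro!: prob_spaceI simp: sets_lam space_lam)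
  have "V_meas V (density lam (\<lambda>x. ennreal (f x))) = Kop V f"
  proof
    fix x
    have "V_meas V (density lam (\<lambda>x. ennreal (f x))) x = (\<integral>y. f y *\<^sub>R V (x, y) \<partial>lam)"
      unfolding V_meas_def
    proof (rule integral_density)
      show "(\<lambda>y. V (x, y)) \<in> borel_measurable lam"
        unfolding measurable_cong_sets[OF sets_lam refl]
        by (intro borel_measurable_continuous_onI continuous_slice)
    qed (use fpos m in auto)
    then show "V_meas V (density lam (\<lambda>x. ennreal (f x))) x = Kop V f x" by (simp add: Kop_apply mult.commute)
  qed
  moreover have "xi lam (Kop V f) = f" using assms by (metis fixed_density_def gibbs_apply)
  ultimately show "Pi_map lam V (density lam (\<lambda>x. ennreal (f x))) = density lam (\<lambda>x. ennreal (f x))"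
    by (simp add: Pi_map_def)
qed

text \<open>The set where the two functions differ is open and null, hence empty by full support. As
  \<open>nondegenerate\<close> asserts the existence of some density, identifying it with a given
  one rests on this.\<close>

lemma density_continuous_unique:
  assumes supp: "\<And>U. open U \<Longrightarrow> U \<noteq> {} \<Longrightarrow> emeasure lam U \<noteq> 0"
    and f: "continuous_on UNIV f" "\<And>x. f x > 0" and g: "continuous_on UNIV g" "\<And>x. g x > 0"
    and eq: "density lam (\<lambda>x. ennreal (f x)) = density lam (\<lambda>x. ennreal (g x))"
  shows "f = g"
proof -
  interpret prob_space lam by (rule prob_lam)
  have m: "f \<in> borel_measurable lam" "g \<in> borel_measurable lam"
    unfolding measurable_cong_sets[OF sets_lam refl]
    using f(1) g(1) by (auto intro: borel_measurable_continuous_onI)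
  have "AE x in lam. ennreal (f x) = ennreal (g x)"
    using eq m by (subst (asm) density_unique_iff) auto
  then have "AE x in lam. f x = g x" using f(2) g(2) by (auto simp: less_imp_le)
  moreover have op: "open {x. f x \<noteq> g x}" by (rule open_Collect_neq[OF f(1) g(1)])
  ultimately have "emeasure lam {x. f x \<noteq> g x} = 0"
    by (subst (asm) AE_iff_measurable[where N = "{x. f x \<noteq> g x}"]) (auto simp: sets_lam space_lam)
  then have "{x. f x \<noteq> g x} = {}" using supp[OF op] by blast
  then show ?thesis by blast
qed

lemma all_nondegenerate_iff:
  fixes V :: "('m \<times> 'm) \<Rightarrow>\<^sub>C real"
  assumes supp: "\<And>U. open U \<Longrightarrow> U \<noteq> {} \<Longrightarrow> emeasure lam U \<noteq> 0"
  shows "(\<forall>\<mu>\<in>Borel_probs. Pi_map lam V \<mu> = \<mu> \<longrightarrow> nondegenerate lam V \<mu>) \<longleftrightarrow> \<not> degenerate_on V UNIV"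
proof
  assume nd: "\<forall>\<mu>\<in>Borel_probs. Pi_map lam V \<mu> = \<mu> \<longrightarrow> nondegenerate lam V \<mu>"
  show "\<not> degenerate_on V UNIV"
  proof
    assume "degenerate_on V UNIV"
    then obtain f u where fu: "fixed_density V f" "kernel_vector V f u" "norm u = 1" unfolding degenerate_on_def by blast
    have "nondegenerate lam V (density lam (\<lambda>x. ennreal (f x)))"
      using nd fixed_density_is_fixed_point[OF fu(1)] by blast
    then obtain g where g: "continuous_on UNIV g" "\<And>x. g x > 0"
      "density lam (\<lambda>x. ennreal (f x)) = density lam (\<lambda>x. ennreal (g x))"
      "\<And>u. u\<in>B0 lam \<Longrightarrow> (\<forall>x. u x + T_op lam g (V_fun lam V u) x = 0) \<Longrightarrow> (\<forall>x. u x = 0)"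
      unfolding nondegenerate_def by blast
    have "apply_bcontfun f = g"
      by (rule density_continuous_unique[OF supp _ fixed_density_pos[OF fu(1)] g(1-3)]) auto
    then have "\<forall>x. u x = 0" using g(4)[of u] fu(2) by (simp add: kernel_vector_iff)
    then have "u = 0" by (intro bcontfun_eqI) simp
    then show False using fu(3) by simp
  qed
next
  assume nd: "\<not> degenerate_on V UNIV"
  show "\<forall>\<mu>\<in>Borel_probs. Pi_map lam V \<mu> = \<mu> \<longrightarrow> nondegenerate lam V \<mu>"
  proof (intro ballI impI)
    fix \<mu> :: "'m measure" assume \<mu>: "\<mu> \<in> Borel_probs" "Pi_map lam V \<mu> = \<mu>"
    obtain f where f: "fixed_density V f" "\<mu> = density lam (\<lambda>x. ennreal (apply_bcontfun f x))"
      using fixed_point_density[OF \<mu>] .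
    have "\<forall>x. u x = 0" if u: "u \<in> B0 lam" "\<forall>x. u x + T_op lam f (V_fun lam V u) x = 0" for u
    proof -
      have "continuous_on UNIV u" using u(1) by (simp add: B0_def)
      then have ub: "apply_bcontfun (Bcontfun u) = u" by (rule apply_Bcontfun_compact[OF compact_M])
      then have "kernel_vector V f (Bcontfun u)" using u by (simp add: kernel_vector_iff)
      then have "Bcontfun u = 0" using nd f(1) unfolding degenerate_on_iff by blast
      then show ?thesis using ub by (metis zero_bcontfun.rep_eq)
    qed
    then show "nondegenerate lam V \<mu>"
      unfolding nondegenerate_def using f(2) fixed_density_pos[OF f(1)]
      by (intro exI[of _ "apply_bcontfun f"]) auto
  qed
qed

end

section \<open>The topology of \<open>C\<^sup>k\<close> convergence\<close>

lemma has_derivative_cong_open: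
  assumes "open S" "x \<in> S" "\<And>y. y \<in> S \<Longrightarrow> f y = g y"
  shows "(f has_derivative D) (at x) \<longleftrightarrow> (g has_derivative D) (at x)"
  using assms has_derivative_transform_within_open[of f D x UNIV S g]
    has_derivative_transform_within_open[of g D x UNIV S f] by auto

lemma frechet_derivative_cong_open:
  assumes "open S" "x \<in> S" "\<And>y. y \<in> S \<Longrightarrow> f y = g y"
  shows "frechet_derivative f (at x) = frechet_derivative g (at x)"
  by (simp only: frechet_derivative_def has_derivative_cong_open[OF assms])

text \<open>Identities between derivatives are available on S only; openness makes them propagate
  through the recursion of \<open>Ck_on\<close>.\<close>

lemma Ck_on_cong:
  assumes S: "open S"
  shows "(\<And>y. y \<in> S \<Longrightarrow> f y = g y) \<Longrightarrow> Ck_on k f S \<longleftrightarrow> Ck_on k g S"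
proof (induction k arbitrary: f g)
  case 0
  then show ?case using continuous_on_cong[of S S f g] by simp
next
  case (Suc k)
  have "f differentiable (at x) \<longleftrightarrow> g differentiable (at x)" if "x \<in> S" for x
    by (simp only: differentiable_def has_derivative_cong_open[OF S that Suc.prems])
  moreover have "Ck_on k (\<lambda>x. frechet_derivative f (at x) b) S \<longleftrightarrow> Ck_on k (\<lambda>x. frechet_derivative g (at x) b) S" for b
    by (intro Suc.IH) (simp add: frechet_derivative_cong_open[OF S _ Suc.prems])
  ultimately show ?case by simp
qed

lemma Ck_on_continuous: "Ck_on k f S \<Longrightarrow> continuous_on S f"
  by (cases k) (auto intro!: continuous_at_imp_continuous_on differentiable_imp_continuous_within)

lemma Ck_on_const: "Ck_on k (\<lambda>_. c) S"
  by (induction k arbitrary: c) (auto simp: frechet_derivative_const)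

lemma frechet_derivative_lincomb:
  assumes "f differentiable (at x)" "g differentiable (at x)"
  shows "frechet_derivative (\<lambda>x. f x + c *\<^sub>R g x) (at x) b =
    frechet_derivative f (at x) b + c *\<^sub>R frechet_derivative g (at x) b"
proof -
  have "((\<lambda>x. f x + c *\<^sub>R g x) has_derivative
      (\<lambda>b. frechet_derivative f (at x) b + c *\<^sub>R frechet_derivative g (at x) b)) (at x)"
    using assms by (intro derivative_intros frechet_derivative_works[THEN iffD1])
  from frechet_derivative_at[OF this] show ?thesis by metis
qed

lemma Ck_on_lincomb:
  assumes S: "open S"
  shows "Ck_on k f S \<Longrightarrow> Ck_on k g S \<Longrightarrow> Ck_on k (\<lambda>x. f x + c *\<^sub>R g x) S"
proof (induction k arbitrary: f g)
  case 0
  then show ?case by (auto intro!: continuous_intros)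
next
  case (Suc k)
  have "Ck_on k (\<lambda>x. frechet_derivative (\<lambda>x. f x + c *\<^sub>R g x) (at x) b) S" if "b \<in> Basis" for b
  proof -
    have "Ck_on k (\<lambda>x. frechet_derivative f (at x) b + c *\<^sub>R frechet_derivative g (at x) b) S"
      using Suc that by simp
    then show ?thesis
      using Suc.prems Ck_on_cong[OF S, of "\<lambda>x. frechet_derivative (\<lambda>x. f x + c *\<^sub>R g x) (at x) b"
        "\<lambda>x. frechet_derivative f (at x) b + c *\<^sub>R frechet_derivative g (at x) b" k]
      by (simp add: frechet_derivative_lincomb)
  qed
  then show ?case using Suc.prems by (auto intro!: derivative_intros)
qed

lemma iter_pderiv_cong:
  assumes S: "open S"
  shows "(\<And>y. y \<in> S \<Longrightarrow> f y = g y) \<Longrightarrow> x \<in> S \<Longrightarrow> iter_pderiv bs f x = iter_pderiv bs g x"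
proof (induction bs arbitrary: f g)
  case (Cons b bs)
  show ?case
    unfolding iter_pderiv.simps
  proof (rule Cons.IH)
    show "frechet_derivative f (at y) b = frechet_derivative g (at y) b" if "y \<in> S" for y
      using frechet_derivative_cong_open[OF S that Cons.prems(1)] by simp
  qed (rule Cons.prems(2))
qed simp

lemma iter_pderiv_lincomb:
  assumes S: "open S" and x: "x \<in> S"
  shows "Ck_on k f S \<Longrightarrow> Ck_on k g S \<Longrightarrow> set bs \<subseteq> Basis \<Longrightarrow> length bs \<le> k \<Longrightarrow>
    iter_pderiv bs (\<lambda>x. f x + c *\<^sub>R g x) x = iter_pderiv bs f x + c *\<^sub>R iter_pderiv bs g x"
proof (induction bs arbitrary: k f g)
  case (Cons b bs)
  then obtain k' where k': "k = Suc k'" by (cases k) auto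
  have "iter_pderiv (b # bs) (\<lambda>x. f x + c *\<^sub>R g x) x =
      iter_pderiv bs (\<lambda>x. frechet_derivative f (at x) b + c *\<^sub>R frechet_derivative g (at x) b) x"
    using Cons.prems k' by (auto intro!: iter_pderiv_cong[OF S _ x] frechet_derivative_lincomb)
  also have "\<dots> = iter_pderiv (b # bs) f x + c *\<^sub>R iter_pderiv (b # bs) g x"
    using Cons.IH[of k' "\<lambda>x. frechet_derivative f (at x) b" "\<lambda>x. frechet_derivative g (at x) b"] Cons.prems k'
    by simp
  finally show ?case .
qed simp

lemma continuous_on_iter_pderiv:
  "Ck_on k f S \<Longrightarrow> set bs \<subseteq> Basis \<Longrightarrow> length bs \<le> k \<Longrightarrow> continuous_on S (iter_pderiv bs f)"
proof (induction bs arbitrary: k f)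
  case Nil
  then show ?case by (simp add: Ck_on_continuous)
next
  case (Cons b bs)
  then show ?case by (cases k) auto
qed

text \<open>\<open>Ck_on\<close> tests derivatives along \<open>Basis\<close>, so the chain rule
  stays within the recursion when \<open>L\<close> sends basis vectors to basis vectors or 0. This
  covers coordinate projections followed by the inclusion of a factor.\<close>

lemma Ck_on_affine:
  fixes L :: "'a::euclidean_space \<Rightarrow> 'b::euclidean_space"
  assumes S: "open S" and T: "open T" and L: "bounded_linear L" "\<And>b. b \<in> Basis \<Longrightarrow> L b \<in> insert 0 Basis"
    and im: "\<And>z. z \<in> T \<Longrightarrow> p + L z \<in> S"
  shows "Ck_on k f S \<Longrightarrow> Ck_on k (\<lambda>z. f (p + L z)) T"
proof (induction k arbitrary: f)
  case 0
  have "continuous_on T (\<lambda>z. p + L z)"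
    by (intro continuous_intros bounded_linear.continuous_on[OF L(1)])
  then show ?case using 0 im by (auto intro: continuous_on_compose2[of S f])
next
  case (Suc k)
  have D: "((\<lambda>z. f (p + L z)) has_derivative (\<lambda>b. frechet_derivative f (at (p + L z)) (L b))) (at z)"
    if "z \<in> T" for z
  proof -
    have "((\<lambda>z. p + L z) has_derivative L) (at z)"
      using has_derivative_add[OF has_derivative_const bounded_linear_imp_has_derivative[OF L(1)]] by simp
    moreover have "(f has_derivative frechet_derivative f (at (p + L z))) (at (p + L z))"
      using Suc.prems im[OF that] by (simp add: frechet_derivative_works)
    ultimately show ?thesis using has_derivative_compose by blast
  qed
  have "Ck_on k (\<lambda>z. frechet_derivative (\<lambda>z. f (p + L z)) (at z) b) T" if b: "b \<in> Basis" for b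
  proof -
    have eq: "frechet_derivative (\<lambda>z. f (p + L z)) (at z) b = frechet_derivative f (at (p + L z)) (L b)"
      if "z \<in> T" for z using frechet_derivative_at[OF D[OF that]] by metis
    have "Ck_on k (\<lambda>z. frechet_derivative f (at (p + L z)) (L b)) T"
    proof (cases "L b = 0")
      case True
      have "frechet_derivative f (at (p + L z)) (L b) = 0" if "z \<in> T" for z
        unfolding True using Suc.prems im[OF that] by (simp add: linear_frechet_derivative linear_0)
      then show ?thesis by (rule Ck_on_cong[OF T, THEN iffD2]) (simp_all add: Ck_on_const)
    next
      case False
      then have "Ck_on k (\<lambda>x. frechet_derivative f (at x) (L b)) S" using Suc.prems L(2)[OF b] by simp
      then show ?thesis by (rule Suc.IH)
    qed
    then show ?thesis using Ck_on_cong[OF T eq] by simp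
  qed
  moreover have "(\<lambda>z. f (p + L z)) differentiable (at z)" if "z \<in> T" for z
    using D[OF that] unfolding differentiable_def by blast
  ultimately show ?case by simp
qed

section \<open>Charts and product atlases\<close>

lemma chart_inv_chart: "is_chart c \<Longrightarrow> x \<in> fst c \<Longrightarrow> chart_inv c (snd c x) = x"
  unfolding is_chart_def by (auto dest: homeomorphism_apply1)

lemma chart_chart_inv: "is_chart c \<Longrightarrow> a \<in> snd c ` fst c \<Longrightarrow> snd c (chart_inv c a) = a"
  unfolding is_chart_def by (auto dest: homeomorphism_apply2)

lemma chart_inv_mem: "a \<in> snd c ` fst c \<Longrightarrow> chart_inv c a \<in> fst c"
  unfolding chart_inv_def by (rule inv_into_into)

lemma chart_inv_prod:
  assumes "is_chart c" "is_chart c'" "a \<in> snd c ` fst c" "b \<in> snd c' ` fst c'"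
  shows "chart_inv (fst c \<times> fst c', map_prod (snd c) (snd c')) (a, b) = (chart_inv c a, chart_inv c' b)"
proof -
  have "inj_on (snd c) (fst c)" "inj_on (snd c') (fst c')"
    using assms(1,2) by (metis chart_inv_chart inj_on_inverseI)+
  then have inj: "inj_on (map_prod (snd c) (snd c')) (fst c \<times> fst c')" by (rule map_prod_inj_on)
  have ab: "(a, b) = map_prod (snd c) (snd c') (chart_inv c a, chart_inv c' b)"
    using assms by (simp add: chart_chart_inv)
  show ?thesis
    unfolding chart_inv_def[of "(_, _)"] fst_conv snd_conv
    by (rule inv_into_f_eq[OF inj _ ab[symmetric]]) (use assms(3,4) in \<open>simp_all add: chart_inv_mem\<close>)
qed

lemma is_chart_prod:
  assumes c: "is_chart c" "is_chart c'"
  shows "is_chart (fst c \<times> fst c', map_prod (snd c) (snd c'))"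
proof -
  let ?d = "(fst c \<times> fst c', map_prod (snd c) (snd c'))"
  have im: "snd ?d ` fst ?d = snd c ` fst c \<times> snd c' ` fst c'" by force
  have h: "homeomorphism (fst c) (snd c ` fst c) (snd c) (chart_inv c)"
    "homeomorphism (fst c') (snd c' ` fst c') (snd c') (chart_inv c')"
    using c by (auto simp: is_chart_def)
  have cont: "continuous_on (fst c \<times> fst c') (map_prod (snd c) (snd c'))"
    using h unfolding map_prod_def case_prod_unfold homeomorphism_def
    by (intro continuous_on_Pair continuous_on_compose2[OF _ continuous_on_fst[OF continuous_on_id]]
        continuous_on_compose2[OF _ continuous_on_snd[OF continuous_on_id]]) auto
  have "continuous_on (snd c ` fst c \<times> snd c' ` fst c') (map_prod (chart_inv c) (chart_inv c'))"
    using h unfolding map_prod_def case_prod_unfold homeomorphism_def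
    by (intro continuous_on_Pair continuous_on_compose2[OF _ continuous_on_fst[OF continuous_on_id]]
        continuous_on_compose2[OF _ continuous_on_snd[OF continuous_on_id]]) auto
  then have cont': "continuous_on (snd c ` fst c \<times> snd c' ` fst c') (chart_inv ?d)"
    by (rule continuous_on_cong[THEN iffD1, rotated 2]) (auto simp: chart_inv_prod[OF c])
  have "homeomorphism (fst ?d) (snd ?d ` fst ?d) (snd ?d) (chart_inv ?d)"
    unfolding im using cont cont' c
    by (intro homeomorphismI) (auto simp: chart_inv_prod chart_inv_chart chart_chart_inv intro: chart_inv_mem)
  then show ?thesis
    unfolding is_chart_def im using c by (auto simp: is_chart_def intro: open_Times)
qed

lemma prod_atlas_eq:
  "prod_atlas A B = {(fst c \<times> fst c', map_prod (snd c) (snd c')) | c c'. c \<in> A \<and> c' \<in> B}"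
  unfolding prod_atlas_def by force

lemma prod_atlasI:
  "c \<in> A \<Longrightarrow> c' \<in> B \<Longrightarrow> (fst c \<times> fst c', map_prod (snd c) (snd c')) \<in> prod_atlas A B"
  unfolding prod_atlas_eq by blast

lemma prod_atlasE:
  assumes "d \<in> prod_atlas A B"
  obtains c c' where "d = (fst c \<times> fst c', map_prod (snd c) (snd c'))" "c \<in> A" "c' \<in> B"
  using assms unfolding prod_atlas_eq by blast

lemma smooth_atlas_is_chart: "smooth_atlas A \<Longrightarrow> c \<in> A \<Longrightarrow> is_chart c"
  by (simp add: smooth_atlas_def)

lemma prod_atlas_is_chart:
  assumes "smooth_atlas A" "d \<in> prod_atlas A A" shows "is_chart d"
  using assms(2) by (rule prod_atlasE) (simp add: is_chart_prod smooth_atlas_is_chart[OF assms(1)])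

lemma prod_atlas_cover:
  assumes "smooth_atlas A"
  obtains d where "d \<in> prod_atlas A A" "z \<in> fst d"
proof -
  obtain c c' where "c \<in> A" "fst z \<in> fst c" "c' \<in> A" "snd z \<in> fst c'"
    using assms unfolding smooth_atlas_def by (metis UNIV_I UN_E)
  then show ?thesis using that[OF prod_atlasI] by (auto simp: mem_Times_iff)
qed

lemma Ck_functions_lincomb:
  assumes A: "\<And>c. c \<in> A \<Longrightarrow> is_chart c" and "f \<in> Ck_functions k A" "g \<in> Ck_functions k A"
  shows "(\<lambda>x. f x + c * g x) \<in> Ck_functions k A"
  unfolding Ck_functions_def
proof (intro CollectI ballI)
  fix d assume d: "d \<in> A"
  then have "open (snd d ` fst d)" using A by (simp add: is_chart_def)
  moreover have "Ck_on k (f \<circ> chart_inv d) (snd d ` fst d)" "Ck_on k (g \<circ> chart_inv d) (snd d ` fst d)"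
    using assms(2,3) d by (auto simp: Ck_functions_def)
  ultimately show "Ck_on k ((\<lambda>x. f x + c * g x) \<circ> chart_inv d) (snd d ` fst d)"
    using Ck_on_lincomb[of _ k "f \<circ> chart_inv d" "g \<circ> chart_inv d" c] by (simp add: comp_def)
qed

lemma Ck_functions_continuous:
  assumes A: "\<And>c. c \<in> A \<Longrightarrow> is_chart c" "(\<Union>c\<in>A. fst c) = UNIV" and f: "f \<in> Ck_functions k A"
  shows "continuous_on UNIV f"
proof -
  have "continuous_on (fst c) f" if c: "c \<in> A" for c
  proof -
    have "continuous_on (snd c ` fst c) (f \<circ> chart_inv c)"
      using f c unfolding Ck_functions_def by (blast intro: Ck_on_continuous)
    moreover have "continuous_on (fst c) (snd c)"
      using A(1)[OF c] by (simp add: is_chart_def homeomorphism_def)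
    ultimately have "continuous_on (fst c) (\<lambda>x. (f \<circ> chart_inv c) (snd c x))"
      by (rule continuous_on_compose2) auto
    then show ?thesis
      by (rule continuous_on_cong[THEN iffD1, rotated 2]) (auto simp: chart_inv_chart[OF A(1)[OF c]])
  qed
  then have "continuous_on (\<Union>c\<in>A. fst c) f"
    using A(1) by (intro continuous_on_open_UN) (auto simp: is_chart_def)
  then show ?thesis by (simp add: A(2))
qed

lemma prod_atlas_UN:
  assumes "smooth_atlas A" shows "(\<Union>c\<in>prod_atlas A A. fst c) = UNIV"
  using prod_atlas_cover[OF assms] by (metis UNIV_eq_I UN_I)

lemma Ck_sym_continuous:
  assumes "smooth_atlas A" "V \<in> Ck_sym k A"
  shows "continuous_on UNIV V"
  using assms by (intro Ck_functions_continuous[OF prod_atlas_is_chart[OF assms(1)] prod_atlas_UN[OF assms(1)]])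
    (auto simp: Ck_sym_def)

text \<open>In product charts, V(z, .) is the representation of V restricted to an affine copy of
  the second factor through the coordinates of z, so no derivative is lost.\<close>

lemma Ck_sym_slice:
  assumes A: "smooth_atlas A" and V: "V \<in> Ck_sym k A"
  shows "(\<lambda>w. V (z, fst w) + V (z, snd w)) \<in> Ck_sym k A"
proof -
  obtain c0 where c0: "c0 \<in> A" "z \<in> fst c0" using A unfolding smooth_atlas_def by blast
  have "Ck_on k ((\<lambda>w. V (z, fst w) + V (z, snd w)) \<circ> chart_inv d) (snd d ` fst d)"
    if d': "d \<in> prod_atlas A A" for d
  proof -
    obtain c c' where d: "d = (fst c \<times> fst c', map_prod (snd c) (snd c'))" and c: "c \<in> A" "c' \<in> A"
      using d' by (rule prod_atlasE)
    have ch: "is_chart c0" "is_chart c" "is_chart c'" using A c c0 by (auto intro: smooth_atlas_is_chart)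
    define T where "T = snd c ` fst c \<times> snd c' ` fst c'"
    have T: "open T" "snd d ` fst d = T"
      unfolding T_def d using ch by (auto simp: is_chart_def intro!: open_Times)
    \<comment> \<open>Stated for a general projection \<pi>, since it is applied to
      \<open>fst\<close> and to \<open>snd\<close>.\<close>
    have *: "Ck_on k (\<lambda>w. V (z, chart_inv e (\<pi> w))) T"
      if e: "e \<in> A" and \<pi>: "bounded_linear \<pi>" "\<And>w. w \<in> T \<Longrightarrow> \<pi> w \<in> snd e ` fst e"
        "\<And>b. b \<in> Basis \<Longrightarrow> \<pi> b \<in> insert 0 Basis" for e and \<pi> :: "'b \<times> 'b \<Rightarrow> 'b"
    proof -
      let ?e = "(fst c0 \<times> fst e, map_prod (snd c0) (snd e))"
      have che: "is_chart e" using A e by (rule smooth_atlas_is_chart)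
      have im: "snd ?e ` fst ?e = snd c0 ` fst c0 \<times> snd e ` fst e" by force
      have "Ck_on k (V \<circ> chart_inv ?e) (snd ?e ` fst ?e)"
        using V prod_atlasI[OF c0(1) e] unfolding Ck_sym_def Ck_functions_def by blast
      then have "Ck_on k (\<lambda>w. (V \<circ> chart_inv ?e) ((snd c0 z, 0) + (0, \<pi> w))) T"
        unfolding im
      proof (rule Ck_on_affine[rotated -1])
        show "open (snd c0 ` fst c0 \<times> snd e ` fst e)"
          using ch(1) che by (auto simp: is_chart_def intro: open_Times)
        show "bounded_linear (\<lambda>w. (0::'b, \<pi> w))"
          by (intro bounded_linear_Pair bounded_linear_zero \<pi>(1))
        show "(0, \<pi> b) \<in> insert 0 Basis" if "b \<in> Basis" for b
          using \<pi>(3)[OF that] by (auto simp: Basis_prod_def zero_prod_def)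
        show "(snd c0 z, 0) + (0, \<pi> w) \<in> snd c0 ` fst c0 \<times> snd e ` fst e" if "w \<in> T" for w
          using \<pi>(2)[OF that] c0(2) by simp
      qed (rule T(1))
      then show ?thesis
        by (rule Ck_on_cong[OF T(1), THEN iffD1, rotated])
          (use \<pi>(2) c0(2) ch(1) che in \<open>simp add: chart_inv_prod chart_inv_chart\<close>)
    qed
    have "Ck_on k (\<lambda>w. V (z, chart_inv c (fst w)) + 1 *\<^sub>R V (z, chart_inv c' (snd w))) T"
      by (intro Ck_on_lincomb T(1) * c bounded_linear_fst bounded_linear_snd)
        (auto simp: T_def Basis_prod_def)
    then show ?thesis
      unfolding T(2)
      by (rule Ck_on_cong[OF T(1), THEN iffD1, rotated])
        (auto simp: d T_def chart_inv_prod[OF ch(2,3)])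
  qed
  then show ?thesis unfolding Ck_sym_def Ck_functions_def by (auto simp: add.commute)
qed

section \<open>Small finite sums and uniform neighbourhoods\<close>

lemma Ck_functions_sum:
  assumes A: "\<And>c. c \<in> A \<Longrightarrow> is_chart c" and g: "g \<in> Ck_functions k A"
    and Z: "finite Z" "\<And>z. z \<in> Z \<Longrightarrow> w z \<in> Ck_functions k A"
  shows "(\<lambda>x. g x + (\<Sum>z\<in>Z. t z * w z x)) \<in> Ck_functions k A"
  using Z
proof (induction Z rule: finite_induct)
  case (insert z Z)
  then have "(\<lambda>x. (g x + (\<Sum>z\<in>Z. t z * w z x)) + t z * w z x) \<in> Ck_functions k A"
    by (intro Ck_functions_lincomb[OF A]) auto
  then show ?case using insert.hyps by (simp add: algebra_simps)
qed (use g in simp)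

lemma iter_pderiv_sum:
  assumes A: "\<And>c. c \<in> A \<Longrightarrow> is_chart c" and g: "g \<in> Ck_functions k A"
    and c: "c \<in> A" and x: "x \<in> snd c ` fst c" and bs: "set bs \<subseteq> Basis" "length bs \<le> k"
    and Z: "finite Z" "\<And>z. z \<in> Z \<Longrightarrow> w z \<in> Ck_functions k A"
  shows "iter_pderiv bs ((\<lambda>x. g x + (\<Sum>z\<in>Z. t z * w z x)) \<circ> chart_inv c) x =
      iter_pderiv bs (g \<circ> chart_inv c) x + (\<Sum>z\<in>Z. t z * iter_pderiv bs (w z \<circ> chart_inv c) x)"
  using Z
proof (induction Z rule: finite_induct)
  case (insert z Z)
  let ?s = "(\<lambda>x. g x + (\<Sum>z\<in>Z. t z * w z x)) \<circ> chart_inv c"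
  have op: "open (snd c ` fst c)" using A[OF c] by (simp add: is_chart_def)
  have 1: "Ck_on k ?s (snd c ` fst c)"
    using Ck_functions_sum[OF A g insert.hyps(1), of w t] insert.prems c unfolding Ck_functions_def by blast
  have 2: "Ck_on k (w z \<circ> chart_inv c) (snd c ` fst c)"
    using insert.prems c unfolding Ck_functions_def by blast
  have eq: "(\<lambda>x. g x + (\<Sum>z\<in>insert z Z. t z * w z x)) \<circ> chart_inv c = (\<lambda>y. ?s y + t z *\<^sub>R (w z \<circ> chart_inv c) y)"
    using insert.hyps by (intro ext) (simp add: algebra_simps)
  have "iter_pderiv bs ?s x =
      iter_pderiv bs (g \<circ> chart_inv c) x + (\<Sum>z\<in>Z. t z * iter_pderiv bs (w z \<circ> chart_inv c) x)"
    by (rule insert.IH) (use insert.prems in blast)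
  then show ?case
    unfolding eq iter_pderiv_lincomb[OF op x 1 2 bs]
    by (simp only: sum.insert[OF insert.hyps] real_scaleR_def add_ac)
qed simp

text \<open>Induction over the generation of the open sets. For a subbasic neighbourhood, the
  derivatives of the finitely many w z are bounded on the compact K, and linearity of
  \<open>iter_pderiv\<close> makes the change small with the coefficients.\<close>

lemma Ck_topology_add_small:
  assumes A: "\<And>c. c \<in> A \<Longrightarrow> is_chart c" and U: "openin (Ck_topology k A) U" and f: "f \<in> U"
    and Z: "finite Z" and w: "\<And>z. z \<in> Z \<Longrightarrow> w z \<in> Ck_functions k A"
  shows "\<exists>\<delta>>0. \<forall>t. (\<forall>z\<in>Z. \<bar>t z\<bar> < \<delta>) \<longrightarrow> (\<lambda>x. f x + (\<Sum>z\<in>Z. t z * w z x)) \<in> U"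
  using openin_topology_generated_by[OF U[unfolded Ck_topology_def]] f
proof (induction arbitrary: f)
  case Empty
  then show ?case by simp
next
  case (Int a b)
  obtain \<delta> where "\<delta> > 0" "\<And>t. \<forall>z\<in>Z. \<bar>t z\<bar> < \<delta> \<Longrightarrow> (\<lambda>x. f x + (\<Sum>z\<in>Z. t z * w z x)) \<in> a"
    using Int.IH(1)[of f] Int.prems by blast
  moreover obtain \<delta>' where "\<delta>' > 0" "\<And>t. \<forall>z\<in>Z. \<bar>t z\<bar> < \<delta>' \<Longrightarrow> (\<lambda>x. f x + (\<Sum>z\<in>Z. t z * w z x)) \<in> b"
    using Int.IH(2)[of f] Int.prems by blast
  ultimately show ?case by (intro exI[of _ "min \<delta> \<delta>'"]) auto
next
  case (UN K)
  then show ?case by (meson UnionE UnionI)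
next
  case (Basis s)
  then obtain f0 c K bs \<epsilon> where s: "s = Ck_nbhd k A f0 c K bs \<epsilon>" and f0: "f0 \<in> Ck_functions k A" and c: "c \<in> A"
    and K: "compact K" "K \<subseteq> snd c ` fst c" and bs: "set bs \<subseteq> Basis" "length bs \<le> k" and "\<epsilon> > 0" by blast
  have fC: "f \<in> Ck_functions k A"
    and fK: "\<And>x. x \<in> K \<Longrightarrow> \<bar>iter_pderiv bs (f \<circ> chart_inv c) x - iter_pderiv bs (f0 \<circ> chart_inv c) x\<bar> < \<epsilon>"
    using Basis.prems unfolding s Ck_nbhd_def by auto
  have cont: "continuous_on K (iter_pderiv bs (h \<circ> chart_inv c))" if "h \<in> Ck_functions k A" for h
  proof -
    have "Ck_on k (h \<circ> chart_inv c) (snd c ` fst c)" using that c unfolding Ck_functions_def by blast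
    from continuous_on_iter_pderiv[OF this bs] show ?thesis using K(2) continuous_on_subset by blast
  qed
  have "\<exists>B. \<forall>x\<in>K. \<bar>iter_pderiv bs (w z \<circ> chart_inv c) x\<bar> \<le> B" if "z \<in> Z" for z
    using compact_imp_bounded[OF compact_continuous_image[OF cont[OF w[OF that]] K(1)]]
    unfolding bounded_iff by auto
  then obtain B where B: "\<And>z x. z \<in> Z \<Longrightarrow> x \<in> K \<Longrightarrow> \<bar>iter_pderiv bs (w z \<circ> chart_inv c) x\<bar> \<le> B z" by metis
  define B' where "B' = (\<Sum>z\<in>Z. \<bar>B z\<bar>)"
  have B': "B' \<ge> 0" unfolding B'_def by (simp add: sum_nonneg)
  \<comment> \<open>The strict bound is pointwise; compactness of K turns it into a uniform gap
    \<open>\<epsilon> - M\<close>, which leaves room for the sum.\<close>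
  obtain M where M: "M < \<epsilon>"
    "\<And>x. x \<in> K \<Longrightarrow> \<bar>iter_pderiv bs (f \<circ> chart_inv c) x - iter_pderiv bs (f0 \<circ> chart_inv c) x\<bar> \<le> M"
  proof (cases "K = {}")
    case True
    then show ?thesis using that[of 0] \<open>\<epsilon> > 0\<close> by simp
  next
    case False
    have "continuous_on K (\<lambda>x. \<bar>iter_pderiv bs (f \<circ> chart_inv c) x - iter_pderiv bs (f0 \<circ> chart_inv c) x\<bar>)"
      by (intro continuous_intros cont fC f0)
    from continuous_attains_sup[OF K(1) False this]
    obtain x0 where "x0 \<in> K" "\<And>x. x \<in> K \<Longrightarrow> \<bar>iter_pderiv bs (f \<circ> chart_inv c) x - iter_pderiv bs (f0 \<circ> chart_inv c) x\<bar> \<le>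
       \<bar>iter_pderiv bs (f \<circ> chart_inv c) x0 - iter_pderiv bs (f0 \<circ> chart_inv c) x0\<bar>" by auto
    then show ?thesis using that fK by blast
  qed
  define \<delta> where "\<delta> = (\<epsilon> - M) / (B' + 1)"
  have \<delta>: "\<delta> > 0" "\<delta> * B' < \<epsilon> - M" unfolding \<delta>_def using M(1) B' by (auto simp: field_simps)
  have "(\<lambda>x. f x + (\<Sum>z\<in>Z. t z * w z x)) \<in> s" if t: "\<forall>z\<in>Z. \<bar>t z\<bar> < \<delta>" for t
    unfolding s Ck_nbhd_def
  proof (intro CollectI conjI ballI)
    show "(\<lambda>x. f x + (\<Sum>z\<in>Z. t z * w z x)) \<in> Ck_functions k A"
      by (rule Ck_functions_sum[OF A fC Z w])
    fix x assume x: "x \<in> K"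
    have "\<bar>\<Sum>z\<in>Z. t z * iter_pderiv bs (w z \<circ> chart_inv c) x\<bar> \<le> (\<Sum>z\<in>Z. \<delta> * \<bar>B z\<bar>)"
    proof (rule order_trans[OF sum_abs sum_mono])
      fix z assume z: "z \<in> Z"
      have "\<bar>iter_pderiv bs (w z \<circ> chart_inv c) x\<bar> \<le> \<bar>B z\<bar>" using B[OF z x] by linarith
      then show "\<bar>t z * iter_pderiv bs (w z \<circ> chart_inv c) x\<bar> \<le> \<delta> * \<bar>B z\<bar>"
        unfolding abs_mult using t z \<delta>(1) by (intro mult_mono) (auto intro: less_imp_le)
    qed
    also have "\<dots> = \<delta> * B'" by (simp add: B'_def sum_distrib_left)
    finally have "\<bar>\<Sum>z\<in>Z. t z * iter_pderiv bs (w z \<circ> chart_inv c) x\<bar> < \<epsilon> - M" using \<delta>(2) by linarith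
    then show "\<bar>iter_pderiv bs ((\<lambda>x. f x + (\<Sum>z\<in>Z. t z * w z x)) \<circ> chart_inv c) x -
        iter_pderiv bs (f0 \<circ> chart_inv c) x\<bar> < \<epsilon>"
      using iter_pderiv_sum[OF A fC c _ bs Z w, of x] M(2)[OF x] K(2) x by (auto simp: subset_iff)
  qed
  then show ?case using \<delta>(1) by blast
qed

text \<open>The empty list of directions expresses closeness of the functions themselves. Compact
  coordinate balls, finitely many of which cover the product, turn this into a bound on the uniform
  distance.\<close>

lemma Ck_sym_C0_nbhd:
  fixes A :: "('m::t2_space, 'e::euclidean_space) chart set"
  assumes A: "smooth_atlas A" and M: "compact (UNIV :: 'm set)" and V: "V \<in> Ck_sym k A" and e: "e > 0"
  obtains N where "openin (Ck_sym_topology k A) N" "V \<in> N" "\<And>W z. W \<in> N \<Longrightarrow> \<bar>W z - V z\<bar> < e"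
proof -
  define B where "B = prod_atlas A A"
  have VB: "V \<in> Ck_functions k B" using V by (simp add: Ck_sym_def B_def)
  have "\<exists>c K O'. c \<in> B \<and> compact K \<and> K \<subseteq> snd c ` fst c \<and> open O' \<and> z \<in> O' \<and> (\<forall>q\<in>O'. q \<in> fst c \<and> snd c q \<in> K)" for z
  proof -
    obtain c where c: "c \<in> B" "z \<in> fst c" unfolding B_def using prod_atlas_cover[OF A] .
    have ch: "is_chart c" using c(1) prod_atlas_is_chart[OF A] unfolding B_def by blast
    then obtain r where r: "r > 0" "cball (snd c z) r \<subseteq> snd c ` fst c"
      using c(2) unfolding is_chart_def by (meson image_eqI open_contains_cball)
    have "continuous_on (fst c) (snd c)" "open (fst c)" using ch by (auto simp: is_chart_def homeomorphism_def)
    then have "open (snd c -` ball (snd c z) r \<inter> fst c)" by (simp add: continuous_on_open_vimage)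
    then show ?thesis using c r
      by (intro exI[of _ c] exI[of _ "cball (snd c z) r"] exI[of _ "snd c -` ball (snd c z) r \<inter> fst c"])
        (auto simp: less_imp_le)
  qed
  then obtain c K O' where c: "\<And>z. c z \<in> B" "\<And>z. compact (K z)" "\<And>z. K z \<subseteq> snd (c z) ` fst (c z)"
    and O': "\<And>z. open (O' z)" "\<And>z. z \<in> O' z" "\<And>z q. q \<in> O' z \<Longrightarrow> q \<in> fst (c z) \<and> snd (c z) q \<in> K z"
    by metis
  obtain P where P: "finite P" "UNIV \<subseteq> (\<Union>z\<in>P. O' z)"
    by (rule compactE_image[of "UNIV :: ('m \<times> 'm) set" UNIV O'])
      (use O' compact_Times[OF M M] in auto)
  define N where "N = (\<Inter>z\<in>P. Ck_nbhd k B V (c z) (K z) [] e) \<inter> topspace (Ck_topology k B)"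
  have "openin (Ck_topology k B) (Ck_nbhd k B V (c z) (K z) [] e)" for z
    unfolding Ck_topology_def
    by (rule topology_generated_by_Basis, rule CollectI,
        rule exI[of _ V], rule exI[of _ "c z"], rule exI[of _ "K z"], rule exI[of _ "[]"], rule exI[of _ e])
      (simp add: VB c e)
  then have "openin (Ck_topology k B) N" unfolding N_def by (intro openin_INT P(1))
  then have "openin (Ck_sym_topology k A) (Ck_sym k A \<inter> N)"
    unfolding Ck_sym_topology_def B_def by (metis Int_commute openin_subtopology)
  moreover have "V \<in> Ck_sym k A \<inter> N"
  proof -
    have "B \<noteq> {}" using c(1) by blast
    then show ?thesis using V VB e by (simp add: N_def topspace_Ck_topology Ck_nbhd_def)
  qed
  moreover have "\<bar>W q - V q\<bar> < e" if W: "W \<in> Ck_sym k A \<inter> N" for W q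
  proof -
    obtain z where z: "z \<in> P" "q \<in> O' z" using P(2) by blast
    have ch: "is_chart (c z)" using c(1)[of z] prod_atlas_is_chart[OF A] unfolding B_def by blast
    have "W \<in> Ck_nbhd k B V (c z) (K z) [] e" using W z(1) by (simp add: N_def)
    then have "\<bar>(W \<circ> chart_inv (c z)) (snd (c z) q) - (V \<circ> chart_inv (c z)) (snd (c z) q)\<bar> < e"
      using O'(3)[OF z(2)] by (simp add: Ck_nbhd_def)
    then show ?thesis using O'(3)[OF z(2)] by (simp add: chart_inv_chart[OF ch])
  qed
  ultimately show ?thesis by (rule that)
qed

lemma Ck_sym_topology_add_small:
  assumes A: "smooth_atlas A" and U: "openin (Ck_sym_topology k A) U" "W \<in> U"
    and Z: "finite Z" "\<And>z. z \<in> Z \<Longrightarrow> w z \<in> Ck_sym k A"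
  shows "\<exists>\<delta>>0. \<forall>t. (\<forall>z\<in>Z. \<bar>t z\<bar> < \<delta>) \<longrightarrow> (\<lambda>x. W x + (\<Sum>z\<in>Z. t z * w z x)) \<in> U"
proof -
  obtain U' where U': "openin (Ck_topology k (prod_atlas A A)) U'" "U = U' \<inter> Ck_sym k A"
    using U(1) unfolding Ck_sym_topology_def openin_subtopology by blast
  have w: "\<And>z. z \<in> Z \<Longrightarrow> w z \<in> Ck_functions k (prod_atlas A A)" using Z(2) by (auto simp: Ck_sym_def)
  have WU: "W \<in> U'" "W \<in> Ck_sym k A" using U(2) U'(2) by auto
  obtain \<delta> where \<delta>: "\<delta> > 0" "\<And>t. \<forall>z\<in>Z. \<bar>t z\<bar> < \<delta> \<Longrightarrow> (\<lambda>x. W x + (\<Sum>z\<in>Z. t z * w z x)) \<in> U'"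
    using Ck_topology_add_small[of "prod_atlas A A" k U' W Z w]
      prod_atlas_is_chart[OF A] U'(1) WU(1) Z(1) w by blast
  have "(\<lambda>x. W x + (\<Sum>z\<in>Z. t z * w z x)) \<in> Ck_sym k A" for t
    using Ck_functions_sum[of "prod_atlas A A" W k Z w t] prod_atlas_is_chart[OF A] Z(1) w WU(2) Z(2)
    unfolding Ck_sym_def by (auto intro!: sum.cong)
  then show ?thesis using \<delta> U'(2) by blast
qed

section \<open>The Riemannian probability\<close>

text \<open>The segment from the identity to A consists of matrices that are positive on nonzero
  vectors, hence invertible; the determinant is 1 at the identity and cannot change sign.\<close>

lemma det_pos_of_positive_definite:
  fixes A :: "real^'n^'n"
  assumes A: "\<And>v. v \<noteq> 0 \<Longrightarrow> v \<bullet> (A *v v) > 0"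
  shows "det A > 0"
proof (rule ccontr)
  assume neg: "\<not> det A > 0"
  define B where "B s = s *\<^sub>R A + (1 - s) *\<^sub>R mat 1" for s :: real
  have "continuous_on {0..1} (\<lambda>s. det (B s))"
    unfolding det_def B_def by (intro continuous_intros)
  moreover have "det (B 0) \<ge> 0" "det (B 1) \<le> 0" using neg by (simp_all add: B_def)
  ultimately obtain s where s: "0 \<le> s" "s \<le> 1" "det (B s) = 0"
    using IVT2'[of "\<lambda>s. det (B s)" 1 0 0] by auto
  then have "\<not> invertible (B s)" by (simp add: invertible_det_nz)
  then obtain v where v: "v \<noteq> 0" "B s *v v = 0"
    using invertible_left_inverse[of "B s"] matrix_left_invertible_ker[of "B s"] by blast
  have "v \<bullet> (B s *v v) = s * (v \<bullet> (A *v v)) + (1 - s) * (v \<bullet> v)"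
    by (simp add: B_def matrix_vector_mult_add_rdistrib scaleR_matrix_vector_assoc[symmetric] inner_add_right)
  moreover have "\<dots> > 0"
  proof (cases "s = 0")
    case False
    then have "s * (v \<bullet> (A *v v)) > 0" using s A[OF v(1)] by simp
    moreover have "(1 - s) * (v \<bullet> v) \<ge> 0" using s by simp
    ultimately show ?thesis by linarith
  qed (use v in simp)
  ultimately show False using v(2) by simp
qed

text \<open>On a compact coordinate ball the volume density has a positive minimum and a finite
  maximum, so comparison with Lebesgue measure gives both bounds. Finiteness is for the total
  volume, positivity for the full support.\<close>

lemma riemannian_volume_chart_ball:
  fixes A :: "('m::{t2_space,second_countable_topology}, real^'n) chart set"
  assumes A: "smooth_atlas A" and G: "riemannian_metric A G" and vol: "riemannian_volume A G vol"
    and U: "open U" "p \<in> U"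
  obtains B where "open B" "p \<in> B" "B \<subseteq> U" "0 < emeasure vol B" "emeasure vol B < \<infinity>"
proof -
  obtain c where c: "c \<in> A" "p \<in> fst c" using A unfolding smooth_atlas_def by blast
  have ch: "is_chart c" by (rule smooth_atlas_is_chart[OF A c(1)])
  have op: "open (fst c)" "open (snd c ` fst c)" and cont: "continuous_on (fst c) (snd c)"
    and cont': "continuous_on (snd c ` fst c) (chart_inv c)"
    using ch by (auto simp: is_chart_def homeomorphism_def)
  define x where "x = snd c p"
  have im: "snd c ` (U \<inter> fst c) = chart_inv c -` U \<inter> snd c ` fst c"
    by (force simp: chart_inv_chart[OF ch] chart_chart_inv[OF ch] chart_inv_mem)
  have "open (snd c ` (U \<inter> fst c))"
    unfolding im using continuous_on_open_vimage[OF op(2)] cont' U(1) by blast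
  moreover have "x \<in> snd c ` (U \<inter> fst c)" using U(2) c(2) by (simp add: x_def)
  ultimately obtain r where r: "r > 0" "cball x r \<subseteq> snd c ` (U \<inter> fst c)"
    by (meson open_contains_cball)
  have sub: "cball x r \<subseteq> snd c ` fst c" using r(2) by blast
  have "continuous_on (snd c ` fst c) (G c)"
    using G c(1) unfolding riemannian_metric_def smooth_on_def by (metis Ck_on.simps(1))
  then have Gc: "continuous_on (cball x r) (G c)" using sub by (rule continuous_on_subset)
  have dc: "continuous_on (cball x r) (\<lambda>y. sqrt (det (G c y)))"
    unfolding det_def by (intro continuous_intros Gc)
  have ne: "cball x r \<noteq> {}" using r(1) by simp
  obtain y1 where y1: "y1 \<in> cball x r" "\<And>y. y \<in> cball x r \<Longrightarrow> sqrt (det (G c y1)) \<le> sqrt (det (G c y))"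
    using continuous_attains_inf[OF compact_cball ne dc] by blast
  obtain y2 where y2: "\<And>y. y \<in> cball x r \<Longrightarrow> sqrt (det (G c y)) \<le> sqrt (det (G c y2))"
    using continuous_attains_sup[OF compact_cball ne dc] by blast
  have pos: "sqrt (det (G c y1)) > 0"
  proof -
    have "y1 \<in> snd c ` fst c" using y1(1) sub by blast
    then have "\<forall>v. v \<noteq> 0 \<longrightarrow> v \<bullet> (G c y1 *v v) > 0"
      using G c(1) unfolding riemannian_metric_def by blast
    then show ?thesis using det_pos_of_positive_definite[of "G c y1"] by simp
  qed
  define B where "B = fst c \<inter> snd c -` ball x r"
  have "open B" unfolding B_def using continuous_on_open_vimage[OF op(1)] cont open_ball
    by (metis Int_commute)
  have sB: "snd c ` B = ball x r"
  proof
    show "ball x r \<subseteq> snd c ` B"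
    proof
      fix y assume y: "y \<in> ball x r"
      then have "y \<in> snd c ` fst c" using sub by auto
      then have "snd c (chart_inv c y) = y" "chart_inv c y \<in> fst c"
        by (auto intro: chart_chart_inv[OF ch] chart_inv_mem)
      then show "y \<in> snd c ` B" using y unfolding B_def by (intro image_eqI[of _ _ "chart_inv c y"]) auto
    qed
  qed (auto simp: B_def)
  have BU: "B \<subseteq> U"
  proof
    fix q assume q: "q \<in> B"
    then have "snd c q \<in> snd c ` (U \<inter> fst c)" using r(2) unfolding B_def by auto
    then obtain q' where "q' \<in> U \<inter> fst c" "snd c q = snd c q'" by blast
    moreover from this have "q = q'" using q chart_inv_chart[OF ch] unfolding B_def by (metis IntD1 IntD2)
    ultimately show "q \<in> U" by blast
  qed
  have "B \<in> sets borel" "B \<subseteq> fst c" using \<open>open B\<close> by (auto simp: B_def)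
  then have vB: "emeasure vol B = (\<integral>\<^sup>+y\<in>ball x r. ennreal (sqrt (det (G c y))) \<partial>lborel)"
    using vol c(1) sB unfolding riemannian_volume_def by simp
  have "(\<integral>\<^sup>+y\<in>ball x r. ennreal (sqrt (det (G c y1))) \<partial>lborel) \<le> emeasure vol B"
    unfolding vB using y1(2) by (intro nn_integral_mono) (auto split: split_indicator intro!: ennreal_leI)
  moreover have "(\<integral>\<^sup>+y\<in>ball x r. ennreal (sqrt (det (G c y1))) \<partial>lborel) =
      ennreal (sqrt (det (G c y1))) * emeasure lborel (ball x r)"
    by (rule nn_integral_cmult_indicator) simp
  moreover have "emeasure lborel (ball x r) > 0"
    using content_ball_pos[OF r(1), of x] emeasure_lborel_ball_finite[of x r]
    by (simp add: emeasure_eq_ennreal_measure less_top)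
  then have "0 < ennreal (sqrt (det (G c y1))) * emeasure lborel (ball x r)"
    using pos by (simp add: ennreal_zero_less_mult_iff)
  ultimately have "0 < emeasure vol B" by (simp only: less_le_trans)
  have "emeasure vol B \<le> (\<integral>\<^sup>+y\<in>ball x r. ennreal (sqrt (det (G c y2))) \<partial>lborel)"
    unfolding vB using y2 by (intro nn_integral_mono) (auto split: split_indicator intro!: ennreal_leI)
  also have "\<dots> = ennreal (sqrt (det (G c y2))) * emeasure lborel (ball x r)"
    by (rule nn_integral_cmult_indicator) simp
  also have "\<dots> < \<infinity>" using emeasure_lborel_ball_finite[of x r] by (simp add: ennreal_mult_less_top)
  finally have "emeasure vol B < \<infinity>" .
  with \<open>0 < emeasure vol B\<close> \<open>open B\<close> BU show ?thesis
    by (intro that[of B]) (use c(2) r(1) in \<open>auto simp: B_def x_def\<close>)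
qed

text \<open>Finitely many balls of finite volume cover the manifold, and every nonempty open set
  contains a ball of positive volume. So the total volume is positive and finite: normalisation
  yields a probability and preserves positivity.\<close>

lemma riemannian_probability_full_support:
  fixes A :: "('m::{t2_space,second_countable_topology}, real^'n) chart set"
  assumes M: "compact_riemannian_manifold A G" and lam: "riemannian_probability A G lam"
  shows "compact_prob lam" "\<And>U. open U \<Longrightarrow> U \<noteq> {} \<Longrightarrow> emeasure lam U \<noteq> 0"
proof -
  have A: "smooth_atlas A" "riemannian_metric A G" and cM: "compact (UNIV :: 'm set)"
    using M by (auto simp: compact_riemannian_manifold_def)
  obtain vol where vol: "riemannian_volume A G vol"
    and lam_eq: "lam = scale_measure (inverse (emeasure vol UNIV)) vol"
    using lam unfolding riemannian_probability_def by blast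
  have sv: "sets vol = sets borel" using vol by (simp add: riemannian_volume_def)
  have "\<exists>B. open B \<and> p \<in> B \<and> emeasure vol B < \<infinity>" for p
    using riemannian_volume_chart_ball[OF A vol open_UNIV UNIV_I, of p] by metis
  then obtain B where B: "\<And>p. open (B p)" "\<And>p. p \<in> B p" "\<And>p. emeasure vol (B p) < \<infinity>" by metis
  obtain P where P: "finite P" "UNIV \<subseteq> (\<Union>p\<in>P. B p)"
    by (rule compactE_image[OF cM, of UNIV B]) (use B in auto)
  have "emeasure vol UNIV \<le> emeasure vol (\<Union>p\<in>P. B p)"
    using P(2) B(1) by (intro emeasure_mono) (auto simp: sv intro!: borel_open)
  also have "\<dots> \<le> (\<Sum>p\<in>P. emeasure vol (B p))"
    using B(1) by (intro emeasure_subadditive_finite P(1)) (auto simp: sv)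
  also have "\<dots> < \<infinity>" using P(1) B(3) by (simp add: less_top)
  finally have fin: "emeasure vol UNIV < \<infinity>" .
  have pos: "emeasure vol U > 0" if U: "open U" "U \<noteq> {}" for U
  proof -
    obtain p where "p \<in> U" using U(2) by blast
    then obtain C where "open C" "C \<subseteq> U" "0 < emeasure vol C"
      using riemannian_volume_chart_ball[OF A vol U(1)] by metis
    moreover from this have "emeasure vol C \<le> emeasure vol U"
      using U(1) by (intro emeasure_mono) (auto simp: sv)
    ultimately show ?thesis by (metis less_le_trans)
  qed
  have p1: "emeasure vol UNIV > 0" by (rule pos) auto
  have "emeasure lam UNIV = 1"
  proof (cases "emeasure vol UNIV")
    case (real r)
    then show ?thesis
      unfolding lam_eq using p1 by (simp add: inverse_ennreal flip: ennreal_mult)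
  qed (use fin in simp)
  moreover have sl: "sets lam = sets borel" by (simp add: lam_eq sv)
  moreover have "space lam = UNIV" using sets_eq_imp_space_eq[OF sl] by simp
  ultimately show "compact_prob lam"
    unfolding compact_prob_def using cM by (auto intro: prob_spaceI)
  show "emeasure lam U \<noteq> 0" if "open U" "U \<noteq> {}" for U
    unfolding lam_eq using pos[OF that] fin by (auto simp: ennreal_inverse_eq_0_iff)
qed

theorem theorem2p10:
  fixes A :: "('m::{t2_space,second_countable_topology}, real^'n) chart set"
    and G :: "('m, real^'n) chart \<Rightarrow> real^'n \<Rightarrow> real^'n^'n"
    and lam :: "'m measure"
    and k :: nat
  assumes "compact_riemannian_manifold A G"
    and "riemannian_probability A G lam"
  shows "openin (Ck_sym_topology k A) (nondegenerate_potentials k A lam) \<and>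
    (Ck_sym_topology k A) closure_of (nondegenerate_potentials k A lam) = Ck_sym k A"
proof -
  interpret compact_prob lam by (rule riemannian_probability_full_support(1)[OF assms])
  note supp = riemannian_probability_full_support(2)[OF assms]
  have A: "smooth_atlas A" using assms(1) by (simp add: compact_riemannian_manifold_def)
  have "A \<noteq> {}" using A unfolding smooth_atlas_def by blast
  let ?X = "Ck_sym_topology k A"
  have top: "topspace ?X = Ck_sym k A" by (rule topspace_Ck_sym_topology[OF \<open>A \<noteq> {}\<close>])
  have bc: "apply_bcontfun (Bcontfun V) = V" if "V \<in> Ck_sym k A" for V
    using Ck_sym_continuous[OF A that] by (rule apply_Bcontfun_compact[OF compact_UNIV_Times[OF compact_M]])
  have mem: "apply_bcontfun W \<in> nondegenerate_potentials k A lam \<longleftrightarrow>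
      apply_bcontfun W \<in> Ck_sym k A \<and> \<not> degenerate_on W UNIV" for W
    unfolding nondegenerate_potentials_def using all_nondegenerate_iff[OF supp, of W] by simp
  \<comment> \<open>The C^k topology is transported to the bounded continuous functions, where the
    fixed point theory was developed.\<close>
  define Op where "Op U \<longleftrightarrow> openin ?X (apply_bcontfun ` U)" for U
  \<comment> \<open>Every sup-norm ball contains the kernels of a C^k neighbourhood. Half the radius
    is used because strict pointwise bounds give only a non-strict bound on the supremum.\<close>
  have Op_Int: "Op (U \<inter> S)" if U: "Op U" and S: "open S" for U S
    unfolding Op_def
  proof (subst openin_subopen, intro ballI)
    fix V assume "V \<in> apply_bcontfun ` (U \<inter> S)"
    then obtain W where W: "V = apply_bcontfun W" "W \<in> U" "W \<in> S" by blast
    have V: "V \<in> Ck_sym k A" using openin_subset[OF U[unfolded Op_def]] W(1,2) top by blast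
    obtain e where e: "e > 0" "ball W e \<subseteq> S" using S W(3) open_contains_ball by blast
    then have "e / 2 > 0" by simp
    then obtain N where N: "openin ?X N" "V \<in> N" "\<And>W z. W \<in> N \<Longrightarrow> \<bar>W z - V z\<bar> < e / 2"
      using Ck_sym_C0_nbhd[OF A compact_M V] by metis
    have "apply_bcontfun ` U \<inter> N \<subseteq> apply_bcontfun ` (U \<inter> S)"
    proof
      fix Y assume "Y \<in> apply_bcontfun ` U \<inter> N"
      then obtain Z where Z: "Y = apply_bcontfun Z" "Z \<in> U" "Y \<in> N" by blast
      have "dist Z W \<le> e / 2"
        using N(3)[OF Z(3)] by (intro dist_bound) (simp add: Z(1) W(1) dist_real_def less_imp_le)
      then have "Z \<in> S" using e by (auto simp: dist_commute)
      then show "Y \<in> apply_bcontfun ` (U \<inter> S)" using Z(1,2) by blast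
    qed
    moreover have "openin ?X (apply_bcontfun ` U \<inter> N)"
      using U N(1) unfolding Op_def by (rule openin_Int)
    ultimately show "\<exists>T. openin ?X T \<and> V \<in> T \<and> T \<subseteq> apply_bcontfun ` (U \<inter> S)"
      using W(1,2) N(2) by blast
  qed
  have Op_UNIV: "Op {W. apply_bcontfun W \<in> Ck_sym k A}"
  proof -
    have "apply_bcontfun ` {W. apply_bcontfun W \<in> Ck_sym k A} = topspace ?X"
      unfolding top using bc by (auto simp: image_iff) metis
    then show ?thesis unfolding Op_def by simp
  qed
  \<comment> \<open>In this form \<open>Op_Int\<close> converts openness for uniform convergence
    into openness in the C^k topology.\<close>
  have "nondegenerate_potentials k A lam = apply_bcontfun ` ({W. apply_bcontfun W \<in> Ck_sym k A} \<inter> {W. \<not> degenerate_on W UNIV})"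
  proof (intro equalityI subsetI)
    fix V assume V: "V \<in> nondegenerate_potentials k A lam"
    then have "V \<in> Ck_sym k A" by (simp add: nondegenerate_potentials_def)
    then show "V \<in> apply_bcontfun ` ({W. apply_bcontfun W \<in> Ck_sym k A} \<inter> {W. \<not> degenerate_on W UNIV})"
      using V mem[of "Bcontfun V"] bc[of V] by (intro image_eqI[of _ _ "Bcontfun V"]) auto
  qed (auto simp: mem)
  then have op: "openin ?X (nondegenerate_potentials k A lam)"
    using Op_Int[OF Op_UNIV open_nondegenerate[OF closed_UNIV]] unfolding Op_def by simp
  have "V \<in> ?X closure_of (nondegenerate_potentials k A lam)" if V: "V \<in> Ck_sym k A" for V
    unfolding in_closure_of
  proof (intro conjI allI impI)
    show "V \<in> topspace ?X" using V top by simp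
    fix T assume T: "V \<in> T \<and> openin ?X T"
    define W where "W = Bcontfun V"
    have W: "apply_bcontfun W = V" unfolding W_def by (rule bc[OF V])
    have im: "apply_bcontfun ` (apply_bcontfun -` T) = T"
    proof -
      have "T \<subseteq> Ck_sym k A" using T openin_subset top by blast
      then have "T \<subseteq> range apply_bcontfun" using bc by (metis rangeI subset_iff)
      then show ?thesis by blast
    qed
    \<comment> \<open>\<open>Y\<close> is an arbitrary kernel of the open set, while the slices are
      those of the V to be approximated, whose class C^k is known.\<close>
    have add: "\<exists>\<delta>>0. \<forall>t. (\<forall>z\<in>Z. 0 \<le> t z \<and> t z < \<delta>) \<longrightarrow> Y + sum_kernel (\<Sum>z\<in>Z. t z *\<^sub>R slice W z) \<in> U"
      if U: "Op U" "Y \<in> U" and Z: "finite Z" for U Y Z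
    proof -
      have "apply_bcontfun Y \<in> apply_bcontfun ` U" using U(2) by blast
      from Ck_sym_topology_add_small[OF A U(1)[unfolded Op_def] this Z, of "\<lambda>z w. V (z, fst w) + V (z, snd w)"]
      obtain \<delta> where \<delta>: "\<delta> > 0" "\<And>t. \<forall>z\<in>Z. \<bar>t z\<bar> < \<delta> \<Longrightarrow>
          (\<lambda>x. Y x + (\<Sum>z\<in>Z. t z * (V (z, fst x) + V (z, snd x)))) \<in> apply_bcontfun ` U"
        using Ck_sym_slice[OF A V] by blast
      have "Y + sum_kernel (\<Sum>z\<in>Z. t z *\<^sub>R slice W z) \<in> U" if t: "\<forall>z\<in>Z. 0 \<le> t z \<and> t z < \<delta>" for t
      proof -
        have "apply_bcontfun (Y + sum_kernel (\<Sum>z\<in>Z. t z *\<^sub>R slice W z)) =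
            (\<lambda>x. Y x + (\<Sum>z\<in>Z. t z * (V (z, fst x) + V (z, snd x))))"
          by (rule ext) (simp add: sum_kernel_apply apply_bcontfun_sum slice_apply W distrib_left sum.distrib)
        then have "apply_bcontfun (Y + sum_kernel (\<Sum>z\<in>Z. t z *\<^sub>R slice W z)) \<in> apply_bcontfun ` U"
          using \<delta>(2)[of t] t by simp
        moreover have "inj (apply_bcontfun :: (('m \<times> 'm) \<Rightarrow>\<^sub>C real) \<Rightarrow> _)"
          by (simp add: inj_def apply_bcontfun_inject)
        ultimately show ?thesis by (simp only: inj_image_mem_iff)
      qed
      then show ?thesis using \<delta>(1) by blast
    qed
    have "\<exists>Y\<in>apply_bcontfun -` T. \<not> degenerate_on Y UNIV"
    proof (rule nondegenerate_perturbation[of W Op, OF _ Op_Int add])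
      show "W (x, y) = W (y, x)" for x y using V by (simp add: W Ck_sym_def)
      show "Op (apply_bcontfun -` T)" unfolding Op_def im using T by simp
      show "W \<in> apply_bcontfun -` T" using T W by simp
    qed
    then obtain Y where Y: "apply_bcontfun Y \<in> T" "\<not> degenerate_on Y UNIV" by blast
    then have "apply_bcontfun Y \<in> nondegenerate_potentials k A lam"
      using mem T openin_subset top by blast
    then show "\<exists>y. y \<in> nondegenerate_potentials k A lam \<and> y \<in> T" using Y(1) by blast
  qed
  moreover have "?X closure_of (nondegenerate_potentials k A lam) \<subseteq> Ck_sym k A"
    using closure_of_subset_topspace[of ?X] top by blast
  ultimately show ?thesis using op by blast
qed

end
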